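(* Let $F$ be a fixed finite set of denial constraints. Consider the following nondeterministic algorithm, taking as input an instance $I$ and a priority $\succ$ of $I$ w.r.t. $F$: (1) construct a repair $I'$ of $I$ w.r.t. $F$ with the basic repairing algorithm; (2) if $I'$ is Pareto optimal w.r.t. $\succ$ and $F$, return $I'$; (3) otherwise, return any completion-optimal repair of $I$ w.r.t. $\succ$ and $F$, constructed with the winnow-based repairing algorithm. This algorithm is a sound and complete algorithm constructing Pareto-optimal repairs: every run returns a repair of $I$ w.r.t. $F$ that is Pareto optimal w.r.t. $\succ$ and $F$, and every such Pareto-optimal repair is returned by some run. Moreover it works in time polynomial in the size of $I$ and $\succ$.
   Context: A database schema is a set of relation names of fixed positive arity; each attribute ranges over one of two disjoint infinite domains: the rationals $\mathbb{Q}$ (with built-in predicates $=,\neq,<,\le,>,\ge$) or a set $D$ of uninterpreted constants (with built-in predicates $=,\neq$). A fact is an expression $R(t)$ with $R$ a relation name and $t$ a tuple of constants of the right arity and types. A database instance is a finite set of facts. A denial constraint is a sentence $\forall\bar x.\ \neg[R_1(\bar x_1)\wedge\dots\wedge R_n(\bar x_n)\wedge\varphi(\bar x)]$ with $n>0$, $\bar x_1\cup\dots\cup\bar x_n=\bar x$, and $\varphi$ a quantifier-free formula using only built-in predicates. A set of facts $\{R_1(t_1),\dots,R_n(t_n)\}\subseteq I$ is a conflict in $I$ w.r.t. $F$ if for some denial constraint $\forall\bar x.\ \neg[R_1(\bar x_1)\wedge\dots\wedge R_n(\bar x_n)\wedge\varphi(\bar x)]$ in $F$ there is a substitution $\rho$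 of constants for $\bar x$ such that $\varphi(\rho(\bar x))$ is true and $\rho(\bar x_i)=t_i$ for all $i$; an instance is consistent with $F$ iff it satisfies $F$, i.e. iff it contains no conflict. A repair of $I$ w.r.t. $F$ is a maximal (under inclusion) subset of $I$ consistent with $F$. Two facts of $I$ are neighbors if some conflict contains both. A priority of $I$ w.r.t. $F$ is an acyclic binary relation $\succ$ on $I$ such that $x\succ y$ implies that $x$ and $y$ are neighbors. A priority is total if no different priority of $I$ w.r.t. $F$ contains it. A set $I'\subseteq I$ is globally optimal (resp. Pareto optimal) w.r.t. $\succ$ and $F$ if there are no nonempty $X\subseteq I'$ and nonempty $Y\subseteq I\setminus I'$ such that $(I'\setminus X)\cup Y$ is consistent with $F$ and $\forall x\in X.\ \exists y\in Y.\ y\succ x$ (resp. $\forall x\in X.\ \forall y\in Y.\ y\succ x$). A repair is completion optimal w.r.t. $\succ$ and $F$ if it is globally optimal w.r.t. some total priority $\succ'\supseteq\succ$ and $F$. Basic repairing algorithm: start with $J=\varnothing$, go through the facts of $I$ in an arbitrary (nondeterministically chosen) order, adding the current fact to $J$ if the result is consistent with $F$ and discarding it otherwise; return $J$. Winnow-based repairing algorithm: for a set of facts $K$ let $\omega_\succ(K)=\{x\in K : \nexists y\in K.\ y\succ x\}$; start with $I^o=I$, $J=\varnothing$; while $\omega_\succ(I^o)\ne\varnothing$, choose (nondeterministically) $x\in\omega_\succ(I^o)$, remove $x$ from $I^o$, and add $x$ to $J$ if $J\cup\{x\}$ is consistent with $F$; return $J$. Complexity is data complexity: $F$ is fixed.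 *)

theory Defs
  imports Complex_Main "HOL-Computational_Algebra.Polynomial"
begin

section \<open>Databases and denial constraints\<close>

datatype sort = RatSort | ConstSort

datatype 'd val = RatVal rat | ConstVal 'd

fun sort_of :: "'d val \<Rightarrow> sort" where
  "sort_of (RatVal _) = RatSort"
| "sort_of (ConstVal _) = ConstSort"

text \<open>A schema maps each of its relation names to the list of the sorts of its attributes.\<close>

type_synonym 'r schema = "'r \<Rightarrow> sort list option"

definition wf_schema :: "'r schema \<Rightarrow> bool" where
  "wf_schema S \<longleftrightarrow> (\<forall>ts \<in> ran S. ts \<noteq> [])"

type_synonym ('r, 'd) fact = "'r \<times> 'd val list"

definition wf_fact :: "'r schema \<Rightarrow> ('r, 'd) fact \<Rightarrow> bool" where
  "wf_fact S f \<longleftrightarrow> S (fst f) = Some (map sort_of (snd f))"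

definition db_instance :: "'r schema \<Rightarrow> ('r, 'd) fact set \<Rightarrow> bool" where
  "db_instance S I \<longleftrightarrow> finite I \<and> (\<forall>f \<in> I. wf_fact S f)"

datatype pred = Eq | Neq | Lt | Le | Gt | Ge

datatype 'd trm = Var nat | Const "'d val"

datatype 'd form =
    Cmp pred "'d trm" "'d trm"
  | Neg "'d form"
  | Conj "'d form" "'d form"
  | Disj "'d form" "'d form"

text \<open>\<open>DC [(R\<^sub>1, x\<^sub>1), \<dots>, (R\<^sub>n, x\<^sub>n)] \<phi>\<close> is the sentence
  \<open>\<forall>x. \<not> (R\<^sub>1(x\<^sub>1) \<and> \<dots> \<and> R\<^sub>n(x\<^sub>n) \<and> \<phi>(x))\<close>.\<close>

datatype ('r, 'd) dc = DC (atoms: "('r \<times> nat list) list") (cond: "'d form")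

fun trm_val :: "(nat \<Rightarrow> 'd val) \<Rightarrow> 'd trm \<Rightarrow> 'd val" where
  "trm_val \<rho> (Var x) = \<rho> x"
| "trm_val \<rho> (Const c) = c"

text \<open>The order predicates are meaningful on rationals only; the sort discipline \<open>wf_form\<close>
  below makes the last equation irrelevant.\<close>

fun holds_pred :: "pred \<Rightarrow> 'd val \<Rightarrow> 'd val \<Rightarrow> bool" where
  "holds_pred Eq a b \<longleftrightarrow> a = b"
| "holds_pred Neq a b \<longleftrightarrow> a \<noteq> b"
| "holds_pred Lt (RatVal p) (RatVal q) \<longleftrightarrow> p < q"
| "holds_pred Le (RatVal p) (RatVal q) \<longleftrightarrow> p \<le> q"
| "holds_pred Gt (RatVal p) (RatVal q) \<longleftrightarrow> p > q"
| "holds_pred Ge (RatVal p) (RatVal q) \<longleftrightarrow> p \<ge> q"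
| "holds_pred _ _ _ \<longleftrightarrow> False"

fun holds :: "(nat \<Rightarrow> 'd val) \<Rightarrow> 'd form \<Rightarrow> bool" where
  "holds \<rho> (Cmp p a b) \<longleftrightarrow> holds_pred p (trm_val \<rho> a) (trm_val \<rho> b)"
| "holds \<rho> (Neg \<phi>) \<longleftrightarrow> \<not> holds \<rho> \<phi>"
| "holds \<rho> (Conj \<phi> \<psi>) \<longleftrightarrow> holds \<rho> \<phi> \<and> holds \<rho> \<psi>"
| "holds \<rho> (Disj \<phi> \<psi>) \<longleftrightarrow> holds \<rho> \<phi> \<or> holds \<rho> \<psi>"

fun trm_vars :: "'d trm \<Rightarrow> nat set" where
  "trm_vars (Var x) = {x}"
| "trm_vars (Const c) = {}"

fun form_vars :: "'d form \<Rightarrow> nat set" where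
  "form_vars (Cmp p a b) = trm_vars a \<union> trm_vars b"
| "form_vars (Neg \<phi>) = form_vars \<phi>"
| "form_vars (Conj \<phi> \<psi>) = form_vars \<phi> \<union> form_vars \<psi>"
| "form_vars (Disj \<phi> \<psi>) = form_vars \<phi> \<union> form_vars \<psi>"

fun trm_sort :: "(nat \<Rightarrow> sort) \<Rightarrow> 'd trm \<Rightarrow> sort" where
  "trm_sort \<tau> (Var x) = \<tau> x"
| "trm_sort \<tau> (Const c) = sort_of c"

fun wf_form :: "(nat \<Rightarrow> sort) \<Rightarrow> 'd form \<Rightarrow> bool" where
  "wf_form \<tau> (Cmp p a b) \<longleftrightarrow>
     trm_sort \<tau> a = trm_sort \<tau> b \<and> (p \<in> {Eq, Neq} \<or> trm_sort \<tau> a = RatSort)"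
| "wf_form \<tau> (Neg \<phi>) \<longleftrightarrow> wf_form \<tau> \<phi>"
| "wf_form \<tau> (Conj \<phi> \<psi>) \<longleftrightarrow> wf_form \<tau> \<phi> \<and> wf_form \<tau> \<psi>"
| "wf_form \<tau> (Disj \<phi> \<psi>) \<longleftrightarrow> wf_form \<tau> \<phi> \<and> wf_form \<tau> \<psi>"

definition wf_dc :: "'r schema \<Rightarrow> ('r, 'd) dc \<Rightarrow> bool" where
  "wf_dc S \<delta> \<longleftrightarrow>
     atoms \<delta> \<noteq> [] \<and>
     form_vars (cond \<delta>) \<subseteq> (\<Union>(R, xs) \<in> set (atoms \<delta>). set xs) \<and>
     (\<exists>\<tau>. (\<forall>(R, xs) \<in> set (atoms \<delta>). S R = Some (map \<tau> xs)) \<and> wf_form \<tau> (cond \<delta>))"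

definition subst_atom :: "(nat \<Rightarrow> 'd val) \<Rightarrow> 'r \<times> nat list \<Rightarrow> ('r, 'd) fact" where
  "subst_atom \<rho> a = (fst a, map \<rho> (snd a))"

definition satisfies :: "('r, 'd) fact set \<Rightarrow> ('r, 'd) dc \<Rightarrow> bool" where
  "satisfies I \<delta> \<longleftrightarrow>
     (\<forall>\<rho>. \<not> ((\<forall>a \<in> set (atoms \<delta>). subst_atom \<rho> a \<in> I) \<and> holds \<rho> (cond \<delta>)))"

definition consistent :: "('r, 'd) dc set \<Rightarrow> ('r, 'd) fact set \<Rightarrow> bool" where
  "consistent F I \<longleftrightarrow> (\<forall>\<delta> \<in> F. satisfies I \<delta>)"

definition conflict :: "('r, 'd) dc set \<Rightarrow> ('r, 'd) fact set \<Rightarrow> ('r, 'd) fact set \<Rightarrow> bool" where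
  "conflict F I C \<longleftrightarrow> C \<subseteq> I \<and>
     (\<exists>\<delta> \<in> F. \<exists>\<rho>. holds \<rho> (cond \<delta>) \<and> C = subst_atom \<rho> ` set (atoms \<delta>))"

definition neighbors ::
  "('r, 'd) dc set \<Rightarrow> ('r, 'd) fact set \<Rightarrow> ('r, 'd) fact \<Rightarrow> ('r, 'd) fact \<Rightarrow> bool" where
  "neighbors F I x y \<longleftrightarrow> (\<exists>C. conflict F I C \<and> x \<in> C \<and> y \<in> C)"

definition repair :: "('r, 'd) dc set \<Rightarrow> ('r, 'd) fact set \<Rightarrow> ('r, 'd) fact set \<Rightarrow> bool" where
  "repair F I J \<longleftrightarrow> J \<subseteq> I \<and> consistent F J \<and>
     (\<forall>J'. J \<subseteq> J' \<and> J' \<subseteq> I \<and> consistent F J' \<longrightarrow> J' = J)"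


section \<open>Priorities and optimality\<close>

text \<open>Throughout, \<open>(x, y) \<in> P\<close> stands for \<open>x \<succ> y\<close>.\<close>

type_synonym ('r, 'd) prio = "(('r, 'd) fact \<times> ('r, 'd) fact) set"

definition priority :: "('r, 'd) dc set \<Rightarrow> ('r, 'd) fact set \<Rightarrow> ('r, 'd) prio \<Rightarrow> bool" where
  "priority F I P \<longleftrightarrow> P \<subseteq> I \<times> I \<and> acyclic P \<and> (\<forall>(x, y) \<in> P. neighbors F I x y)"

definition total_priority :: "('r, 'd) dc set \<Rightarrow> ('r, 'd) fact set \<Rightarrow> ('r, 'd) prio \<Rightarrow> bool" where
  "total_priority F I P \<longleftrightarrow> priority F I P \<and> (\<forall>P'. priority F I P' \<and> P \<subseteq> P' \<longrightarrow> P' = P)"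

definition globally_optimal ::
  "('r, 'd) dc set \<Rightarrow> ('r, 'd) fact set \<Rightarrow> ('r, 'd) prio \<Rightarrow> ('r, 'd) fact set \<Rightarrow> bool" where
  "globally_optimal F I P J \<longleftrightarrow> J \<subseteq> I \<and>
     \<not> (\<exists>X Y. X \<subseteq> J \<and> X \<noteq> {} \<and> Y \<subseteq> I - J \<and> Y \<noteq> {} \<and>
          consistent F ((J - X) \<union> Y) \<and> (\<forall>x \<in> X. \<exists>y \<in> Y. (y, x) \<in> P))"

definition pareto_optimal ::
  "('r, 'd) dc set \<Rightarrow> ('r, 'd) fact set \<Rightarrow> ('r, 'd) prio \<Rightarrow> ('r, 'd) fact set \<Rightarrow> bool" where
  "pareto_optimal F I P J \<longleftrightarrow> J \<subseteq> I \<and>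
     \<not> (\<exists>X Y. X \<subseteq> J \<and> X \<noteq> {} \<and> Y \<subseteq> I - J \<and> Y \<noteq> {} \<and>
          consistent F ((J - X) \<union> Y) \<and> (\<forall>x \<in> X. \<forall>y \<in> Y. (y, x) \<in> P))"

definition completion_optimal ::
  "('r, 'd) dc set \<Rightarrow> ('r, 'd) fact set \<Rightarrow> ('r, 'd) prio \<Rightarrow> ('r, 'd) fact set \<Rightarrow> bool" where
  "completion_optimal F I P J \<longleftrightarrow> repair F I J \<and>
     (\<exists>P'. total_priority F I P' \<and> P \<subseteq> P' \<and> globally_optimal F I P' J)"


section \<open>Runs of nondeterministic transition systems\<close>

text \<open>A step \<open>step s l s'\<close> carries a label \<open>l\<close>: \<open>Some x\<close> if the step nondeterministically chooses
  \<open>x\<close>, and \<open>None\<close> if it makes no choice. \<open>run step s xs n t\<close> says that \<open>n\<close> consecutive steps,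
  making the choices \<open>xs\<close> in this order, lead from \<open>s\<close> to \<open>t\<close>.\<close>

inductive run :: "('s \<Rightarrow> 'l option \<Rightarrow> 's \<Rightarrow> bool) \<Rightarrow> 's \<Rightarrow> 'l list \<Rightarrow> nat \<Rightarrow> 's \<Rightarrow> bool"
  for step where
  run_refl: "run step s [] 0 s"
| run_silent: "step s None s' \<Longrightarrow> run step s' xs n t \<Longrightarrow> run step s xs (Suc n) t"
| run_choice: "step s (Some x) s' \<Longrightarrow> run step s' xs n t \<Longrightarrow> run step s (x # xs) (Suc n) t"

definition halted :: "('s \<Rightarrow> 'l option \<Rightarrow> 's \<Rightarrow> bool) \<Rightarrow> 's \<Rightarrow> bool" where
  "halted step s \<longleftrightarrow> (\<nexists>l s'. step s l s')"

definition terminating :: "('s \<Rightarrow> 'l option \<Rightarrow> 's \<Rightarrow> bool) \<Rightarrow> 's \<Rightarrow> bool" where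
  "terminating step s \<longleftrightarrow> (\<nexists>f. f 0 = s \<and> (\<forall>i. \<exists>l. step (f i) l (f (Suc i))))"


section \<open>The repairing algorithms\<close>

definition add_fact ::
  "('r, 'd) dc set \<Rightarrow> ('r, 'd) fact set \<Rightarrow> ('r, 'd) fact \<Rightarrow> ('r, 'd) fact set" where
  "add_fact F J x = (if consistent F (insert x J) then insert x J else J)"

definition winnow :: "('r, 'd) prio \<Rightarrow> ('r, 'd) fact set \<Rightarrow> ('r, 'd) fact set" where
  "winnow P K = {x \<in> K. \<not> (\<exists>y \<in> K. (y, x) \<in> P)}"

text \<open>\<open>Basic K J\<close> and \<open>Winnow K J\<close> are the states of the basic and of the winnow-based repairing
  algorithm in which \<open>J\<close> has been built so far and the facts of \<open>K\<close> remain to be processed;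
  in \<open>Test J\<close>, the set \<open>J\<close> built by the former is tested for Pareto optimality.\<close>

datatype 'f state =
    Basic "'f set" "'f set"
  | Test "'f set"
  | Winnow "'f set" "'f set"
  | Return "'f set"

inductive alg_step ::
  "('r, 'd) dc set \<Rightarrow> ('r, 'd) fact set \<Rightarrow> ('r, 'd) prio \<Rightarrow>
   ('r, 'd) fact state \<Rightarrow> ('r, 'd) fact option \<Rightarrow> ('r, 'd) fact state \<Rightarrow> bool"
  for F I P where
  basic_pick: "x \<in> K \<Longrightarrow>
    alg_step F I P (Basic K J) (Some x) (Basic (K - {x}) (add_fact F J x))"
| basic_done: "alg_step F I P (Basic {} J) None (Test J)"
| test_success: "pareto_optimal F I P J \<Longrightarrow> alg_step F I P (Test J) None (Return J)"
| test_failure: "\<not> pareto_optimal F I P J \<Longrightarrow> alg_step F I P (Test J) None (Winnow I {})"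
| winnow_pick: "x \<in> winnow P K \<Longrightarrow>
    alg_step F I P (Winnow K J) (Some x) (Winnow (K - {x}) (add_fact F J x))"
| winnow_done: "winnow P K = {} \<Longrightarrow> alg_step F I P (Winnow K J) None (Return J)"


section \<open>Model of computation\<close>

text \<open>The machine model is a nondeterministic version of Jones' language WHILE over binary trees
  (N. D. Jones, Computability and Complexity from a Programming Perspective). The only data
  operations are pairing, projections and the test for \<open>Leaf\<close>; they take constant time on trees
  represented by pointers, and a program evaluates only expressions of constant size, so that
  polynomially many steps of a program amount to polynomial time on a Turing machine.\<close>

datatype tree = Leaf | Node tree tree

datatype exp = V nat | LeafE | NodeE exp exp | Hd exp | Tl exp

type_synonym store = "nat \<Rightarrow> tree"

fun hd_tree :: "tree \<Rightarrow> tree" where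
  "hd_tree Leaf = Leaf"
| "hd_tree (Node a b) = a"

fun tl_tree :: "tree \<Rightarrow> tree" where
  "tl_tree Leaf = Leaf"
| "tl_tree (Node a b) = b"

fun exp_val :: "store \<Rightarrow> exp \<Rightarrow> tree" where
  "exp_val s (V x) = s x"
| "exp_val s LeafE = Leaf"
| "exp_val s (NodeE e f) = Node (exp_val s e) (exp_val s f)"
| "exp_val s (Hd e) = hd_tree (exp_val s e)"
| "exp_val s (Tl e) = tl_tree (exp_val s e)"

datatype com =
    Skip
  | Assign nat exp
  | Seq com com
  | If exp com com
  | While exp com
  | Choose nat exp

text \<open>A tree is viewed as the list \<open>Node a\<^sub>1 (Node a\<^sub>2 \<dots> (Node a\<^sub>n Leaf))\<close>.\<close>

fun elements :: "tree \<Rightarrow> tree set" where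
  "elements Leaf = {}"
| "elements (Node a b) = insert a (elements b)"

inductive com_step :: "com \<times> store \<Rightarrow> tree option \<Rightarrow> com \<times> store \<Rightarrow> bool" where
  "com_step (Assign x e, s) None (Skip, s(x := exp_val s e))"
| "com_step (Seq Skip c, s) None (c, s)"
| "com_step (c, s) l (c', s') \<Longrightarrow> com_step (Seq c d, s) l (Seq c' d, s')"
| "exp_val s e \<noteq> Leaf \<Longrightarrow> com_step (If e c d, s) None (c, s)"
| "exp_val s e = Leaf \<Longrightarrow> com_step (If e c d, s) None (d, s)"
| "com_step (While e c, s) None (If e (Seq c (While e c)) Skip, s)"
| "a \<in> elements (exp_val s e) \<Longrightarrow> com_step (Choose x e, s) (Some a) (Skip, s(x := a))"

text \<open>Variable 0 holds the input at the start and the output at the end. A configuration with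
  command \<open>Skip\<close> is final; a \<open>Choose\<close> from the empty list is stuck.\<close>

definition start :: "com \<Rightarrow> tree \<Rightarrow> com \<times> store" where
  "start c d = (c, (\<lambda>_. Leaf)(0 := d))"

text \<open>On inputs from \<open>D\<close>, every run reaches a final configuration, within a number of steps that is
  polynomial in the size (number of \<open>Node\<close>s) of the input.\<close>

definition poly_time_on :: "tree set \<Rightarrow> com \<Rightarrow> bool" where
  "poly_time_on D c \<longleftrightarrow>
     (\<exists>p :: nat poly. \<forall>d \<in> D. \<forall>xs n c' s'.
        run com_step (start c d) xs n (c', s') \<longrightarrow>
          n \<le> poly p (size d) \<and> (halted com_step (c', s') \<longrightarrow> c' = Skip))"


section \<open>Encoding of inputs and outputs\<close>

text \<open>Numbers are encoded in binary, least significant bit first.\<close>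

fun enc_nat :: "nat \<Rightarrow> tree" where
  "enc_nat n = (if n = 0 then Leaf
     else Node (if even n then Leaf else Node Leaf Leaf) (enc_nat (n div 2)))"

declare enc_nat.simps [simp del]

definition enc_int :: "int \<Rightarrow> tree" where
  "enc_int i = Node (if i < 0 then Node Leaf Leaf else Leaf) (enc_nat (nat \<bar>i\<bar>))"

definition enc_rat :: "rat \<Rightarrow> tree" where
  "enc_rat q = (case quotient_of q of (a, b) \<Rightarrow> Node (enc_int a) (enc_int b))"

definition enc_list :: "('a \<Rightarrow> tree) \<Rightarrow> 'a list \<Rightarrow> tree" where
  "enc_list e xs = foldr (\<lambda>x. Node (e x)) xs Leaf"

text \<open>The encodings \<open>eR\<close> of relation names and \<open>eD\<close> of uninterpreted constants are parameters.\<close>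

fun enc_val :: "('d \<Rightarrow> tree) \<Rightarrow> 'd val \<Rightarrow> tree" where
  "enc_val eD (RatVal q) = Node Leaf (enc_rat q)"
| "enc_val eD (ConstVal d) = Node (Node Leaf Leaf) (eD d)"

definition enc_fact :: "('r \<Rightarrow> tree) \<Rightarrow> ('d \<Rightarrow> tree) \<Rightarrow> ('r, 'd) fact \<Rightarrow> tree" where
  "enc_fact eR eD f = Node (eR (fst f)) (enc_list (enc_val eD) (snd f))"

text \<open>A finite set is encoded by any repetition-free list of its elements.\<close>

definition set_encodings :: "('a \<Rightarrow> tree) \<Rightarrow> 'a set \<Rightarrow> tree set" where
  "set_encodings e A = {enc_list e xs | xs. distinct xs \<and> set xs = A}"

definition input_encodings ::
  "('r \<Rightarrow> tree) \<Rightarrow> ('d \<Rightarrow> tree) \<Rightarrow> ('r, 'd) fact set \<Rightarrow> ('r, 'd) prio \<Rightarrow> tree set" where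
  "input_encodings eR eD I P =
     {Node a b | a b. a \<in> set_encodings (enc_fact eR eD) I \<and>
        b \<in> set_encodings (\<lambda>(x, y). Node (enc_fact eR eD x) (enc_fact eR eD y)) P}"

text \<open>On input \<open>(I, P)\<close>, the terminated runs of \<open>c\<close> are those of the algorithm:
  the same sequences of nondeterministically chosen facts, with the same results.\<close>

definition implements_on ::
  "('r \<Rightarrow> tree) \<Rightarrow> ('d \<Rightarrow> tree) \<Rightarrow> ('r, 'd) dc set \<Rightarrow> ('r, 'd) fact set \<Rightarrow> ('r, 'd) prio \<Rightarrow>
   com \<Rightarrow> bool" where
  "implements_on eR eD F I P c \<longleftrightarrow>
     (\<forall>d \<in> input_encodings eR eD I P.
        (\<forall>as n s. run com_step (start c d) as n (Skip, s) \<longrightarrow>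
           (\<exists>xs m J. run (alg_step F I P) (Basic I {}) xs m (Return J) \<and>
              as = map (enc_fact eR eD) xs \<and> s 0 \<in> set_encodings (enc_fact eR eD) J)) \<and>
        (\<forall>xs m J. run (alg_step F I P) (Basic I {}) xs m (Return J) \<longrightarrow>
           (\<exists>n s. run com_step (start c d) (map (enc_fact eR eD) xs) n (Skip, s) \<and>
              s 0 \<in> set_encodings (enc_fact eR eD) J)))"

end

theory Submission
  imports Defs "HOL-Library.While_Combinator"
begin

text \<open>Processing the facts of \<open>I\<close> greedily along a linear order yields a repair which is globally
  optimal for the total priority orienting every pair of neighbors along that order; conversely, a
  repair that is globally optimal for a total priority is the result of every greedy run compatible
  with it. So the winnow-based algorithm returns exactly the completion-optimal repairs, which are
  Pareto optimal. A Pareto-optimal repair \<open>J\<close> is produced by the basic algorithm when it picks the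
  facts of \<open>J\<close> first.

  For the time bound, every deterministic stretch of the algorithm is a function on trees built by
  composition, case distinction and iteration with polynomially bounded intermediate results. Since
  \<open>F\<close> is fixed, consistency is a first-order property over the active domain with a fixed number of
  quantifiers. Pareto optimality only has to be tested against the exchanges of
  \<open>{x \<in> J. y \<succ> x}\<close> for a single fact \<open>y\<close>.\<close>

section \<open>The algorithm on sets of facts\<close>

text \<open>\<open>implements_on\<close> asks for the same sequences of choices and not only for the
  same results. So each \<open>Choose\<close> must draw from a list of exactly the facts that the
  algorithm may pick, which is why the list of winnow candidates is part of the loop state and is
  recomputed after every pick. Choices occur in two loops only; what lies between them is
  deterministic. The two inclusions of runs have different proofs: a bound on all runs of the
  program also yields the matching runs of the algorithm, whereas a prescribed sequence of choices
  requires composing a run of the program explicitly. Since expressions can only test for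
  \<open>Leaf\<close>, equality of trees has to be programmed, and so do the order predicates:
  \<open>a/b < c/d\<close> is decided by cross-multiplication, so binary multiplication is needed.
  Inheritance of consistency by subsets is what makes rejected facts stay rejected, and it justifies
  the single fact \<open>y\<close> in the Pareto test: passing from \<open>(X, Y)\<close> to one
  \<open>y\<close> and all facts that it dominates only removes facts from the exchanged
  set.\<close>

lemma run_append:
  assumes "run step s xs m t" "run step t ys n u"
  shows "run step s (xs @ ys) (m + n) u"
  using assms by (induction rule: run.induct) (auto intro: run.intros)

section \<open>Conflicts, repairs and total priorities\<close>

lemma consistent_subset: "consistent F J \<Longrightarrow> J' \<subseteq> J \<Longrightarrow> consistent F J'"
  unfolding consistent_def satisfies_def by blast

lemma inconsistent_conflict:
  assumes "\<not> consistent F J" "J \<subseteq> I"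
  obtains C where "conflict F I C" "C \<subseteq> J" "\<not> consistent F C"
proof -
  obtain \<delta> \<rho> where d: "\<delta> \<in> F" "\<forall>a \<in> set (atoms \<delta>). subst_atom \<rho> a \<in> J" "holds \<rho> (cond \<delta>)"
    using assms(1) by (auto simp: consistent_def satisfies_def)
  let ?C = "subst_atom \<rho> ` set (atoms \<delta>)"
  have "conflict F I ?C" "?C \<subseteq> J" "\<not> consistent F ?C"
    using d assms(2) by (auto simp: conflict_def consistent_def satisfies_def)
  then show thesis by (rule that)
qed

lemma repairI:
  assumes "J \<subseteq> I" "consistent F J" "\<And>x. x \<in> I - J \<Longrightarrow> \<not> consistent F (insert x J)"
  shows "repair F I J"
  unfolding repair_def
proof (intro conjI allI impI assms(1,2))
  fix J' assume J': "J \<subseteq> J' \<and> J' \<subseteq> I \<and> consistent F J'"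
  show "J' = J"
  proof (rule ccontr)
    assume "J' \<noteq> J"
    with J' obtain x where "x \<in> J'" "x \<notin> J" by blast
    with J' assms(3)[of x] show False by (auto dest: consistent_subset[of _ _ "insert x J"])
  qed
qed

lemma repair_insert:
  assumes "repair F I J" "x \<in> I - J"
  shows "\<not> consistent F (insert x J)"
  using assms unfolding repair_def by blast

lemma acyclic_not_refl: "acyclic P \<Longrightarrow> (x, x) \<notin> P"
  by (auto simp: acyclic_def)

text \<open>By maximality, adding the pair in either direction would close a cycle, so
  \<open>P\<close> has paths between \<open>x\<close> and \<open>y\<close> both ways. As
  \<open>x \<noteq> y\<close>, these two paths already form a cycle.\<close>

lemma priority_total_cases:
  assumes "total_priority F I P" "neighbors F I x y" "x \<noteq> y"
  shows "(x, y) \<in> P \<or> (y, x) \<in> P"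
proof (rule ccontr)
  assume *: "\<not> ((x, y) \<in> P \<or> (y, x) \<in> P)"
  have P: "priority F I P" using assms(1) by (simp add: total_priority_def)
  have xy: "x \<in> I" "y \<in> I" "neighbors F I y x"
    using assms(2) by (auto simp: neighbors_def conflict_def)
  have cyc: "(b, a) \<in> P\<^sup>*" if "(a, b) \<notin> P" "neighbors F I a b" "a \<in> I" "b \<in> I" for a b
  proof (rule ccontr)
    assume "(b, a) \<notin> P\<^sup>*"
    then have "priority F I (insert (a, b) P)"
      using P that by (auto simp: priority_def acyclic_insert)
    then show False using assms(1) that(1) unfolding total_priority_def by blast
  qed
  have "(y, x) \<in> P\<^sup>*" "(x, y) \<in> P\<^sup>*" using cyc * assms(2) xy by auto
  then have "(x, y) \<in> P\<^sup>+" using assms(3) by (auto dest: rtranclD)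
  then have "(x, x) \<in> P\<^sup>+" using \<open>(y, x) \<in> P\<^sup>*\<close> by (rule trancl_rtrancl_trancl)
  then show False using P unfolding priority_def acyclic_def by blast
qed

lemma winnow_subset: "winnow P K \<subseteq> K"
  by (auto simp: winnow_def)

text \<open>A finite acyclic relation is well-founded, so a nonempty \<open>K\<close> has an
  undominated fact. Hence the winnow-based algorithm cannot stop before all facts are
  processed.\<close>

lemma winnow_eq_empty_iff:
  assumes "finite K" "acyclic P"
  shows "winnow P K = {} \<longleftrightarrow> K = {}"
proof
  assume W: "winnow P K = {}"
  show "K = {}"
  proof (rule ccontr)
    assume "K \<noteq> {}"
    have wf: "wf (P \<inter> K \<times> K)"
      by (rule finite_acyclic_wf) (use assms(1) acyclic_subset[OF assms(2)] in blast)+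
    obtain x where "x \<in> K" using \<open>K \<noteq> {}\<close> by blast
    from iffD1[OF wf_eq_minimal wf, rule_format, OF this]
    obtain z where "z \<in> K" "\<forall>y. (y, z) \<in> P \<inter> K \<times> K \<longrightarrow> y \<notin> K" ..
    then have "z \<in> winnow P K" unfolding winnow_def by blast
    with W show False by simp
  qed
qed (auto simp: winnow_def)

section \<open>Termination and the greedy invariant\<close>

inductive_cases Basic_stepE: "alg_step F I P (Basic K J) l s"
inductive_cases Test_stepE: "alg_step F I P (Test J) l s"
inductive_cases Winnow_stepE: "alg_step F I P (Winnow K J) l s"
inductive_cases Return_stepE: "alg_step F I P (Return J) l s"

lemma run_invariant:
  assumes "run step s xs n t" "Q s" "\<And>s l s'. Q s \<Longrightarrow> step s l s' \<Longrightarrow> Q s'"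
  shows "Q t"
  using assms by (induction rule: run.induct) blast+

lemma terminating_alg:
  assumes "finite I"
  shows "terminating (alg_step F I P) (Basic I {})"
  unfolding terminating_def
proof
  assume "\<exists>f. f 0 = Basic I {} \<and> (\<forall>i. \<exists>l. alg_step F I P (f i) l (f (Suc i)))"
  then obtain f where f: "f 0 = Basic I {}" "\<And>i. \<exists>l. alg_step F I P (f i) l (f (Suc i))" by blast
  define fin where "fin s = (case s of Basic K J \<Rightarrow> finite K | Winnow K J \<Rightarrow> finite K | _ \<Rightarrow> True)"
    for s :: "('a, 'b) fact state"
  \<comment> \<open>The offsets make room for the later phases: a \<open>Basic\<close> state must
    exceed the test and a complete winnow phase, which starts again with \<open>card I\<close>
    facts.\<close>
  define rank where "rank s = (case s of Basic K J \<Rightarrow> card K + card I + 4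
     | Test J \<Rightarrow> card I + 3 | Winnow K J \<Rightarrow> card K + 2 | Return J \<Rightarrow> 1)"
    for s :: "('a, 'b) fact state"
  have dec: "card K - Suc 0 < card K" if "finite K" "x \<in> K" for x and K :: "('a, 'b) fact set"
    using card_Diff1_less[OF that] that by simp
  have step: "fin s' \<and> rank s' < rank s" if "alg_step F I P s l s'" "fin s" for s l s'
    using that assms by (elim alg_step.cases)
      (auto simp: fin_def rank_def intro: dec card_Diff1_less dest: subsetD[OF winnow_subset])
  have fin: "fin (f i)" for i
  proof (induction i)
    case 0
    then show ?case using f(1) assms by (simp add: fin_def)
  next
    case (Suc i)
    then show ?case using f(2)[of i] step by blast
  qed
  have "\<forall>i. (f (Suc i), f i) \<in> measure rank"
    using f(2) step fin unfolding in_measure by blast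
  then show False using wf_iff_no_infinite_down_chain[of "measure rank"] by blast
qed

definition greedy_inv where
  "greedy_inv F I K J \<longleftrightarrow> K \<subseteq> I \<and> J \<subseteq> I - K \<and> consistent F J \<and>
     (\<forall>x \<in> I - K - J. \<not> consistent F (insert x J))"

text \<open>A fact rejected earlier stays rejected while \<open>J\<close> grows, because consistency
  is inherited by subsets; the only new case is \<open>x\<close> itself.\<close>

lemma greedy_inv_step:
  assumes "greedy_inv F I K J" "x \<in> K"
  shows "greedy_inv F I (K - {x}) (add_fact F J x)"
proof -
  have "\<not> consistent F (insert y (add_fact F J x))" if "y \<in> I - (K - {x}) - add_fact F J x" for y
  proof (cases "y = x")
    case True
    then show ?thesis using that by (auto simp: add_fact_def split: if_splits)
  next
    case False
    then have "\<not> consistent F (insert y J)"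
      using that assms by (auto simp: greedy_inv_def add_fact_def split: if_splits)
    then show ?thesis
      by (rule contrapos_nn) (erule consistent_subset, auto simp: add_fact_def)
  qed
  then show ?thesis using assms by (auto simp: greedy_inv_def add_fact_def)
qed

lemma greedy_inv_repair: "greedy_inv F I {} J \<Longrightarrow> repair F I J"
  by (rule repairI) (auto simp: greedy_inv_def)

lemma greedy_inv_start:
  assumes "\<forall>\<delta> \<in> F. atoms \<delta> \<noteq> []"
  shows "greedy_inv F I I {}"
proof -
  have "satisfies {} \<delta>" if "\<delta> \<in> F" for \<delta>
    using assms that by (cases "atoms \<delta>") (auto simp: satisfies_def)
  then show ?thesis by (auto simp: greedy_inv_def consistent_def)
qed

lemma basic_run_repair:
  assumes "\<forall>\<delta> \<in> F. atoms \<delta> \<noteq> []" "run (alg_step F I P) (Basic I {}) xs n (Test J)"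
  shows "repair F I J"
proof -
  define Q where "Q s = (case s of Basic K J \<Rightarrow> greedy_inv F I K J | Test J \<Rightarrow> repair F I J | _ \<Rightarrow> True)"
    for s :: "('a, 'b) fact state"
  have "Q (Test J)"
  proof (rule run_invariant[OF assms(2)])
    show "Q (Basic I {})" by (simp add: Q_def greedy_inv_start[OF assms(1)])
    fix s l s' assume "Q s" "alg_step F I P s l s'"
    then show "Q s'"
      by (elim alg_step.cases) (auto simp: Q_def intro: greedy_inv_step greedy_inv_repair)
  qed
  then show ?thesis by (simp add: Q_def)
qed

text \<open>The relation \<open>E\<close> collects the pairs of facts in the order in which they are processed.\<close>

definition winnow_inv where
  "winnow_inv F I P K J E \<longleftrightarrow> greedy_inv F I K J \<and> E \<subseteq> I \<times> I \<and> irrefl E \<and> trans E \<and>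
     (\<forall>x \<in> I - K. \<forall>y \<in> I - K. x \<noteq> y \<longrightarrow> (x, y) \<in> E \<or> (y, x) \<in> E) \<and>
     (\<forall>x \<in> I - K. \<forall>y \<in> K. (x, y) \<in> E) \<and>
     (\<forall>x y. (x, y) \<in> E \<longrightarrow> x \<in> I - K) \<and>
     (\<forall>x \<in> I - K. \<forall>y \<in> I. (y, x) \<in> P \<longrightarrow> (y, x) \<in> E) \<and>
     (\<forall>y \<in> I - K - J. \<not> consistent F (insert y {x \<in> J. (x, y) \<in> E}))"

text \<open>The new pairs place \<open>x\<close> before the facts that remain. As \<open>x\<close>
  is undominated in \<open>K\<close>, every fact of \<open>I\<close> that \<open>P\<close> prefers
  to it is already processed, so \<open>E\<close> keeps respecting \<open>P\<close>.\<close>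

lemma winnow_inv_step:
  assumes inv: "winnow_inv F I P K J E" and x: "x \<in> winnow P K"
  shows "winnow_inv F I P (K - {x}) (add_fact F J x) (E \<union> {x} \<times> (K - {x}))"
proof -
  let ?E = "E \<union> {x} \<times> (K - {x})"
  have xK: "x \<in> K" and xP: "\<And>y. y \<in> K \<Longrightarrow> (y, x) \<notin> P" using x by (auto simp: winnow_def)
  have g: "greedy_inv F I K J" and EI: "E \<subseteq> I \<times> I" and irrE: "irrefl E" and tr: "trans E"
    and tot: "\<forall>x \<in> I - K. \<forall>y \<in> I - K. x \<noteq> y \<longrightarrow> (x, y) \<in> E \<or> (y, x) \<in> E"
    and bef: "\<forall>x \<in> I - K. \<forall>y \<in> K. (x, y) \<in> E"
    and dom: "\<forall>x y. (x, y) \<in> E \<longrightarrow> x \<in> I - K"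
    and PE: "\<forall>x \<in> I - K. \<forall>y \<in> I. (y, x) \<in> P \<longrightarrow> (y, x) \<in> E"
    and rej: "\<forall>y \<in> I - K - J. \<not> consistent F (insert y {x \<in> J. (x, y) \<in> E})"
    using inv unfolding winnow_inv_def by blast+
  have KI: "K \<subseteq> I" and JK: "J \<subseteq> I - K" using g by (auto simp: greedy_inv_def)
  have "\<forall>y \<in> I - (K - {x}) - add_fact F J x.
     \<not> consistent F (insert y {z \<in> add_fact F J x. (z, y) \<in> ?E})"
  proof
    fix y assume y: "y \<in> I - (K - {x}) - add_fact F J x"
    show "\<not> consistent F (insert y {z \<in> add_fact F J x. (z, y) \<in> ?E})"
    proof (cases "y = x")
      case True
      then have *: "add_fact F J x = J" "\<not> consistent F (insert x J)" using y by (auto simp: add_fact_def split: if_splits)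
      \<comment> \<open>All of \<open>J\<close> was processed before \<open>x\<close>, so
        restricting to the predecessors of \<open>x\<close> loses nothing.\<close>
      have "{z \<in> J. (z, x) \<in> ?E} = J" using JK xK bef by auto
      then show ?thesis using * True by simp
    next
      case False
      then have "y \<in> I - K - J" using y by (auto simp: add_fact_def split: if_splits)
      then have "\<not> consistent F (insert y {z \<in> J. (z, y) \<in> E})" using rej by blast
      then show ?thesis
        by (rule contrapos_nn) (erule consistent_subset, auto simp: add_fact_def)
    qed
  qed
  moreover have "trans ?E"
  proof (rule transI)
    fix a b c assume "(a, b) \<in> ?E" "(b, c) \<in> ?E"
    then consider "(a, b) \<in> E" "(b, c) \<in> E" | "(a, b) \<in> E" "c \<in> K" | "b \<in> K" "(b, c) \<in> E"
      by blast
    then show "(a, c) \<in> ?E"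
    proof cases
      case 1
      then show ?thesis using transD[OF tr] by blast
    next
      case 2
      then show ?thesis using dom bef by blast
    next
      case 3
      then show ?thesis using dom by blast
    qed
  qed
  moreover have "irrefl ?E" using irrE by (auto simp: irrefl_def)
  ultimately show ?thesis
    unfolding winnow_inv_def
  proof (intro conjI)
    show "greedy_inv F I (K - {x}) (add_fact F J x)" by (rule greedy_inv_step[OF g xK])
    show "?E \<subseteq> I \<times> I" using EI KI xK by blast
    show "\<forall>a \<in> I - (K - {x}). \<forall>b \<in> I - (K - {x}). a \<noteq> b \<longrightarrow> (a, b) \<in> ?E \<or> (b, a) \<in> ?E"
      using tot bef xK by blast
    show "\<forall>a \<in> I - (K - {x}). \<forall>b \<in> K - {x}. (a, b) \<in> ?E" using bef by blast
    show "\<forall>a b. (a, b) \<in> ?E \<longrightarrow> a \<in> I - (K - {x})" using dom KI xK by blast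
    show "\<forall>a \<in> I - (K - {x}). \<forall>b \<in> I. (b, a) \<in> P \<longrightarrow> (b, a) \<in> ?E"
      using PE bef xK xP by blast
  qed
qed

text \<open>With no fact left, \<open>E\<close> is a strict linear order of \<open>I\<close>
  containing \<open>P\<close>, and its pairs of neighbors form a total priority. An improvement
  \<open>(X, Y)\<close> is refuted at the \<open>E\<close>-least \<open>y\<close> in
  \<open>Y\<close>: the rejection of \<open>y\<close> involves an earlier \<open>x\<close> in
  \<open>X\<close>, whose improver in \<open>Y\<close> would come earlier still.\<close>

lemma winnow_inv_completion_optimal:
  assumes inv: "winnow_inv F I P {} J E" and fin: "finite I" and P: "priority F I P"
  shows "completion_optimal F I P J"
proof -
  have rep: "repair F I J" using inv by (auto simp: winnow_inv_def intro: greedy_inv_repair)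
  have irrE: "irrefl E" and tr: "trans E" and EI: "E \<subseteq> I \<times> I"
    and tot: "\<And>x y. x \<in> I \<Longrightarrow> y \<in> I \<Longrightarrow> x \<noteq> y \<Longrightarrow> (x, y) \<in> E \<or> (y, x) \<in> E"
    and PE: "P \<subseteq> E"
    and rej: "\<And>y. y \<in> I - J \<Longrightarrow> \<not> consistent F (insert y {x \<in> J. (x, y) \<in> E})"
    using inv P by (auto simp: winnow_inv_def priority_def)
  have acE: "acyclic E" using irrE tr by (simp add: acyclic_irrefl trancl_id)
  define P' where "P' = {(x, y) \<in> E. neighbors F I x y}"
  have pr: "priority F I P'"
    unfolding priority_def using EI acE by (auto simp: P'_def intro: acyclic_subset)
  \<comment> \<open>A pair of \<open>P''\<close> outside \<open>P'\<close> would be the reverse of a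
    pair of \<open>P'\<close>, giving a cycle of length two.\<close>
  have "P'' = P'" if P'': "priority F I P''" "P' \<subseteq> P''" for P''
  proof
    show "P'' \<subseteq> P'"
    proof
      fix e assume e: "e \<in> P''"
      obtain x y where xy: "e = (x, y)" by (cases e)
      then have n: "neighbors F I x y" "x \<in> I" "y \<in> I" using P'' e by (auto simp: priority_def)
      have ac: "acyclic P''" using P'' by (simp add: priority_def)
      then have "x \<noteq> y" using e xy by (auto dest: acyclic_not_refl)
      have "(y, x) \<notin> P''"
      proof
        assume "(y, x) \<in> P''"
        then have "(x, x) \<in> P''\<^sup>+" using e xy by (meson trancl.simps)
        then show False using ac unfolding acyclic_def by blast
      qed
      then have "(y, x) \<notin> E" using P''(2) n by (auto simp: P'_def neighbors_def)
      then show "e \<in> P'" using tot[OF n(2,3) \<open>x \<noteq> y\<close>] n xy by (auto simp: P'_def)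
    qed
  qed (rule P''(2))
  then have tp: "total_priority F I P'" using pr by (simp add: total_priority_def)
  have PP': "P \<subseteq> P'" using PE P by (auto simp: P'_def priority_def)
  have imp: "False" if XY: "X \<subseteq> J" "X \<noteq> {}" "Y \<subseteq> I - J" "Y \<noteq> {}" "consistent F ((J - X) \<union> Y)"
      "\<forall>x \<in> X. \<exists>y \<in> Y. (y, x) \<in> P'" for X Y
  proof -
    have wf: "wf E" using acE EI fin by (meson finite_SigmaI finite_acyclic_wf finite_subset)
    obtain y where y: "y \<in> Y" "\<And>z. (z, y) \<in> E \<Longrightarrow> z \<notin> Y"
      by (rule wfE_min'[OF wf XY(4)]) blast
    have "y \<in> I - J" using y(1) XY(3) by blast
    then have "\<not> consistent F (insert y {x \<in> J. (x, y) \<in> E})" by (rule rej)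
    \<comment> \<open>The facts that caused the rejection of \<open>y\<close> cannot all survive in
      \<open>J - X\<close>, since \<open>y\<close> is consistent with that set.\<close>
    then obtain x where x: "x \<in> J" "(x, y) \<in> E" "x \<in> X"
      using consistent_subset[OF XY(5), of "insert y {x \<in> J. (x, y) \<in> E}"] y(1) by blast
    then obtain y' where "y' \<in> Y" "(y', x) \<in> E" using XY(6) by (auto simp: P'_def)
    then show False using y(2) tr x(2) by (meson transE)
  qed
  have "globally_optimal F I P' J"
    unfolding globally_optimal_def
  proof (intro conjI notI)
    show "J \<subseteq> I" using rep by (simp add: repair_def)
  qed (elim exE conjE, rule imp; assumption)
  then show ?thesis unfolding completion_optimal_def using rep tp PP' by blast
qed

section \<open>Winnow-based runs and completion-optimal repairs\<close>

lemma winnow_run_completion_optimal: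
  assumes "\<forall>\<delta> \<in> F. atoms \<delta> \<noteq> []" "finite I" "priority F I P"
    and run: "run (alg_step F I P) (Winnow I {}) xs n (Return J)"
  shows "completion_optimal F I P J"
proof -
  define Q where "Q s = (case s of Winnow K J \<Rightarrow> \<exists>E. winnow_inv F I P K J E
      | Return J \<Rightarrow> completion_optimal F I P J | _ \<Rightarrow> False)"
    for s :: "('a, 'b) fact state"
  have ac: "acyclic P" using assms(3) by (simp add: priority_def)
  have "Q (Return J)"
  proof (rule run_invariant[OF run])
    have "winnow_inv F I P I {} {}"
      using greedy_inv_start[OF assms(1), of I] by (auto simp: winnow_inv_def irrefl_def trans_def)
    then show "Q (Winnow I {})" by (auto simp: Q_def)
    fix s l s' assume Q: "Q s" and st: "alg_step F I P s l s'"
    show "Q s'"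
      using st
    proof (cases rule: alg_step.cases)
      case (winnow_pick x K J)
      then obtain E where E: "winnow_inv F I P K J E" using Q by (auto simp: Q_def)
      have "winnow_inv F I P (K - {x}) (add_fact F J x) (E \<union> {x} \<times> (K - {x}))"
        using winnow_inv_step[OF E winnow_pick(4)] .
      then have "Q (Winnow (K - {x}) (add_fact F J x))" unfolding Q_def state.case by (rule exI)
      then show ?thesis using winnow_pick by simp
    next
      case (winnow_done K J)
      then obtain E where E: "winnow_inv F I P K J E" using Q by (auto simp: Q_def)
      then have "finite K" using assms(2) by (auto simp: winnow_inv_def greedy_inv_def intro: finite_subset)
      then have "K = {}" using winnow_done ac by (simp add: winnow_eq_empty_iff)
      then show ?thesis using winnow_inv_completion_optimal[OF _ assms(2,3)] E winnow_done
        by (auto simp: Q_def)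
    qed (use Q in \<open>auto simp: Q_def\<close>)
  qed
  then show ?thesis by (simp add: Q_def)
qed

text \<open>If the greedy construction accepted a fact \<open>x \<notin> J\<close>, then exchanging the not yet processed
  neighbors of \<open>x\<close> in \<open>J\<close> for \<open>x\<close> would improve \<open>J\<close>.\<close>

lemma completion_optimal_add_fact:
  assumes tp: "total_priority F I P'" and opt: "globally_optimal F I P' J" and rep: "repair F I J"
    and K: "K \<subseteq> I" and x: "x \<in> winnow P' K"
  shows "add_fact F (J - K) x = J - (K - {x})"
proof -
  have JI: "J \<subseteq> I" and cJ: "consistent F J" using rep by (auto simp: repair_def)
  have xK: "x \<in> K" using x by (auto simp: winnow_def)
  show ?thesis
  proof (cases "x \<in> J")
    case True
    then have "consistent F (insert x (J - K))" by (intro consistent_subset[OF cJ]) auto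
    then show ?thesis using True xK by (auto simp: add_fact_def)
  next
    case False
    have "\<not> consistent F (insert x (J - K))"
    proof
      assume c: "consistent F (insert x (J - K))"
      define X where "X = {z \<in> J \<inter> K. neighbors F I x z}"
      \<comment> \<open>No fact of \<open>K\<close> dominates \<open>x\<close>, so totality leaves
        only this orientation.\<close>
      have "(x, z) \<in> P'" if "z \<in> X" for z
        using that priority_total_cases[OF tp, of x z] x False by (auto simp: X_def winnow_def)
      moreover have cX: "consistent F ((J - X) \<union> {x})"
      proof (rule ccontr)
        assume "\<not> ?thesis"
        moreover have "(J - X) \<union> {x} \<subseteq> I" using JI xK K by auto
        ultimately obtain C where C: "conflict F I C" "C \<subseteq> (J - X) \<union> {x}" "\<not> consistent F C"
          by (rule inconsistent_conflict)
        \<comment> \<open>As \<open>J\<close> is consistent, the conflict involves \<open>x\<close>.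
          All its facts are then neighbors of \<open>x\<close>, and those in \<open>K\<close> other
          than \<open>x\<close> were removed with \<open>X\<close>.\<close>
        then have "x \<in> C" using consistent_subset[OF cJ, of C] by blast
        then have "neighbors F I x z" if "z \<in> C" for z using C(1) that by (auto simp: neighbors_def)
        then have "C \<subseteq> insert x (J - K)" using C(2) by (auto simp: X_def)
        then show False using C(3) consistent_subset[OF c] by blast
      qed
      moreover have "X \<noteq> {}"
      proof
        assume "X = {}"
        then have "consistent F (insert x J)" using cX by simp
        then show False using repair_insert[OF rep, of x] False xK K by blast
      qed
      moreover have "X \<subseteq> J" "{x} \<subseteq> I - J" using False xK K by (auto simp: X_def)
      ultimately show False using opt unfolding globally_optimal_def by blast
    qed
    then show ?thesis using False by (auto simp: add_fact_def)
  qed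
qed

text \<open>The run always picks from \<open>winnow P'\<close>, and \<open>P \<subseteq> P'\<close>
  makes this a legal pick for \<open>P\<close>. The set built so far stays equal to
  \<open>J - K\<close>.\<close>

lemma completion_optimal_winnow_run:
  assumes "finite I" "completion_optimal F I P J"
  shows "\<exists>xs n. run (alg_step F I P) (Winnow I {}) xs n (Return J)"
proof -
  obtain P' where P': "total_priority F I P'" "P \<subseteq> P'" "globally_optimal F I P' J" and rep: "repair F I J"
    using assms(2) by (auto simp: completion_optimal_def)
  have ac: "acyclic P'" using P'(1) by (simp add: total_priority_def priority_def)
  have JI: "J \<subseteq> I" using rep by (simp add: repair_def)
  have "\<exists>xs n. run (alg_step F I P) (Winnow K (J - K)) xs n (Return J)" if "K \<subseteq> I" for K
  proof -
    have "finite K" using that assms(1) finite_subset by blast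
    then show ?thesis using that
    proof (induction rule: finite_psubset_induct)
      case (psubset K)
      show ?case
      proof (cases "K = {}")
        case True
        then have "alg_step F I P (Winnow K (J - K)) None (Return J)"
          using winnow_done[of P "{}" F I J] by (simp add: winnow_def)
        then show ?thesis by (meson run_refl run_silent)
      next
        case False
        then obtain x where x: "x \<in> winnow P' K"
          using winnow_eq_empty_iff[OF psubset.hyps ac] by auto
        then have xP: "x \<in> winnow P K" "x \<in> K" using P'(2) by (auto simp: winnow_def)
        from winnow_pick[OF xP(1), of F I "J - K"]
        have "alg_step F I P (Winnow K (J - K)) (Some x) (Winnow (K - {x}) (J - (K - {x})))"
          using completion_optimal_add_fact[OF P'(1,3) rep psubset.prems x] by simp
        moreover have "\<exists>xs n. run (alg_step F I P) (Winnow (K - {x}) (J - (K - {x}))) xs n (Return J)"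
          using psubset xP by (intro psubset.IH) auto
        ultimately show ?thesis by (meson run_choice)
      qed
    qed
  qed
  from this[of I] show ?thesis using JI by (simp add: Diff_eq_empty_iff[THEN iffD2])
qed

text \<open>Being beaten by all of a nonempty \<open>Y\<close> implies being beaten by one of its
  facts, and a larger priority only adds improvements.\<close>

lemma completion_optimal_pareto:
  assumes "completion_optimal F I P J"
  shows "pareto_optimal F I P J"
proof -
  obtain P' where P': "P \<subseteq> P'" "globally_optimal F I P' J"
    using assms by (auto simp: completion_optimal_def)
  show ?thesis
    unfolding pareto_optimal_def
  proof (intro conjI notI)
    show "J \<subseteq> I" using P'(2) by (simp add: globally_optimal_def)
    assume "\<exists>X Y. X \<subseteq> J \<and> X \<noteq> {} \<and> Y \<subseteq> I - J \<and> Y \<noteq> {} \<and>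
          consistent F ((J - X) \<union> Y) \<and> (\<forall>x \<in> X. \<forall>y \<in> Y. (y, x) \<in> P)"
    then obtain X Y where "X \<subseteq> J" "X \<noteq> {}" "Y \<subseteq> I - J" "Y \<noteq> {}" "consistent F ((J - X) \<union> Y)"
      "\<forall>x \<in> X. \<exists>y \<in> Y. (y, x) \<in> P'"
      using P'(1) by (metis all_not_in_conv subsetD)
    then show False using P'(2) unfolding globally_optimal_def by blast
  qed
qed

section \<open>Soundness and completeness on sets of facts\<close>

lemma alg_sound:
  assumes F: "\<forall>\<delta> \<in> F. atoms \<delta> \<noteq> []" and I: "finite I" and P: "priority F I P"
    and run: "run (alg_step F I P) (Basic I {}) xs n s" and halt: "halted (alg_step F I P) s"
  shows "\<exists>J. s = Return J \<and> repair F I J \<and> pareto_optimal F I P J"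
proof -
  \<comment> \<open>In the winnow phase it suffices to record reachability from
    \<open>Winnow I {}\<close>: when the phase ends, the result on complete winnow runs
    applies.\<close>
  define Q where "Q s = (case s of Basic K J \<Rightarrow> greedy_inv F I K J | Test J \<Rightarrow> repair F I J
      | Winnow K J \<Rightarrow> \<exists>xs n. run (alg_step F I P) (Winnow I {}) xs n s
      | Return J \<Rightarrow> repair F I J \<and> pareto_optimal F I P J)"
    for s :: "('a, 'b) fact state"
  have "Q s"
  proof (rule run_invariant[OF run])
    show "Q (Basic I {})" by (simp add: Q_def greedy_inv_start[OF F])
    fix s l s' assume Q: "Q s" and st: "alg_step F I P s l s'"
    have app: "\<exists>xs n. run (alg_step F I P) (Winnow I {}) xs n s'"
      if ex: "\<exists>xs n. run (alg_step F I P) (Winnow I {}) xs n s"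
    proof -
      obtain xs n where 1: "run (alg_step F I P) (Winnow I {}) xs n s" using ex by blast
      have "\<exists>ys. run (alg_step F I P) s ys 1 s'"
        using st by (cases l) (auto intro: run.intros)
      with 1 show ?thesis by (blast intro: run_append)
    qed
    show "Q s'"
      using st
    proof (cases rule: alg_step.cases)
      case (winnow_done K J)
      then have "completion_optimal F I P J"
        using app Q winnow_run_completion_optimal[OF F I P] by (auto simp: Q_def)
      then show ?thesis using winnow_done
        by (auto simp: Q_def completion_optimal_pareto) (simp add: completion_optimal_def)
    next
      case (test_failure J)
      then show ?thesis by (auto simp: Q_def intro: run_refl)
    qed (use Q app in \<open>auto simp: Q_def intro: greedy_inv_step greedy_inv_repair\<close>)
  qed
  show ?thesis
  proof (cases s)
    case (Basic K J)
    then show ?thesis using halt basic_pick[of _ K F I P J] basic_done[of F I P J]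
      by (cases "K = {}") (auto simp: halted_def)
  next
    case (Test J)
    then show ?thesis using halt test_success[of F I P J] test_failure[of F I P J] by (auto simp: halted_def)
  next
    case (Winnow K J)
    then show ?thesis using halt winnow_pick[of _ P K F I J] winnow_done[of P K F I J]
      by (cases "winnow P K = {}") (auto simp: halted_def)
  next
    case (Return J)
    then show ?thesis using \<open>Q s\<close> by (auto simp: Q_def)
  qed
qed

lemma basic_run_accept_all:
  assumes "finite K'" "consistent F (J \<union> K')" "K' \<subseteq> K"
  shows "\<exists>xs n. run (alg_step F I P) (Basic K J) xs n (Basic (K - K') (J \<union> K'))"
  using assms
proof (induction K' arbitrary: K J rule: finite_induct)
  case empty
  then show ?case by (auto intro: run_refl)
next
  case (insert x A)
  have "consistent F (insert x J)" using insert.prems by (auto intro: consistent_subset)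
  then have "alg_step F I P (Basic K J) (Some x) (Basic (K - {x}) (insert x J))"
    using basic_pick[of x K F I P J] insert.prems by (simp add: add_fact_def)
  moreover have "\<exists>xs n. run (alg_step F I P) (Basic (K - {x}) (insert x J)) xs n
      (Basic (K - {x} - A) (insert x J \<union> A))"
    using insert by (intro insert.IH) auto
  ultimately show ?case by (simp add: Diff_insert2[symmetric]) (metis Diff_insert run_choice)
qed

lemma basic_run_reject_all:
  assumes "finite K" "\<forall>x \<in> K. x \<notin> J \<longrightarrow> \<not> consistent F (insert x J)"
  shows "\<exists>xs n. run (alg_step F I P) (Basic K J) xs n (Test J)"
  using assms
proof (induction K rule: finite_induct)
  case empty
  then show ?case by (meson run_refl run_silent basic_done)
next
  case (insert x A)
  have "add_fact F J x = J" using insert.prems by (auto simp: add_fact_def)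
  then have "alg_step F I P (Basic (insert x A) J) (Some x) (Basic A J)"
    using basic_pick[of x "insert x A" F I P J] insert.hyps by simp
  then show ?case using insert by (meson insertCI run_choice)
qed

lemma alg_complete:
  assumes "finite I" and rep: "repair F I J" and "pareto_optimal F I P J"
  shows "\<exists>xs n. run (alg_step F I P) (Basic I {}) xs n (Return J)"
proof -
  have J: "J \<subseteq> I" "consistent F J" "finite J"
    using rep assms(1) by (auto simp: repair_def intro: finite_subset)
  obtain xs n where 1: "run (alg_step F I P) (Basic I {}) xs n (Basic (I - J) J)"
    using basic_run_accept_all[of J F "{}" I I P] J by auto
  obtain ys m where 2: "run (alg_step F I P) (Basic (I - J) J) ys m (Test J)"
    using basic_run_reject_all[of "I - J" J F I P] assms(1) repair_insert[OF rep] by auto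
  have 3: "run (alg_step F I P) (Test J) [] 1 (Return J)"
    using test_success[OF assms(3)] by (auto intro: run.intros)
  show ?thesis using run_append[OF run_append[OF 1 2] 3] by blast
qed

section \<open>Step bounds for programs\<close>

text \<open>Merges the two labelled cases of \<open>run\<close> into one: a silent step contributes
  the empty list of choices.\<close>

definition enc_label :: "'l option \<Rightarrow> 'l list" where
  "enc_label l = (case l of None \<Rightarrow> [] | Some x \<Rightarrow> [x])"

lemma enc_label_simps [simp]: "enc_label None = []" "enc_label (Some x) = [x]"
  by (simp_all add: enc_label_def)

lemma run_step:
  assumes "step s l s'" "run step s' xs n t"
  shows "run step s (enc_label l @ xs) (Suc n) t"
  using assms by (cases l) (auto intro: run.intros)

lemma run_cases_label:
  assumes "run step s xs n t"
  obtains "xs = []" "n = 0" "t = s"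
  | l s' ys m where "step s l s'" "run step s' ys m t" "xs = enc_label l @ ys" "n = Suc m"
  using assms by (cases rule: run.cases) (force intro: that)+

text \<open>All runs from the configuration reach \<open>Skip\<close> within \<open>n\<close> steps, and \<open>Q\<close> holds for the list of
  choices and the final store of each of them.\<close>

fun safe :: "nat \<Rightarrow> com \<times> store \<Rightarrow> (tree list \<Rightarrow> store \<Rightarrow> bool) \<Rightarrow> bool" where
  "safe 0 (c, s) Q \<longleftrightarrow> c = Skip \<and> Q [] s"
| "safe (Suc n) (c, s) Q \<longleftrightarrow> (if c = Skip then Q [] s else
     (\<exists>l k. com_step (c, s) l k) \<and>
     (\<forall>l k. com_step (c, s) l k \<longrightarrow> safe n k (\<lambda>as. Q (enc_label l @ as))))"

inductive_cases SkipE [elim!]: "com_step (Skip, s) l k"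
inductive_cases AssignE [elim!]: "com_step (Assign x e, s) l k"
inductive_cases SeqE: "com_step (Seq c d, s) l k"
inductive_cases IfE: "com_step (If e c d, s) l k"
inductive_cases WhileE [elim!]: "com_step (While e c, s) l k"
inductive_cases ChooseE [elim!]: "com_step (Choose x e, s) l k"

declare safe.simps(2) [simp del]

lemma safe_SucI:
  assumes "com_step (c, s) l0 k0"
    and "\<And>l c' s'. com_step (c, s) l (c', s') \<Longrightarrow> safe n (c', s') (\<lambda>as. Q (enc_label l @ as))"
  shows "safe (Suc n) (c, s) Q"
proof -
  have "c \<noteq> Skip" "\<exists>l k. com_step (c, s) l k" using assms(1) by blast+
  moreover have "\<forall>l k. com_step (c, s) l k \<longrightarrow> safe n k (\<lambda>as. Q (enc_label l @ as))"
    using assms(2) by auto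
  ultimately show ?thesis by (simp only: safe.simps(2) if_False simp_thms)
qed

lemma safe_SucD:
  assumes "safe (Suc n) (c, s) Q" "com_step (c, s) l k"
  shows "safe n k (\<lambda>as. Q (enc_label l @ as))"
  using assms unfolding safe.simps(2) by (cases k) (auto split: if_splits)

lemma safe_step_exists:
  assumes "safe n (c, s) Q" "c \<noteq> Skip"
  obtains l k where "com_step (c, s) l k"
  using assms by (cases n) (auto simp: safe.simps(2))

lemma safe_Skip_iff [simp]: "safe n (Skip, s) Q \<longleftrightarrow> Q [] s"
  by (cases n) (auto simp: safe.simps(2))

lemma safe_mono:
  "safe n (c, s) Q \<Longrightarrow> n \<le> m \<Longrightarrow> (\<And>as s'. Q as s' \<Longrightarrow> Q' as s') \<Longrightarrow> safe m (c, s) Q'"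
proof (induction n arbitrary: m c s Q Q')
  case 0
  then show ?case by auto
next
  case (Suc n)
  then obtain m' where m: "m = Suc m'" by (cases m) auto
  show ?case
  proof (cases "c = Skip")
    case True
    then show ?thesis using Suc.prems by auto
  next
    case False
    with Suc.prems(1) obtain l0 k0 where st: "com_step (c, s) l0 k0" by (rule safe_step_exists)
    show ?thesis unfolding m
    proof (rule safe_SucI[OF st])
      fix l c' s' assume "com_step (c, s) l (c', s')"
      then have "safe n (c', s') (\<lambda>as. Q (enc_label l @ as))"
        by (rule safe_SucD[OF Suc.prems(1)])
      then show "safe m' (c', s') (\<lambda>as. Q' (enc_label l @ as))"
        by (rule Suc.IH) (use Suc.prems m in auto)
    qed
  qed
qed

text \<open>Unfinished runs are covered too, since the time bound and the absence of stuck
  configurations concern every run.\<close>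

lemma safe_run:
  "run com_step k as n (c', s') \<Longrightarrow> safe N k Q \<Longrightarrow>
     n \<le> N \<and> (halted com_step (c', s') \<longrightarrow> c' = Skip) \<and> (c' = Skip \<longrightarrow> Q as s')"
proof (induction N arbitrary: k as n Q)
  case 0
  obtain c s where k: "k = (c, s)" by (cases k)
  from 0 show ?case unfolding k by (cases rule: run_cases_label) auto
next
  case (Suc N)
  obtain c s where k: "k = (c, s)" by (cases k)
  from Suc.prems(1) show ?case
  proof (cases rule: run_cases_label)
    case 1
    then show ?thesis using Suc.prems k by (auto simp: halted_def elim: safe_step_exists)
  next
    case (2 l k' ys m)
    then have "safe N k' (\<lambda>as. Q (enc_label l @ as))" using Suc.prems(2) k safe_SucD by blast
    from Suc.IH[OF 2(2) this] show ?thesis using 2 by auto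
  qed
qed

text \<open>Every configuration other than \<open>Skip\<close> has a step, so following arbitrary
  successors ends in \<open>Skip\<close>; which choices are made on the way is left open.\<close>

lemma safe_terminates:
  "safe N k Q \<Longrightarrow> \<exists>as n s'. run com_step k as n (Skip, s') \<and> Q as s'"
proof (induction N arbitrary: k Q)
  case 0
  obtain c s where k: "k = (c, s)" by (cases k)
  with 0 show ?case by (auto intro: run_refl)
next
  case (Suc N)
  obtain c s where k: "k = (c, s)" by (cases k)
  show ?case
  proof (cases "c = Skip")
    case True
    then show ?thesis using Suc.prems k by (auto intro: run_refl)
  next
    case False
    then obtain l k' where st: "com_step (c, s) l k'"
      using Suc.prems k safe_step_exists by metis
    then have "safe N k' (\<lambda>as. Q (enc_label l @ as))" using Suc.prems k safe_SucD by blast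
    from Suc.IH[OF this] obtain as n s' where
      "run com_step k' as n (Skip, s')" "Q (enc_label l @ as) s'" by blast
    with run_step[of com_step, OF st] show ?thesis unfolding k by blast
  qed
qed

section \<open>Step bounds for the individual commands\<close>

lemma safe_assign: "Q [] (s(x := exp_val s e)) \<Longrightarrow> safe (Suc n) (Assign x e, s) Q"
  by (rule safe_SucI, rule com_step.intros) auto

lemma safe_choose:
  assumes "exp_val s e \<noteq> Leaf" "\<And>a. a \<in> elements (exp_val s e) \<Longrightarrow> Q [a] (s(x := a))"
  shows "safe (Suc n) (Choose x e, s) Q"
proof -
  have "\<exists>a. a \<in> elements (exp_val s e)" using assms(1) by (cases "exp_val s e") auto
  then obtain a where "com_step (Choose x e, s) (Some a) (Skip, s(x := a))"
    by (blast intro: com_step.intros)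
  then show ?thesis by (rule safe_SucI) (use assms in auto)
qed

text \<open>The extra step is the one that drops the finished \<open>Skip\<close>.\<close>

lemma safe_seq:
  "safe n (c, s) (\<lambda>as s'. safe m (d, s') (\<lambda>bs. Q (as @ bs))) \<Longrightarrow> safe (Suc (n + m)) (Seq c d, s) Q"
proof (induction n arbitrary: c s Q)
  case 0
  then have "safe m (d, s) Q" and c: "c = Skip" by auto
  have "com_step (Seq Skip d, s) None (d, s)" by (rule com_step.intros)
  then show ?case unfolding c by (rule safe_SucI) (use \<open>safe m (d, s) Q\<close> in \<open>auto elim!: SeqE\<close>)
next
  case (Suc n)
  show ?case
  proof (cases "c = Skip")
    case True
    then have "safe m (d, s) Q" using Suc.prems by simp
    then have *: "safe (Suc n + m) (d, s) Q" by (rule safe_mono) auto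
    have "com_step (Seq Skip d, s) None (d, s)" by (rule com_step.intros)
    then show ?thesis unfolding True by (rule safe_SucI) (use * in \<open>auto elim!: SeqE\<close>)
  next
    case False
    then obtain l c' s' where "com_step (c, s) l (c', s')"
      using safe_step_exists[OF Suc.prems] by (metis prod.exhaust)
    then have "com_step (Seq c d, s) l (Seq c' d, s')" by (rule com_step.intros)
    then have "safe (Suc (Suc n + m)) (Seq c d, s) Q"
    proof (rule safe_SucI)
      fix l k1 k2 assume "com_step (Seq c d, s) l (k1, k2)"
      then obtain c' where 2: "com_step (c, s) l (c', k2)" "k1 = Seq c' d"
        using False by (auto elim: SeqE)
      show "safe (Suc n + m) (k1, k2) (\<lambda>as. Q (enc_label l @ as))"
      proof -
        have "safe n (c', k2) (\<lambda>as s'. safe m (d, s') (\<lambda>bs. Q ((enc_label l @ as) @ bs)))"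
          using safe_SucD[OF Suc.prems 2(1)] by simp
        then show ?thesis using Suc.IH[of c' k2 "\<lambda>as. Q (enc_label l @ as)"] 2 by simp
      qed
    qed
    then show ?thesis by simp
  qed
qed

lemma safe_if:
  assumes "exp_val s e \<noteq> Leaf \<Longrightarrow> safe n (c, s) Q" "exp_val s e = Leaf \<Longrightarrow> safe n (d, s) Q"
  shows "safe (Suc n) (If e c d, s) Q"
proof (cases "exp_val s e = Leaf")
  case True
  then have "com_step (If e c d, s) None (d, s)" by (rule com_step.intros)
  then show ?thesis by (rule safe_SucI) (use assms True in \<open>auto elim!: IfE\<close>)
next
  case False
  then have "com_step (If e c d, s) None (c, s)" by (rule com_step.intros)
  then show ?thesis by (rule safe_SucI) (use assms False in \<open>auto elim!: IfE\<close>)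
qed

text \<open>The two extra steps unfold the loop to an \<open>If\<close> and evaluate its
  test.\<close>

lemma safe_while:
  assumes "exp_val s e \<noteq> Leaf \<Longrightarrow> safe n (Seq c (While e c), s) Q" "exp_val s e = Leaf \<Longrightarrow> Q [] s"
  shows "safe (Suc (Suc n)) (While e c, s) Q"
proof -
  have *: "safe (Suc n) (If e (Seq c (While e c)) Skip, s) Q"
    using assms by (intro safe_if) auto
  have "com_step (While e c, s) None (If e (Seq c (While e c)) Skip, s)" by (rule com_step.intros)
  then show ?thesis by (rule safe_SucI) (use * in auto)
qed

section \<open>Polynomial-time functions on trees\<close>

lemma poly_nat_mono: "m \<le> n \<Longrightarrow> poly p m \<le> poly (p :: nat poly) n"
  by (induction p) (auto intro!: mult_mono)

text \<open>Variables below \<open>k\<close> are scratch with arbitrary initial contents; those from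
  \<open>k\<close> on are preserved, so that a surrounding program can keep values there.\<close>

definition computes :: "com \<Rightarrow> nat \<Rightarrow> (nat \<Rightarrow> nat) \<Rightarrow> (tree \<Rightarrow> tree) \<Rightarrow> bool" where
  "computes c k T f \<longleftrightarrow> (\<forall>s. safe (T (size (s 0))) (c, s)
     (\<lambda>as s'. as = [] \<and> s' 0 = f (s 0) \<and> (\<forall>x\<ge>k. s' x = s x)))"

text \<open>The size bound does not follow from the time bound: with shared subtrees, \<open>n\<close> steps can build a
  tree of size exponential in \<open>n\<close>.\<close>

definition ptime :: "(tree \<Rightarrow> tree) \<Rightarrow> bool" where
  "ptime f \<longleftrightarrow> (\<exists>c k p. 0 < k \<and> computes c k (poly p) f \<and> (\<forall>t. size (f t) \<le> poly p (size t)))"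

lemma computesI:
  "(\<And>s. safe (T (size (s 0))) (c, s) (\<lambda>as s'. as = [] \<and> s' 0 = f (s 0) \<and> (\<forall>x\<ge>k. s' x = s x)))
    \<Longrightarrow> computes c k T f"
  by (auto simp: computes_def)

lemma computesD:
  assumes "computes c k T f"
  shows "safe (T (size (s 0))) (c, s) (\<lambda>as s'. as = [] \<and> s' 0 = f (s 0) \<and> (\<forall>x\<ge>k. s' x = s x))"
  using assms by (auto simp: computes_def)

lemma computes_safe:
  assumes "computes c k T f" "T (size (s 0)) \<le> n"
    and "\<And>s'. s' 0 = f (s 0) \<Longrightarrow> \<forall>x\<ge>k. s' x = s x \<Longrightarrow> Q [] s'"
  shows "safe n (c, s) Q"
  using computesD[OF assms(1)] assms(2) by (rule safe_mono) (use assms(3) in auto)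

lemma computes_mono: "computes c k T f \<Longrightarrow> k \<le> k' \<Longrightarrow> (\<And>n. T n \<le> T' n) \<Longrightarrow> computes c k' T' f"
  by (rule computesI) (erule computes_safe, auto)

lemma ptimeI:
  assumes "0 < k" "computes c k T f" "\<And>n. T n \<le> poly p n" "\<And>t. size (f t) \<le> poly q (size t)"
  shows "ptime f"
proof -
  have "computes c k (poly (p + q)) f"
    by (rule computes_mono[OF assms(2)]) (auto intro: trans_le_add1 assms(3))
  moreover have "size (f t) \<le> poly (p + q) (size t)" for t
    using assms(4)[of t] by simp
  ultimately show ?thesis using assms(1) unfolding ptime_def by blast
qed

lemma ptime_assign:
  assumes "\<And>s. exp_val s e = f (s 0)" "\<And>t. size (f t) \<le> poly q (size t)"
  shows "ptime f"
proof (rule ptimeI[of 1 "Assign 0 e" "\<lambda>_. Suc 0" f "[:1:]"])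
  show "computes (Assign 0 e) 1 (\<lambda>_. Suc 0) f"
    by (rule computesI, rule safe_assign) (simp add: assms)
qed (use assms(2) in auto)

lemma ptime_id: "ptime (\<lambda>t. t)"
  by (rule ptime_assign[of "V 0" _ "[:0, 1:]"]) auto

fun tree_exp :: "tree \<Rightarrow> exp" where
  "tree_exp Leaf = LeafE"
| "tree_exp (Node a b) = NodeE (tree_exp a) (tree_exp b)"

lemma exp_val_tree_exp [simp]: "exp_val s (tree_exp t) = t"
  by (induction t) auto

lemma ptime_const: "ptime (\<lambda>_. t)"
  by (rule ptime_assign[of "tree_exp t" _ "[:size t:]"]) auto

text \<open>The program for \<open>f\<close> runs on a tree of size at most \<open>poly q n\<close>,
  so monotonicity gives the composed polynomial. This is where the size bound in
  \<open>ptime\<close> enters.\<close>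

lemma ptime_comp:
  assumes "ptime f" "ptime g"
  shows "ptime (\<lambda>t. f (g t))"
proof -
  obtain c k p where f: "0 < k" "computes c k (poly p) f" "\<And>t. size (f t) \<le> poly p (size t)"
    using assms(1) unfolding ptime_def by blast
  obtain d l q where g: "0 < l" "computes d l (poly q) g" "\<And>t. size (g t) \<le> poly q (size t)"
    using assms(2) unfolding ptime_def by blast
  define T where "T n = Suc (poly q n + poly p (poly q n))" for n
  show ?thesis
  proof (rule ptimeI)
    show "0 < max k l" using f by simp
    show "computes (Seq d c) (max k l) T (\<lambda>t. f (g t))"
      unfolding T_def
      by (rule computesI, rule safe_seq, rule computes_safe[OF g(2)], simp,
          rule computes_safe[OF f(2)]) (auto intro: poly_nat_mono g)
    show "T n \<le> poly (1 + q + pcompose p q) n" for n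
      by (simp add: T_def poly_pcompose)
    show "size (f (g t)) \<le> poly (pcompose p q) (size t)" for t
      using f(3)[of "g t"] poly_nat_mono[OF g(3)] by (simp add: poly_pcompose) (meson order_trans)
  qed
qed

lemma size_hd_tree: "size (hd_tree t) \<le> size t" and size_tl_tree: "size (tl_tree t) \<le> size t"
  by (cases t; simp)+

lemma ptime_hd: "ptime f \<Longrightarrow> ptime (\<lambda>t. hd_tree (f t))"
  by (rule ptime_comp, rule ptime_assign[of "Hd (V 0)" _ "[:0, 1:]"]) (auto simp: size_hd_tree)

lemma ptime_tl: "ptime f \<Longrightarrow> ptime (\<lambda>t. tl_tree (f t))"
  by (rule ptime_comp, rule ptime_assign[of "Tl (V 0)" _ "[:0, 1:]"]) (auto simp: size_tl_tree)

lemma ptime_Node: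
  assumes "ptime f" "ptime g"
  shows "ptime (\<lambda>t. Node (f t) (g t))"
proof -
  obtain c k p where f: "0 < k" "computes c k (poly p) f" "\<And>t. size (f t) \<le> poly p (size t)"
    using assms(1) unfolding ptime_def by blast
  obtain d l q where g: "0 < l" "computes d l (poly q) g" "\<And>t. size (g t) \<le> poly q (size t)"
    using assms(2) unfolding ptime_def by blast
  \<comment> \<open>Both programs preserve the variables from \<open>m\<close> on: \<open>m\<close>
    keeps the input for \<open>d\<close>, and \<open>Suc m\<close> keeps the result of
    \<open>c\<close>.\<close>
  define m where "m = max k l"
  have m: "0 < m" "k \<le> m" "l \<le> m" using f by (auto simp: m_def)
  let ?c = "Seq (Assign m (V 0)) (Seq c (Seq (Assign (Suc m) (V 0)) (Seq (Assign 0 (V m))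
    (Seq d (Assign 0 (NodeE (V (Suc m)) (V 0)))))))"
  let ?T = "\<lambda>n. Suc (1 + Suc (poly p n + Suc (1 + Suc (1 + Suc (poly q n + 1)))))"
  show ?thesis
  proof (rule ptimeI)
    show "0 < Suc (Suc m)" by simp
    show "computes ?c (Suc (Suc m)) ?T (\<lambda>t. Node (f t) (g t))"
      apply (rule computesI, rule safe_seq, unfold One_nat_def, rule safe_assign)
      apply (rule safe_seq, rule computes_safe[OF f(2)])
      subgoal using m by simp
      apply (rule safe_seq, rule safe_assign)
      apply (rule safe_seq, rule safe_assign)
      apply (rule safe_seq, rule computes_safe[OF g(2)])
      subgoal using m by simp
      apply (rule safe_assign)
      apply (simp, intro conjI allI impI)
      subgoal premises prems using prems(4)[rule_format, of "Suc m"] m by simp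
      subgoal premises prems using prems(2)[rule_format, of m] m by simp
      subgoal premises prems for s s' s'' x
        using prems(2)[rule_format, of x] prems(4)[rule_format, of x] prems(5) m by simp
      done
    show "?T n \<le> poly (p + q + [:9:]) n" for n by simp
    show "size (Node (f t) (g t)) \<le> poly (p + q + 1) (size t)" for t
      using f(3)[of t] g(3)[of t] by simp
  qed
qed

definition of_bool_tree :: "bool \<Rightarrow> tree" where
  "of_bool_tree b = (if b then Node Leaf Leaf else Leaf)"

lemma of_bool_tree_simps [simp]:
  "of_bool_tree True = Node Leaf Leaf" "of_bool_tree False = Leaf"
  "of_bool_tree b = Leaf \<longleftrightarrow> \<not> b" "of_bool_tree b = of_bool_tree c \<longleftrightarrow> b = c"
  by (auto simp: of_bool_tree_def)

lemma size_of_bool_tree [simp]: "size (of_bool_tree b) \<le> Suc 0"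
  by (simp add: of_bool_tree_def)

definition decidable :: "(tree \<Rightarrow> bool) \<Rightarrow> bool" where
  "decidable P \<longleftrightarrow> ptime (\<lambda>t. of_bool_tree (P t))"

lemma decidable_comp: "decidable P \<Longrightarrow> ptime f \<Longrightarrow> decidable (\<lambda>t. P (f t))"
  unfolding decidable_def by (rule ptime_comp)

text \<open>Programs have a single input, so a binary operation is treated with its arguments packed
  into one \<open>Node\<close> and is instantiated by this rule.\<close>

lemma ptime_comp2:
  assumes "ptime (\<lambda>u. F (hd_tree u) (tl_tree u))" "ptime f" "ptime g"
  shows "ptime (\<lambda>t. F (f t) (g t))"
  using ptime_comp[OF assms(1) ptime_Node[OF assms(2,3)]] by simp

lemma decidable_comp2:
  assumes "decidable (\<lambda>u. F (hd_tree u) (tl_tree u))" "ptime f" "ptime g"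
  shows "decidable (\<lambda>t. F (f t) (g t))"
  using decidable_comp[OF assms(1) ptime_Node[OF assms(2,3)]] by simp

lemma ptime_if:
  assumes "decidable P" "ptime f" "ptime g"
  shows "ptime (\<lambda>t. if P t then f t else g t)"
proof -
  \<comment> \<open>Evaluating \<open>P\<close> would overwrite the input, so its truth value is
    paired with the input and both branches read the second component.\<close>
  have *: "ptime (\<lambda>u. if hd_tree u \<noteq> Leaf then f (tl_tree u) else g (tl_tree u))" (is "ptime ?h")
  proof -
    have "ptime (\<lambda>u. f (tl_tree u))" by (rule ptime_comp[OF assms(2) ptime_tl[OF ptime_id]])
    then obtain c k p where f: "0 < k" "computes c k (poly p) (\<lambda>u. f (tl_tree u))"
        "\<And>t. size (f (tl_tree t)) \<le> poly p (size t)"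
      unfolding ptime_def by blast
    have "ptime (\<lambda>u. g (tl_tree u))" by (rule ptime_comp[OF assms(3) ptime_tl[OF ptime_id]])
    then obtain d l q where g: "0 < l" "computes d l (poly q) (\<lambda>u. g (tl_tree u))"
        "\<And>t. size (g (tl_tree t)) \<le> poly q (size t)"
      unfolding ptime_def by blast
    show ?thesis
    proof (rule ptimeI)
      show "0 < max k l" using f by simp
      show "computes (If (Hd (V 0)) c d) (max k l) (\<lambda>n. Suc (poly p n + poly q n)) ?h"
        apply (rule computesI, rule safe_if)
         apply (rule computes_safe[OF f(2)], simp, simp)
        apply (rule computes_safe[OF g(2)], simp, simp)
        done
      show "Suc (poly p n + poly q n) \<le> poly (1 + p + q) n" for n by simp
      show "size (?h t) \<le> poly (p + q) (size t)" for t
        using f(3)[of t] g(3)[of t] by auto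
    qed
  qed
  show ?thesis
    using ptime_comp[OF * ptime_Node[OF assms(1)[unfolded decidable_def] ptime_id]]
    by (simp cong: if_cong)
qed

lemma decidable_if:
  assumes "decidable P" "decidable Q" "decidable R"
  shows "decidable (\<lambda>t. if P t then Q t else R t)"
  using ptime_if[OF assms(1) assms(2,3)[unfolded decidable_def]]
  by (simp add: decidable_def if_distrib)

lemma decidable_const: "decidable (\<lambda>_. b)"
  unfolding decidable_def by (rule ptime_const)

lemma decidable_not:
  assumes "decidable P" shows "decidable (\<lambda>t. \<not> P t)"
proof -
  have "decidable (\<lambda>t. if P t then False else True)"
    by (intro decidable_if assms decidable_const)
  moreover have "(\<lambda>t. if P t then False else True) = (\<lambda>t. \<not> P t)" by auto
  ultimately show ?thesis by simp
qed

lemma decidable_conj: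
  assumes "decidable P" "decidable Q" shows "decidable (\<lambda>t. P t \<and> Q t)"
proof -
  have "decidable (\<lambda>t. if P t then Q t else False)"
    by (intro decidable_if assms decidable_const)
  moreover have "(\<lambda>t. if P t then Q t else False) = (\<lambda>t. P t \<and> Q t)" by auto
  ultimately show ?thesis by simp
qed

lemma decidable_disj:
  assumes "decidable P" "decidable Q" shows "decidable (\<lambda>t. P t \<or> Q t)"
  using decidable_not[OF decidable_conj[OF decidable_not[OF assms(1)] decidable_not[OF assms(2)]]]
  by simp

lemma decidable_neq_Leaf: "ptime f \<Longrightarrow> decidable (\<lambda>t. f t \<noteq> Leaf)"
proof -
  assume f: "ptime f"
  have "ptime (\<lambda>u. of_bool_tree (u \<noteq> Leaf))"
    apply (rule ptimeI[of 1 "If (V 0) (Assign 0 (NodeE LeafE LeafE)) Skip" "\<lambda>_. Suc (Suc 0)" _ "[:2:]" "[:1:]"])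
       apply simp
      apply (rule computesI, rule safe_if, rule safe_assign, simp, simp)
      apply (auto simp: of_bool_tree_def)
    done
  then show ?thesis unfolding decidable_def using f by (rule ptime_comp)
qed

text \<open>The loop state carries the value of the test next to \<open>u\<close>, which makes the
  \<open>While\<close> test the constant-size expression \<open>Hd (V 0)\<close>. \<open>Inv\<close>
  bounds every intermediate state in terms of the original input \<open>t\<close>, and
  \<open>N\<close> bounds the number of rounds.\<close>

lemma ptime_while:
  assumes B: "decidable B" and g: "ptime g" and init: "ptime init"
    and I0: "\<And>t. Inv t (init t)"
    and IS: "\<And>t u. Inv t u \<Longrightarrow> B u \<Longrightarrow> Inv t (g u) \<and> N (g u) < (N u :: nat)"
    and sz: "\<And>t u. Inv t u \<Longrightarrow> size u \<le> poly q (size t)"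
    and N: "\<And>t. N (init t) \<le> poly r (size t)"
  shows "ptime (\<lambda>t. while B g (init t))"
proof -
  let ?F = "\<lambda>t. Node (of_bool_tree (B t)) t"
  have F: "ptime ?F" using B unfolding decidable_def by (intro ptime_Node ptime_id)
  have "ptime (\<lambda>t. ?F (init t))" by (rule ptime_comp[OF F init])
  then obtain c1 k1 p1 where c1: "0 < k1" "computes c1 k1 (poly p1) (\<lambda>t. ?F (init t))"
    unfolding ptime_def by blast
  have "ptime (\<lambda>u. ?F (g (tl_tree u)))"
    by (intro ptime_comp[OF F] ptime_comp[OF g] ptime_tl ptime_id)
  then obtain c2 k2 p2 where c2: "0 < k2" "computes c2 k2 (poly p2) (\<lambda>u. ?F (g (tl_tree u)))"
    unfolding ptime_def by blast
  define k where "k = max k1 k2"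
  have k: "0 < k" "k1 \<le> k" "k2 \<le> k" using c1 by (auto simp: k_def)
  let ?W = "While (Hd (V 0)) c2"
  \<comment> \<open>\<open>poly q (size t) + 2\<close> bounds the state together with its flag; a
    round costs one execution of \<open>c2\<close> and 3 administrative steps.\<close>
  have loop: "safe (3 + m * (3 + poly p2 (poly q (size t) + 2))) (?W, s)
      (\<lambda>as s'. as = [] \<and> tl_tree (s' 0) = while B g u \<and> (\<forall>x\<ge>k. s' x = s x))"
    if "Inv t u" "s 0 = ?F u" "N u \<le> m" for t u s m
    using that
  proof (induction m arbitrary: u s)
    case 0
    then have "\<not> B u" using IS[of t u] by auto
    then have "safe 2 (?W, s)
      (\<lambda>as s'. as = [] \<and> tl_tree (s' 0) = while B g u \<and> (\<forall>x\<ge>k. s' x = s x))"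
      using 0 unfolding numeral_2_eq_2 by (intro safe_while) (auto simp: while_unfold[of B g u])
    then show ?case by (rule safe_mono) auto
  next
    case (Suc m)
    let ?T = "poly p2 (poly q (size t) + 2)"
    have "safe (Suc (Suc (Suc (?T + (3 + m * (3 + ?T)))))) (?W, s)
      (\<lambda>as s'. as = [] \<and> tl_tree (s' 0) = while B g u \<and> (\<forall>x\<ge>k. s' x = s x))"
    proof (rule safe_while, rule safe_seq)
      assume "exp_val s (Hd (V 0)) \<noteq> Leaf"
      then have Bu: "B u" using Suc.prems by (auto split: if_splits)
      have "size (s 0) \<le> poly q (size t) + 2"
        using sz[OF Suc.prems(1)] Suc.prems(2) by (simp add: of_bool_tree_def)
      then show "safe ?T (c2, s) (\<lambda>as s'. safe (3 + m * (3 + ?T)) (?W, s')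
        (\<lambda>bs s''. as @ bs = [] \<and> tl_tree (s'' 0) = while B g u \<and> (\<forall>x\<ge>k. s'' x = s x)))"
      proof (rule computes_safe[OF c2(2) poly_nat_mono])
        fix s' assume s': "s' 0 = ?F (g (tl_tree (s 0)))" "\<forall>x\<ge>k2. s' x = s x"
        have "safe (3 + m * (3 + ?T)) (?W, s')
          (\<lambda>bs s''. bs = [] \<and> tl_tree (s'' 0) = while B g (g u) \<and> (\<forall>x\<ge>k. s'' x = s' x))"
          using IS[OF Suc.prems(1) Bu] Suc.prems s' by (intro Suc.IH) auto
        then show "safe (3 + m * (3 + ?T)) (?W, s')
          (\<lambda>bs s''. [] @ bs = [] \<and> tl_tree (s'' 0) = while B g u \<and> (\<forall>x\<ge>k. s'' x = s x))"
          by (rule safe_mono) (use s' k Bu in \<open>auto simp: while_unfold[of B g u]\<close>)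
      qed
    next
      assume "exp_val s (Hd (V 0)) = Leaf"
      then have Bu: "\<not> B u" using Suc.prems by (auto split: if_splits)
      then show "[] = [] \<and> tl_tree (s 0) = while B g u \<and> (\<forall>x\<ge>k. s x = s x)"
        using Suc.prems by (simp add: while_unfold[of B g u])
    qed
    then show ?case by (rule safe_mono) auto
  qed
  define T where "T n = Suc (poly p1 n + Suc ((3 + poly r n * (3 + poly p2 (poly q n + 2))) + Suc 0))" for n
  have szw: "size (while B g u) \<le> poly q (size t)" if "Inv t u" for t u
    using that
  proof (induction "N u" arbitrary: u rule: less_induct)
    case less
    then show ?case using IS[of t u] sz[of t u] by (cases "B u") (auto simp: while_unfold[of B g u])
  qed
  show ?thesis
  proof (rule ptimeI)
    show "computes (Seq c1 (Seq ?W (Assign 0 (Tl (V 0))))) k T (\<lambda>t. while B g (init t))"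
      unfolding T_def
      apply (rule computesI, rule safe_seq, rule computes_safe[OF c1(2)], simp)
      apply (rule safe_seq)
      subgoal premises prems for s s'
        by (rule safe_mono[OF loop[of "s 0" "init (s 0)" s', OF I0 prems(1) N]], simp)
          (rule safe_assign, use k prems in auto)
      done
    show "T n \<le> poly (p1 + [:6:] + r * ([:3:] + pcompose p2 (q + [:2:]))) n" for n
      by (simp add: T_def poly_pcompose)
    show "size (while B g (init t)) \<le> poly q (size t)" for t by (rule szw[OF I0])
  qed (use k in auto)
qed

lemma ptime_size: "ptime f \<Longrightarrow> \<exists>p. \<forall>t. size (f t) \<le> poly p (size t)"
  unfolding ptime_def by blast

lemmas ptime_intros = ptime_id ptime_const ptime_hd ptime_tl ptime_Node ptime_if
  decidable_const decidable_not decidable_conj decidable_disj decidable_neq_Leaf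

section \<open>Lists as trees: folds, searches, filters and equality\<close>

fun list_of :: "tree \<Rightarrow> tree list" where
  "list_of Leaf = []"
| "list_of (Node a b) = a # list_of b"

abbreviation tree_of :: "tree list \<Rightarrow> tree" where
  "tree_of \<equiv> enc_list (\<lambda>t. t)"

lemma enc_list_simps [simp]: "enc_list e [] = Leaf" "enc_list e (x # xs) = Node (e x) (enc_list e xs)"
  by (simp_all add: enc_list_def)

lemma list_of_enc_list [simp]: "list_of (enc_list e xs) = map e xs"
  by (induction xs) auto

lemma tree_of_list_of [simp]: "tree_of (list_of t) = t"
  by (induction t rule: list_of.induct) auto

lemma enc_list_map: "enc_list e xs = tree_of (map e xs)"
  by (induction xs) auto

lemma elements_list_of: "elements t = set (list_of t)"
  by (induction t rule: list_of.induct) auto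

lemma elements_enc_list [simp]: "elements (enc_list e xs) = e ` set xs"
  by (simp add: elements_list_of)

lemma size_enc_list: "size (enc_list e xs) = (\<Sum>x\<leftarrow>xs. Suc (size (e x)))"
  by (induction xs) auto

lemma length_list_of: "length (list_of t) \<le> size t"
  by (induction t rule: list_of.induct) auto

text \<open>A loop whose state consists of the remaining list, the accumulator and the parameter
  \<open>g t\<close>. The size hypothesis ranges over all prefixes because each partial fold is an
  intermediate state.\<close>

lemma ptime_fold:
  assumes h: "ptime (\<lambda>u. h (hd_tree u) (hd_tree (tl_tree u)) (tl_tree (tl_tree u)))"
    and f: "ptime f" and z: "ptime z" and g: "ptime g"
    and sz: "\<And>t xs ys. list_of (f t) = xs @ ys \<Longrightarrow>
      size (fold (\<lambda>a acc. h a acc (g t)) xs (z t)) \<le> poly q (size t)"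
  shows "ptime (\<lambda>t. fold (\<lambda>a acc. h a acc (g t)) (list_of (f t)) (z t))"
proof -
  let ?B = "\<lambda>u. hd_tree u \<noteq> Leaf"
  let ?s = "\<lambda>u. Node (tl_tree (hd_tree u))
    (Node (h (hd_tree (hd_tree u)) (hd_tree (tl_tree u)) (tl_tree (tl_tree u))) (tl_tree (tl_tree u)))"
  let ?i = "\<lambda>t. Node (f t) (Node (z t) (g t))"
  have "ptime (\<lambda>u. Node (hd_tree (hd_tree u)) (tl_tree u))" by (intro ptime_intros)
  from ptime_comp[OF h this]
  have s: "ptime ?s" by (intro ptime_intros) simp
  obtain pf pg where pf: "\<And>t. size (f t) \<le> poly pf (size t)" and pg: "\<And>t. size (g t) \<le> poly pg (size t)"
    using ptime_size[OF f] ptime_size[OF g] by blast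
  have run: "while ?B ?s (Node l (Node acc p)) = Node Leaf (Node (fold (\<lambda>a acc. h a acc p) (list_of l) acc) p)"
    for l acc p
    by (induction l arbitrary: acc rule: list_of.induct) (simp_all add: while_unfold)
  have "ptime (\<lambda>t. while ?B ?s (?i t))"
  proof (rule ptime_while[where Inv = "\<lambda>t u. \<exists>xs ys. list_of (f t) = xs @ ys \<and>
      u = Node (tree_of ys) (Node (fold (\<lambda>a acc. h a acc (g t)) xs (z t)) (g t))"
      and N = "\<lambda>u. length (list_of (hd_tree u))" and q = "pf + q + pg + [:2:]" and r = pf])
    show "decidable ?B" "ptime ?s" "ptime ?i" by (intro ptime_intros s f z g)+
    show "\<exists>xs ys. list_of (f t) = xs @ ys \<and>
      ?i t = Node (tree_of ys) (Node (fold (\<lambda>a acc. h a acc (g t)) xs (z t)) (g t))" for t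
      by (rule exI[of _ "[]"]) simp
    show "(\<exists>xs ys. list_of (f t) = xs @ ys \<and>
      ?s u = Node (tree_of ys) (Node (fold (\<lambda>a acc. h a acc (g t)) xs (z t)) (g t))) \<and>
      length (list_of (hd_tree (?s u))) < length (list_of (hd_tree u))"
      if ex: "\<exists>xs ys. list_of (f t) = xs @ ys \<and>
      u = Node (tree_of ys) (Node (fold (\<lambda>a acc. h a acc (g t)) xs (z t)) (g t))" and Bu: "?B u" for t u
    proof -
      obtain xs ys where u: "list_of (f t) = xs @ ys"
        "u = Node (tree_of ys) (Node (fold (\<lambda>a acc. h a acc (g t)) xs (z t)) (g t))" using ex by (elim exE conjE)
      with Bu obtain y ys' where ys: "ys = y # ys'" by (cases ys) auto
      show ?thesis using u unfolding ys
        by (intro conjI exI[of _ "xs @ [y]"] exI[of _ ys']) auto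
    qed
    show "size u \<le> poly (pf + q + pg + [:2:]) (size t)" if ex: "\<exists>xs ys. list_of (f t) = xs @ ys \<and>
      u = Node (tree_of ys) (Node (fold (\<lambda>a acc. h a acc (g t)) xs (z t)) (g t))" for t u
    proof -
      obtain xs ys where u: "list_of (f t) = xs @ ys"
        "u = Node (tree_of ys) (Node (fold (\<lambda>a acc. h a acc (g t)) xs (z t)) (g t))" using ex by (elim exE conjE)
      have "size (tree_of ys) \<le> size (tree_of (list_of (f t)))"
        unfolding u(1) size_enc_list by simp
      then show ?thesis using u(2) sz[OF u(1)] pf[of t] pg[of t] by simp
    qed
    show "length (list_of (hd_tree (?i t))) \<le> poly pf (size t)" for t
      using pf[of t] length_list_of[of "f t"] by simp
  qed
  then have "ptime (\<lambda>t. hd_tree (tl_tree (while ?B ?s (?i t))))" by (intro ptime_intros)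
  then show ?thesis unfolding run by simp
qed

lemma decidable_bex:
  assumes Q: "decidable (\<lambda>u. Q (hd_tree u) (tl_tree u))" and f: "ptime f"
  shows "decidable (\<lambda>t. \<exists>a \<in> elements (f t). Q a t)"
proof -
  let ?h = "\<lambda>a acc t. of_bool_tree (acc \<noteq> Leaf \<or> Q a t)"
  have h: "fold (\<lambda>a acc. ?h a acc t) xs (of_bool_tree b) = of_bool_tree (b \<or> (\<exists>a \<in> set xs. Q a t))" for t xs b
    by (induction xs arbitrary: b) auto
  have "decidable (\<lambda>u. Q (hd_tree u) (tl_tree (tl_tree u)))"
    by (rule decidable_comp2[OF Q]) (intro ptime_intros)+
  then have "ptime (\<lambda>u. ?h (hd_tree u) (hd_tree (tl_tree u)) (tl_tree (tl_tree u)))"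
    unfolding decidable_def[symmetric] by (intro ptime_intros)
  then have "ptime (\<lambda>t. fold (\<lambda>a acc. ?h a acc t) (list_of (f t)) (of_bool_tree False))"
  proof (rule ptime_fold[where q = 1])
    show "size (fold (\<lambda>a acc. ?h a acc t) xs (of_bool_tree False)) \<le> poly 1 (size t)" for t xs
      unfolding h by simp
  qed (intro ptime_intros f)+
  then show ?thesis unfolding h decidable_def elements_list_of by simp
qed

text \<open>The order of the remaining elements is reversed, as they are moved one by one to the front of
  the result.\<close>

definition tree_filter :: "(tree \<Rightarrow> bool) \<Rightarrow> tree \<Rightarrow> tree" where
  "tree_filter P t = tree_of (rev (filter P (list_of t)))"

lemma sum_list_filter_le: "(\<Sum>x\<leftarrow>filter P xs. f x) \<le> (\<Sum>x\<leftarrow>xs. f x :: nat)"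
  by (induction xs) auto

lemma size_tree_filter: "size (tree_filter P t) \<le> size t"
proof -
  have "size (tree_filter P t) \<le> size (tree_of (list_of t))"
    unfolding tree_filter_def size_enc_list rev_map[symmetric] sum_list_rev by (rule sum_list_filter_le)
  then show ?thesis by simp
qed

lemma list_of_tree_filter [simp]: "list_of (tree_filter P t) = rev (filter P (list_of t))"
  by (simp add: tree_filter_def)

lemma elements_tree_filter [simp]: "elements (tree_filter P t) = {a \<in> elements t. P a}"
  by (auto simp: elements_list_of)

lemma ptime_filter:
  assumes Q: "decidable (\<lambda>u. Q (hd_tree u) (tl_tree u))" and f: "ptime f"
  shows "ptime (\<lambda>t. tree_filter (\<lambda>a. Q a t) (f t))"
proof -
  let ?h = "\<lambda>a acc t. if Q a t then Node a acc else acc"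
  have h: "fold (\<lambda>a acc. ?h a acc t) xs acc = tree_of (rev (filter (\<lambda>a. Q a t) xs) @ list_of acc)" for t xs acc
    by (induction xs arbitrary: acc) auto
  have d: "decidable (\<lambda>u. Q (hd_tree u) (tl_tree (tl_tree u)))"
    by (rule decidable_comp2[OF Q]) (intro ptime_intros)+
  obtain p where p: "\<And>t. size (f t) \<le> poly p (size t)" using ptime_size[OF f] by blast
  have "ptime (\<lambda>t. fold (\<lambda>a acc. ?h a acc t) (list_of (f t)) Leaf)"
  proof (rule ptime_fold[where q = p])
    show "ptime (\<lambda>u. ?h (hd_tree u) (hd_tree (tl_tree u)) (tl_tree (tl_tree u)))"
      by (intro ptime_intros d)
    fix t xs ys assume "list_of (f t) = xs @ ys"
    then have "size (tree_of xs) \<le> size (tree_of (list_of (f t)))"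
      unfolding size_enc_list by simp
    then have "size (tree_of xs) \<le> poly p (size t)" using p[of t] by simp
    then show "size (fold (\<lambda>a acc. ?h a acc t) xs Leaf) \<le> poly p (size t)"
      using size_tree_filter[of "\<lambda>a. Q a t" "tree_of xs"] by (simp add: h tree_filter_def)
  qed (intro ptime_intros f)+
  then show ?thesis by (simp add: h tree_filter_def)
qed

text \<open>Both trees are traversed in parallel, with a work list of pairs still to be compared. A
  mismatch raises the flag in the head of the state and empties the work list.\<close>

lemma decidable_eq:
  assumes "ptime f" "ptime g"
  shows "decidable (\<lambda>t. f t = g t)"
proof -
  let ?B = "\<lambda>u. tl_tree u \<noteq> Leaf"
  let ?x = "\<lambda>u. hd_tree (hd_tree (tl_tree u))" and ?y = "\<lambda>u. tl_tree (hd_tree (tl_tree u))"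
    and ?r = "\<lambda>u. tl_tree (tl_tree u)"
  let ?s = "\<lambda>u. if ?x u \<noteq> Leaf \<and> ?y u \<noteq> Leaf then Node (hd_tree u) (Node (Node (hd_tree (?x u)) (hd_tree (?y u)))
        (Node (Node (tl_tree (?x u)) (tl_tree (?y u))) (?r u)))
     else if ?x u \<noteq> Leaf \<or> ?y u \<noteq> Leaf then Node (Node Leaf Leaf) Leaf
     else Node (hd_tree u) (?r u)"
  let ?i = "\<lambda>t. Node Leaf (Node (Node (hd_tree t) (tl_tree t)) Leaf)"
  \<comment> \<open>Splitting a pair whose first tree has subtrees of sizes \<open>l\<close> and
    \<open>r\<close> replaces the weight \<open>2 * (l + r + 1) + 1\<close> by
    \<open>2 * l + 1\<close> and \<open>2 * r + 1\<close>; the factor 2 pays for the additional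
    pair.\<close>
  define N where "N u = (\<Sum>p\<leftarrow>list_of (tl_tree u). 2 * size (hd_tree p) + 1)" for u
  have N_dec: "N (?s u) < N u" if "?B u" for u
  proof -
    obtain p r where r: "tl_tree u = Node p r" using \<open>?B u\<close> by (cases "tl_tree u") auto
    show ?thesis using r by (cases "hd_tree p"; cases "tl_tree p") (auto simp: N_def)
  qed
  have run: "hd_tree (while ?B ?s u) = Leaf \<longleftrightarrow> hd_tree u = Leaf \<and> (\<forall>p \<in> elements (tl_tree u). hd_tree p = tl_tree p)" for u
  proof (induction "N u" arbitrary: u rule: less_induct)
    case less
    show ?case
    proof (cases "?B u")
      case False
      then show ?thesis by (simp add: while_unfold[of ?B ?s u])
    next
      case True
      then obtain p r where r: "tl_tree u = Node p r" by (cases "tl_tree u") auto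
      have "hd_tree (while ?B ?s u) = Leaf \<longleftrightarrow> hd_tree (while ?B ?s (?s u)) = Leaf"
        using True by (subst while_unfold) simp
      also have "\<dots> \<longleftrightarrow> hd_tree (?s u) = Leaf \<and> (\<forall>p \<in> elements (tl_tree (?s u)). hd_tree p = tl_tree p)"
        by (rule less) (rule N_dec[OF True])
      also have "\<dots> \<longleftrightarrow> hd_tree u = Leaf \<and> (\<forall>p \<in> elements (tl_tree u). hd_tree p = tl_tree p)"
        using r by (cases "hd_tree p"; cases "tl_tree p") auto
      finally show ?thesis .
    qed
  qed
  have "ptime (\<lambda>t. while ?B ?s (?i t))"
  \<comment> \<open>Splitting a pair preserves the size of the work list: the two root nodes that
    disappear make up for the new pair and the new list cell.\<close>
  proof (rule ptime_while[where Inv = "\<lambda>t u. size (hd_tree u) \<le> 1 \<and> size (tl_tree u) \<le> size t + 2"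
      and N = N and q = "[:4, 1:]" and r = "[:1, 2:]"])
    show "decidable ?B" "ptime ?s" "ptime ?i" by (intro ptime_intros)+
    show "size (hd_tree (?i t)) \<le> 1 \<and> size (tl_tree (?i t)) \<le> size t + 2" for t by (cases t) auto
    show "(size (hd_tree (?s u)) \<le> 1 \<and> size (tl_tree (?s u)) \<le> size t + 2) \<and> N (?s u) < N u"
      if "size (hd_tree u) \<le> 1 \<and> size (tl_tree u) \<le> size t + 2" "?B u" for t u
    proof
      obtain p r where r: "tl_tree u = Node p r" using \<open>?B u\<close> by (cases "tl_tree u") auto
      show "size (hd_tree (?s u)) \<le> 1 \<and> size (tl_tree (?s u)) \<le> size t + 2"
        using that(1) r by (cases p; cases "hd_tree p"; cases "tl_tree p") auto
    qed (rule N_dec[OF that(2)])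
    show "size u \<le> poly [:4, 1:] (size t)"
      if "size (hd_tree u) \<le> 1 \<and> size (tl_tree u) \<le> size t + 2" for t u
      using that by (cases u) auto
    show "N (?i t) \<le> poly [:1, 2:] (size t)" for t
      using size_hd_tree[of t] by (simp add: N_def)
  qed
  then have "decidable (\<lambda>t. \<not> hd_tree (while ?B ?s (?i t)) \<noteq> Leaf)" by (intro ptime_intros)
  then have "decidable (\<lambda>t. hd_tree t = tl_tree t)" unfolding run by simp
  then show ?thesis using assms by (rule decidable_comp2)
qed

lemma decidable_mem: "ptime f \<Longrightarrow> ptime g \<Longrightarrow> decidable (\<lambda>t. f t \<in> elements (g t))"
proof -
  assume f: "ptime f" and g: "ptime g"
  have "decidable (\<lambda>t. \<exists>a \<in> elements (g t). a = f t)"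
    by (intro decidable_bex g decidable_eq ptime_intros ptime_comp[OF f])
  then show ?thesis by (simp add: bex_simps Bex_def)
qed

section \<open>Arithmetic on binary numbers\<close>

definition bit :: "tree \<Rightarrow> nat" where
  "bit b = (if b = Leaf then 0 else 1)"

fun bin_val :: "tree \<Rightarrow> nat" where
  "bin_val Leaf = 0"
| "bin_val (Node b t) = bit b + 2 * bin_val t"

lemma bin_val_hd_tl: "bin_val t = bit (hd_tree t) + 2 * bin_val (tl_tree t)"
  by (cases t) (auto simp: bit_def)

lemma bin_val_enc_nat [simp]: "bin_val (enc_nat n) = n"
proof (induction n rule: less_induct)
  case (less n)
  then show ?case
    by (cases "n = 0") (auto simp: enc_nat.simps[of n] enc_nat.simps[of 0] bit_def split: if_splits)
qed

lemma bin_val_less: "bin_val t < 2 ^ length (list_of t)"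
  by (induction t rule: list_of.induct) (auto simp: bit_def)

definition bin_less :: "tree \<Rightarrow> tree \<Rightarrow> bool" where
  "bin_less a b \<longleftrightarrow> bin_val a < bin_val b"

lemma bin_val_pos: "0 < bin_val t \<longleftrightarrow> (\<exists>b \<in> elements t. b \<noteq> Leaf)"
  by (induction t rule: list_of.induct) (auto simp: bit_def)

lemma size_le_hd_tl: "size t \<le> Suc (size (hd_tree t) + size (tl_tree t))"
  by (cases t) auto

text \<open>One pass from the least significant digit. The flag compares the parts read so far and
  is overruled by every later differing digit; a nonzero digit of the second number left at the end
  makes it the larger one.\<close>

lemma decidable_bin_less:
  assumes "ptime f" "ptime g"
  shows "decidable (\<lambda>t. bin_less (f t) (g t))"
proof -
  let ?h = "\<lambda>x acc (p :: tree). Node (if x \<noteq> Leaf \<and> \<not> hd_tree (tl_tree acc) \<noteq> Leaf then Leaf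
      else if \<not> x \<noteq> Leaf \<and> hd_tree (tl_tree acc) \<noteq> Leaf then Node Leaf Leaf else hd_tree acc)
    (tl_tree (tl_tree acc))"
  let ?F = "\<lambda>t. fold (\<lambda>x acc. ?h x acc Leaf) (list_of (hd_tree t)) (Node Leaf (tl_tree t))"
  let ?less = "\<lambda>acc. (\<exists>b \<in> elements (tl_tree acc). b \<noteq> Leaf) \<or> hd_tree acc \<noteq> Leaf"
  \<comment> \<open>Generalised to an arbitrary accumulator, in which the flag decides exactly when
    the remaining digits are tied.\<close>
  have F: "?less (fold (\<lambda>x acc. ?h x acc Leaf) (list_of a) acc) \<longleftrightarrow>
    bin_val a < bin_val (tl_tree acc) \<or> bin_val a = bin_val (tl_tree acc) \<and> hd_tree acc \<noteq> Leaf" for a acc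
  proof (induction a arbitrary: acc rule: list_of.induct)
    case 1
    then show ?case by (auto simp: bin_val_pos[symmetric])
  next
    case (2 x a)
    have *: "bin_val (tl_tree acc) = bit (hd_tree (tl_tree acc)) + 2 * bin_val (tl_tree (tl_tree acc))"
      by (rule bin_val_hd_tl)
    show ?case unfolding list_of.simps fold.simps o_apply 2 unfolding *
      by (auto simp: bit_def)
  qed
  have sz: "size (fold (\<lambda>x acc. ?h x acc Leaf) xs acc) \<le> size (tl_tree acc) + 2"
    if "size (hd_tree acc) \<le> 1" "acc \<noteq> Leaf" for xs acc
    using that
  proof (induction xs arbitrary: acc)
    case Nil
    then show ?case using size_le_hd_tl[of acc] by simp
  next
    case (Cons x xs)
    have "size (fold (\<lambda>x acc. ?h x acc Leaf) xs (?h x acc Leaf)) \<le> size (tl_tree (?h x acc Leaf)) + 2"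
      by (rule Cons.IH) (use Cons.prems in auto)
    then show ?case using size_tl_tree[of "tl_tree acc"] by simp
  qed
  have F_ptime: "ptime ?F"
  proof (rule ptime_fold[where q = "[:2, 1:]" and h = ?h and g = "\<lambda>_. Leaf"])
    show "ptime (\<lambda>u. ?h (hd_tree u) (hd_tree (tl_tree u)) (tl_tree (tl_tree u)))"
      by (intro ptime_intros)
    show "size (fold (\<lambda>x acc. ?h x acc Leaf) xs (Node Leaf (tl_tree t))) \<le> poly [:2, 1:] (size t)" for t xs
      using sz[of "Node Leaf (tl_tree t)" xs] size_tl_tree[of t] by simp
  qed (intro ptime_intros)+
  have "decidable (\<lambda>t. ?less (?F t))"
    by (intro ptime_intros decidable_bex F_ptime)
  then have "decidable (\<lambda>t. bin_less (hd_tree t) (tl_tree t))"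
    unfolding F bin_less_def by simp
  then show ?thesis using assms by (rule decidable_comp2)
qed

fun add_bits :: "nat \<Rightarrow> tree \<Rightarrow> tree \<Rightarrow> tree \<Rightarrow> tree list" where
  "add_bits 0 a b c = []"
| "add_bits (Suc n) a b c =
     of_bool_tree (odd (bit (hd_tree a) + bit (hd_tree b) + bit c)) #
     add_bits n (tl_tree a) (tl_tree b) (of_bool_tree (2 \<le> bit (hd_tree a) + bit (hd_tree b) + bit c))"

lemma length_add_bits [simp]: "length (add_bits n a b c) = n"
  by (induction n arbitrary: a b c) auto

lemma size_add_bits: "x \<in> set (add_bits n a b c) \<Longrightarrow> size x \<le> 1"
  by (induction n arbitrary: a b c) (auto simp: of_bool_tree_def)

text \<open>Ripple-carry addition truncated to \<open>n\<close> digits; the hypothesis excludes an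
  overflow.\<close>

lemma bin_val_add_bits:
  "bin_val a + bin_val b + bit c < 2 ^ n \<Longrightarrow>
     bin_val (tree_of (add_bits n a b c)) = bin_val a + bin_val b + bit c"
proof (induction n arbitrary: a b c)
  case 0
  then show ?case by simp
next
  case (Suc n)
  let ?c = "of_bool_tree (2 \<le> bit (hd_tree a) + bit (hd_tree b) + bit c)"
  have 1: "bin_val a = bit (hd_tree a) + 2 * bin_val (tl_tree a)"
    "bin_val b = bit (hd_tree b) + 2 * bin_val (tl_tree b)" by (rule bin_val_hd_tl)+
  have 2: "bit (hd_tree a) + bit (hd_tree b) + bit c = bit (of_bool_tree (odd (bit (hd_tree a) + bit (hd_tree b) + bit c))) + 2 * bit ?c"
    by (auto simp: bit_def)
  have "bin_val (tree_of (add_bits n (tl_tree a) (tl_tree b) ?c)) = bin_val (tl_tree a) + bin_val (tl_tree b) + bit ?c"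
    by (rule Suc.IH) (use Suc.prems 1 2 in simp)
  then show ?case using 1 2 by simp
qed

text \<open>The list \<open>k\<close> only serves as a clock: its length is the number of digits that are computed.\<close>

definition bin_add :: "tree \<Rightarrow> tree \<Rightarrow> tree \<Rightarrow> tree" where
  "bin_add k a b = tree_of (add_bits (length (list_of k)) a b Leaf)"

text \<open>The carry of a full adder, spelled out with tests for \<open>Leaf\<close> so that the
  closure rules for \<open>ptime\<close> apply.\<close>

definition maj3 :: "tree \<Rightarrow> tree \<Rightarrow> tree \<Rightarrow> tree" where
  "maj3 a b c = (if a \<noteq> Leaf \<and> b \<noteq> Leaf \<or> a \<noteq> Leaf \<and> c \<noteq> Leaf \<or> b \<noteq> Leaf \<and> c \<noteq> Leaf
     then Node Leaf Leaf else Leaf)"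

text \<open>The sum digit of a full adder, in the same style.\<close>

definition xor3 :: "tree \<Rightarrow> tree \<Rightarrow> tree \<Rightarrow> tree" where
  "xor3 a b c = (if a \<noteq> Leaf
     then if b \<noteq> Leaf then if c \<noteq> Leaf then Node Leaf Leaf else Leaf
          else if c \<noteq> Leaf then Leaf else Node Leaf Leaf
     else if b \<noteq> Leaf then if c \<noteq> Leaf then Leaf else Node Leaf Leaf
          else if c \<noteq> Leaf then Node Leaf Leaf else Leaf)"

lemma ptime_maj3_xor3:
  assumes "ptime f" "ptime g" "ptime h"
  shows "ptime (\<lambda>t. maj3 (f t) (g t) (h t))" "ptime (\<lambda>t. xor3 (f t) (g t) (h t))"
  unfolding maj3_def xor3_def by (intro ptime_intros assms)+

text \<open>The accumulator holds the remaining digits of both summands, the carry, and the digits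
  computed so far with the most significant one first.\<close>

definition add_step :: "tree \<Rightarrow> tree" where
  "add_step acc =
     Node (Node (tl_tree (hd_tree (hd_tree acc))) (tl_tree (tl_tree (hd_tree acc))))
      (Node (maj3 (hd_tree (hd_tree (hd_tree acc))) (hd_tree (tl_tree (hd_tree acc))) (hd_tree (tl_tree acc)))
        (Node (xor3 (hd_tree (hd_tree (hd_tree acc))) (hd_tree (tl_tree (hd_tree acc))) (hd_tree (tl_tree acc)))
         (tl_tree (tl_tree acc))))"

lemma add_step: "add_step (Node (Node a b) (Node c out)) = Node (Node (tl_tree a) (tl_tree b))
    (Node (of_bool_tree (2 \<le> bit (hd_tree a) + bit (hd_tree b) + bit c))
      (Node (of_bool_tree (odd (bit (hd_tree a) + bit (hd_tree b) + bit c))) out))"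
  by (auto simp: add_step_def maj3_def xor3_def bit_def)

lemma ptime_bin_add:
  assumes "ptime f" "ptime g" "ptime g'"
  shows "ptime (\<lambda>t. bin_add (f t) (g t) (g' t))"
proof -
  let ?h = "\<lambda>(x :: tree) acc (p :: tree). add_step acc"
  have F: "tl_tree (tl_tree (fold (\<lambda>x acc. add_step acc) k (Node (Node a b) (Node c out)))) =
    tree_of (rev (add_bits (length k) a b c) @ list_of out)" for a b c out and k :: "tree list"
    by (induction k arbitrary: a b c out) (simp_all add: add_step)
  have sz: "size (fold (\<lambda>x acc. add_step acc) k (Node (Node a b) (Node c out))) \<le>
    size a + size b + size out + 2 * length k + 4" if "size c \<le> 1" for a b c out and k :: "tree list"
    using that
  proof (induction k arbitrary: a b c out)
    case (Cons x k)
    let ?c = "of_bool_tree (2 \<le> bit (hd_tree a) + bit (hd_tree b) + bit c)"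
    let ?o = "of_bool_tree (odd (bit (hd_tree a) + bit (hd_tree b) + bit c))"
    have "size (fold (\<lambda>x acc. add_step acc) (x # k) (Node (Node a b) (Node c out))) =
      size (fold (\<lambda>x acc. add_step acc) k (Node (Node (tl_tree a) (tl_tree b)) (Node ?c (Node ?o out))))"
      by (simp add: add_step)
    also have "\<dots> \<le> size (tl_tree a) + size (tl_tree b) + size (Node ?o out) + 2 * length k + 4"
      by (rule Cons.IH) (simp add: of_bool_tree_def)
    also have "\<dots> \<le> size a + size b + size out + 2 * length (x # k) + 4"
      using size_tl_tree[of a] size_tl_tree[of b] by (simp add: of_bool_tree_def)
    finally show ?case .
  qed simp
  let ?F = "\<lambda>t. fold (\<lambda>x acc. add_step acc) (list_of (hd_tree t))
     (Node (Node (hd_tree (tl_tree t)) (tl_tree (tl_tree t))) (Node Leaf Leaf))"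
  have "ptime ?F"
  proof (rule ptime_fold[where q = "[:4, 4:]" and h = ?h and g = "\<lambda>_. Leaf"])
    show "ptime (\<lambda>u. add_step (hd_tree (tl_tree u)))"
      unfolding add_step_def by (intro ptime_intros ptime_maj3_xor3)
    fix t xs ys assume "list_of (hd_tree t) = xs @ ys"
    then have "length xs \<le> length (list_of (hd_tree t))" by simp
    also have "\<dots> \<le> size t" using length_list_of[of "hd_tree t"] size_hd_tree[of t] by simp
    finally have "length xs \<le> size t" .
    moreover have "size (hd_tree (tl_tree t)) \<le> size t" "size (tl_tree (tl_tree t)) \<le> size t"
      by (meson size_tl_tree size_hd_tree order_trans)+
    ultimately show "size (fold (\<lambda>x acc. add_step acc) xs (Node (Node (hd_tree (tl_tree t)) (tl_tree (tl_tree t))) (Node Leaf Leaf)))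
      \<le> poly [:4, 4:] (size t)"
      by (intro order_trans[OF sz]) simp_all
  qed (intro ptime_intros)+
  \<comment> \<open>The digits were produced in reverse order; filtering with a true predicate
    serves as list reversal.\<close>
  then have "ptime (\<lambda>t. tree_filter (\<lambda>_. True) (tl_tree (tl_tree (?F t))))"
    by (intro ptime_filter ptime_intros)
  then have "ptime (\<lambda>t. bin_add (hd_tree t) (hd_tree (tl_tree t)) (tl_tree (tl_tree t)))"
    unfolding F by (simp add: tree_filter_def bin_add_def)
  then have "ptime (\<lambda>t. bin_add (hd_tree (Node (f t) (Node (g t) (g' t))))
    (hd_tree (tl_tree (Node (f t) (Node (g t) (g' t))))) (tl_tree (tl_tree (Node (f t) (Node (g t) (g' t))))))"
    by (rule ptime_comp) (intro ptime_intros assms)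
  then show ?thesis by simp
qed

text \<open>Schoolbook multiplication. The partial product \<open>r\<close> never has more digits than the shifted
  factor \<open>m\<close>, so that \<open>m\<close> can serve as the clock of the addition.\<close>

definition mul_step :: "tree \<Rightarrow> tree \<Rightarrow> tree" where
  "mul_step x acc = Node (Node Leaf (hd_tree acc))
     (if x \<noteq> Leaf then bin_add (Node Leaf (hd_tree acc)) (hd_tree acc) (tl_tree acc) else tl_tree acc)"

definition bin_mul :: "tree \<Rightarrow> tree \<Rightarrow> tree" where
  "bin_mul a b = tl_tree (fold mul_step (list_of a) (Node b Leaf))"

text \<open>\<open>m\<close> and \<open>r\<close> both have values below
  \<open>2 ^ length (list_of m)\<close>, so their sum fits into the one digit more that the shifted
  factor grants. Small digits turn the length of \<open>r\<close> into a size bound, whence the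
  factor 3: one part for \<open>m\<close>, two for \<open>r\<close>.\<close>

lemma mul_steps:
  assumes "length (list_of r) \<le> length (list_of m)" "\<forall>x \<in> elements r. size x \<le> 1"
  shows "bin_val (tl_tree (fold mul_step (list_of a) (Node m r))) = bin_val a * bin_val m + bin_val r \<and>
    size (fold mul_step (list_of a) (Node m r)) \<le> 3 * (size m + length (list_of a)) + 1"
  using assms
proof (induction a arbitrary: m r rule: list_of.induct)
  case 1
  have "size r \<le> 2 * length (list_of r)" if "\<forall>x \<in> elements r. size x \<le> 1" for r
    using that by (induction r rule: list_of.induct) auto
  from this[OF 1(2)] 1(1) show ?case using length_list_of[of m] by simp
next
  case (2 x a)
  define r' where "r' = (if x \<noteq> Leaf then bin_add (Node Leaf m) m r else r)"
  have r': "length (list_of r') \<le> length (list_of (Node Leaf m))" "\<forall>x \<in> elements r'. size x \<le> 1"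
    using 2(2,3) size_add_bits by (auto simp: r'_def bin_add_def)
  have st: "mul_step x (Node m r) = Node (Node Leaf m) r'"
    by (simp add: mul_step_def r'_def)
  have "bin_val r < 2 ^ length (list_of m)"
    using bin_val_less[of r] 2(2) by (meson less_le_trans power_increasing one_le_numeral)
  then have v: "bin_val r' = bit x * bin_val m + bin_val r"
    using bin_val_add_bits[of m r Leaf "Suc (length (list_of m))"] bin_val_less[of m]
    by (simp add: r'_def bin_add_def bit_def)
  show ?case using 2(1)[OF r'] v by (simp add: st algebra_simps bit_def)
qed

lemma bin_val_bin_mul: "bin_val (bin_mul a b) = bin_val a * bin_val b"
  using mul_steps[of Leaf b a] by (simp add: bin_mul_def)

lemma ptime_bin_mul:
  assumes "ptime f" "ptime g"
  shows "ptime (\<lambda>t. bin_mul (f t) (g t))"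
proof -
  have "ptime (\<lambda>t. fold (\<lambda>x acc. (\<lambda>x acc p. mul_step x acc) x acc Leaf) (list_of (hd_tree t)) (Node (tl_tree t) Leaf))"
  proof (rule ptime_fold[where q = "[:1, 6:]" and g = "\<lambda>_. Leaf"])
    show "ptime (\<lambda>u. mul_step (hd_tree u) (hd_tree (tl_tree u)))"
      unfolding mul_step_def by (intro ptime_intros ptime_bin_add)
    fix t xs ys assume "list_of (hd_tree t) = xs @ ys"
    then have "length xs \<le> length (list_of (hd_tree t))" by simp
    also have "\<dots> \<le> size t" using length_list_of[of "hd_tree t"] size_hd_tree[of t] by simp
    finally show "size (fold mul_step xs (Node (tl_tree t) Leaf)) \<le> poly [:1, 6:] (size t)"
      using mul_steps[of Leaf "tl_tree t" "tree_of xs"] size_tl_tree[of t] by simp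
  qed (intro ptime_intros)+
  then have "ptime (\<lambda>t. bin_mul (hd_tree t) (tl_tree t))"
    unfolding bin_mul_def by (intro ptime_intros) simp
  then show ?thesis using assms by (rule ptime_comp2)
qed

section \<open>Deciding consistency on encoded instances\<close>

lemma enc_nat_eq_iff [simp]: "enc_nat m = enc_nat n \<longleftrightarrow> m = n"
  using bin_val_enc_nat by metis

lemma enc_int_eq_iff [simp]: "enc_int i = enc_int j \<longleftrightarrow> i = j"
  by (auto simp: enc_int_def split: if_splits)

lemma enc_rat_eq_iff [simp]: "enc_rat p = enc_rat q \<longleftrightarrow> p = q"
  by (auto simp: enc_rat_def quotient_of_inject_eq[symmetric] split: prod.splits)

lemma enc_val_eq_iff:
  assumes "inj eD"
  shows "enc_val eD v = enc_val eD w \<longleftrightarrow> v = w"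
  using assms by (cases v; cases w) (auto dest: injD)

lemma enc_list_inj:
  assumes "inj_on e (set xs \<union> set ys)" "enc_list e xs = enc_list e ys"
  shows "xs = ys"
proof -
  have "map e xs = map e ys" using assms(2) by (metis list_of_enc_list)
  then show ?thesis using assms(1) by (simp add: inj_on_map_eq_map)
qed

text \<open>\<open>eR\<close> is injective only on the names of the schema, so the facts are
  restricted to these.\<close>

lemma enc_fact_inj_on:
  assumes "inj_on eR (dom S)" "inj eD" "\<forall>f \<in> A. fst f \<in> dom S"
  shows "inj_on (enc_fact eR eD) A"
proof (rule inj_onI)
  fix f g assume fg: "f \<in> A" "g \<in> A" "enc_fact eR eD f = enc_fact eR eD g"
  then have "fst f = fst g" using assms(1,3) by (auto simp: enc_fact_def dest: inj_onD)
  moreover have "snd f = snd g"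
  proof (rule enc_list_inj)
    show "inj_on (enc_val eD) (set (snd f) \<union> set (snd g))"
      by (rule inj_onI) (simp add: enc_val_eq_iff[OF assms(2)])
  qed (use fg in \<open>simp add: enc_fact_def\<close>)
  ultimately show "f = g" by (rule prod_eqI)
qed

text \<open>Cross-multiplication. Integers are encoded by sign and absolute value and denominators
  are positive, so apart from the signs only products of natural numbers are compared; for two
  negative numbers the comparison is reversed.\<close>

definition rat_less :: "tree \<Rightarrow> tree \<Rightarrow> bool" where
  "rat_less p q \<longleftrightarrow>
    (if hd_tree (hd_tree p) \<noteq> Leaf
     then if hd_tree (hd_tree q) \<noteq> Leaf
       then bin_less (bin_mul (tl_tree (hd_tree q)) (tl_tree (tl_tree p)))
              (bin_mul (tl_tree (hd_tree p)) (tl_tree (tl_tree q)))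
       else True
     else if hd_tree (hd_tree q) \<noteq> Leaf then False
       else bin_less (bin_mul (tl_tree (hd_tree p)) (tl_tree (tl_tree q)))
              (bin_mul (tl_tree (hd_tree q)) (tl_tree (tl_tree p))))"

lemma rat_less_enc_rat: "rat_less (enc_rat p) (enc_rat q) \<longleftrightarrow> p < q"
proof -
  obtain a b c d where ab: "quotient_of p = (a, b)" and cd: "quotient_of q = (c, d)"
    by (meson surj_pair)
  have bd: "0 < b" "0 < d" using quotient_of_denom_pos[OF ab] quotient_of_denom_pos[OF cd] .
  have nat: "nat i * nat j < nat k * nat l \<longleftrightarrow> i * j < k * l" if "0 \<le> i" "0 \<le> k" "0 \<le> j" "0 \<le> l" for i j k l :: int
    using that by (metis mult_nonneg_nonneg nat_less_eq_zless nat_mult_distrib)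
  have pq: "p < q \<longleftrightarrow> a * d < c * b" by (simp add: rat_less_code ab cd mult.commute)
  have sgn: "a < 0 \<Longrightarrow> a * d < 0" "c < 0 \<Longrightarrow> c * b < 0" "\<not> a < 0 \<Longrightarrow> 0 \<le> a * d" "\<not> c < 0 \<Longrightarrow> 0 \<le> c * b"
    using bd by (simp_all add: mult_neg_pos)
  have "a * d < c * b" if "a < 0" "\<not> c < 0"
    using sgn(1,4) that by linarith
  moreover have "\<not> a * d < c * b" if "\<not> a < 0" "c < 0"
    using sgn(2,3) that by linarith
  ultimately show ?thesis
    unfolding pq using bd by (cases "a < 0"; cases "c < 0")
      (simp_all add: rat_less_def enc_rat_def enc_int_def ab cd bin_less_def bin_val_bin_mul nat)
qed

lemma decidable_rat_less: "ptime f \<Longrightarrow> ptime g \<Longrightarrow> decidable (\<lambda>t. rat_less (f t) (g t))"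
  unfolding rat_less_def
  by (intro decidable_if decidable_bin_less ptime_bin_mul ptime_intros)

text \<open>The tests of the tags make the order predicates false on uninterpreted constants, as in
  \<open>holds_pred\<close>, so that both agree on all values.\<close>

fun pred_tree :: "pred \<Rightarrow> tree \<Rightarrow> tree \<Rightarrow> bool" where
  "pred_tree Eq u v \<longleftrightarrow> u = v"
| "pred_tree Neq u v \<longleftrightarrow> \<not> u = v"
| "pred_tree Lt u v \<longleftrightarrow> hd_tree u = Leaf \<and> hd_tree v = Leaf \<and> rat_less (tl_tree u) (tl_tree v)"
| "pred_tree Le u v \<longleftrightarrow> hd_tree u = Leaf \<and> hd_tree v = Leaf \<and> \<not> rat_less (tl_tree v) (tl_tree u)"
| "pred_tree Gt u v \<longleftrightarrow> hd_tree u = Leaf \<and> hd_tree v = Leaf \<and> rat_less (tl_tree v) (tl_tree u)"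
| "pred_tree Ge u v \<longleftrightarrow> hd_tree u = Leaf \<and> hd_tree v = Leaf \<and> \<not> rat_less (tl_tree u) (tl_tree v)"

lemma pred_tree_enc_val:
  assumes "inj eD"
  shows "pred_tree p (enc_val eD v) (enc_val eD w) \<longleftrightarrow> holds_pred p v w"
  by (cases p; cases v; cases w)
    (auto simp: rat_less_enc_rat inj_eq[OF assms])

lemma decidable_pred_tree: "ptime f \<Longrightarrow> ptime g \<Longrightarrow> decidable (\<lambda>t. pred_tree p (f t) (g t))"
  by (cases p) (simp; intro decidable_rat_less decidable_eq ptime_intros; assumption)+

fun trm_tree :: "('d \<Rightarrow> tree) \<Rightarrow> (nat \<Rightarrow> tree) \<Rightarrow> 'd trm \<Rightarrow> tree" where
  "trm_tree eD \<rho> (Var x) = \<rho> x"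
| "trm_tree eD \<rho> (Const c) = enc_val eD c"

fun holds_tree :: "('d \<Rightarrow> tree) \<Rightarrow> (nat \<Rightarrow> tree) \<Rightarrow> 'd form \<Rightarrow> bool" where
  "holds_tree eD \<rho> (Cmp p a b) \<longleftrightarrow> pred_tree p (trm_tree eD \<rho> a) (trm_tree eD \<rho> b)"
| "holds_tree eD \<rho> (Neg \<phi>) \<longleftrightarrow> \<not> holds_tree eD \<rho> \<phi>"
| "holds_tree eD \<rho> (Conj \<phi> \<psi>) \<longleftrightarrow> holds_tree eD \<rho> \<phi> \<and> holds_tree eD \<rho> \<psi>"
| "holds_tree eD \<rho> (Disj \<phi> \<psi>) \<longleftrightarrow> holds_tree eD \<rho> \<phi> \<or> holds_tree eD \<rho> \<psi>"

lemma trm_tree_enc_val: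
  "\<forall>x \<in> trm_vars a. \<rho>' x = enc_val eD (\<rho> x) \<Longrightarrow> trm_tree eD \<rho>' a = enc_val eD (trm_val \<rho> a)"
  by (cases a) auto

lemma holds_tree_enc_val:
  assumes "inj eD" "\<forall>x \<in> form_vars \<phi>. \<rho>' x = enc_val eD (\<rho> x)"
  shows "holds_tree eD \<rho>' \<phi> \<longleftrightarrow> holds \<rho> \<phi>"
  using assms(2)
proof (induction \<phi>)
  case (Cmp p a b)
  then show ?case
    by (simp add: trm_tree_enc_val[of _ \<rho>' eD \<rho>] pred_tree_enc_val[OF assms(1)])
qed auto

lemma decidable_holds_tree:
  assumes "\<And>x. ptime (\<lambda>t. \<rho> t x)"
  shows "decidable (\<lambda>t. holds_tree eD (\<rho> t) \<phi>)"
proof (induction \<phi>)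
  case (Cmp p a b)
  have "ptime (\<lambda>t. trm_tree eD (\<rho> t) a)" for a :: "'a trm"
    by (cases a) (auto intro: assms ptime_const)
  then show ?case by (simp add: decidable_pred_tree)
qed (simp_all add: decidable_not decidable_conj decidable_disj)

text \<open>The new values are taken from the active domain of the instance encoded by \<open>j\<close>.\<close>

fun ex_valuation ::
  "nat list \<Rightarrow> ((nat \<Rightarrow> tree) \<Rightarrow> tree \<Rightarrow> bool) \<Rightarrow> (nat \<Rightarrow> tree) \<Rightarrow> tree \<Rightarrow> bool" where
  "ex_valuation [] Q \<rho> j \<longleftrightarrow> Q \<rho> j"
| "ex_valuation (x # xs) Q \<rho> j \<longleftrightarrow>
     (\<exists>f \<in> elements j. \<exists>v \<in> elements (tl_tree f). ex_valuation xs Q (\<rho>(x := v)) j)"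

lemma ex_valuation_iff:
  "ex_valuation xs Q \<rho> j \<longleftrightarrow> (\<exists>\<rho>'. (\<forall>x. x \<notin> set xs \<longrightarrow> \<rho>' x = \<rho> x) \<and>
     (\<forall>x \<in> set xs. \<exists>f \<in> elements j. \<rho>' x \<in> elements (tl_tree f)) \<and> Q \<rho>' j)"
proof (induction xs arbitrary: \<rho>)
  case Nil
  have "(\<forall>x. \<rho>' x = \<rho> x) \<longleftrightarrow> \<rho>' = \<rho>" for \<rho>' by auto
  then show ?case by simp
next
  case (Cons x xs)
  show ?case (is "?L \<longleftrightarrow> ?R")
  proof
    assume ?L
    then obtain f v \<rho>' where *: "f \<in> elements j" "v \<in> elements (tl_tree f)"
      "\<forall>y. y \<notin> set xs \<longrightarrow> \<rho>' y = (\<rho>(x := v)) y"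
      "\<forall>y \<in> set xs. \<exists>f \<in> elements j. \<rho>' y \<in> elements (tl_tree f)" "Q \<rho>' j"
      by (auto simp: Cons.IH)
    \<comment> \<open>\<open>x\<close> may occur again in \<open>xs\<close>; its final value is then
      the one chosen later instead of \<open>v\<close>.\<close>
    then have "\<exists>f \<in> elements j. \<rho>' x \<in> elements (tl_tree f)" by (cases "x \<in> set xs") auto
    then show ?R using * by (intro exI[of _ \<rho>']) auto
  next
    assume ?R
    then obtain \<rho>' where *: "\<forall>y. y \<notin> set (x # xs) \<longrightarrow> \<rho>' y = \<rho> y"
      "\<forall>y \<in> set (x # xs). \<exists>f \<in> elements j. \<rho>' y \<in> elements (tl_tree f)" "Q \<rho>' j" by blast
    then obtain f where f: "f \<in> elements j" "\<rho>' x \<in> elements (tl_tree f)" by auto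
    have "ex_valuation xs Q (\<rho>(x := \<rho>' x)) j"
      unfolding Cons.IH using * by (intro exI[of _ \<rho>']) auto
    then show ?L using f by auto
  qed
qed

text \<open>Each variable costs two nested searches, with the values found packed in front of the
  input; this is why \<open>\<rho>\<close> and \<open>j\<close> are functions of the input. The
  nesting depth is determined by \<open>xs\<close>, hence by the fixed constraint.\<close>

lemma decidable_ex_valuation:
  assumes Q: "\<And>\<rho> j. (\<And>x. ptime (\<lambda>t. \<rho> t x)) \<Longrightarrow> ptime j \<Longrightarrow> decidable (\<lambda>t. Q (\<rho> t) (j t))"
    and "\<And>x. ptime (\<lambda>t. \<rho> t x)" "ptime j"
  shows "decidable (\<lambda>t. ex_valuation xs Q (\<rho> t) (j t))"
  using assms(2,3)
proof (induction xs arbitrary: \<rho> j)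
  case Nil
  then show ?case using Q by simp
next
  case (Cons x xs)
  have "decidable (\<lambda>u. ex_valuation xs Q ((\<rho> (tl_tree (tl_tree u)))(x := hd_tree u)) (j (tl_tree (tl_tree u))))"
  proof (rule Cons.IH)
    show "ptime (\<lambda>u. ((\<rho> (tl_tree (tl_tree u)))(x := hd_tree u)) y)" for y
      using ptime_comp[OF Cons.prems(1)[of y], of "\<lambda>u. tl_tree (tl_tree u)"]
      by (cases "y = x") (simp_all add: ptime_intros)
    show "ptime (\<lambda>u. j (tl_tree (tl_tree u)))"
      by (intro ptime_comp[OF Cons.prems(2)] ptime_intros)
  qed
  then have "decidable (\<lambda>u. \<exists>v \<in> elements (tl_tree (hd_tree u)). ex_valuation xs Q ((\<rho> (tl_tree u))(x := v)) (j (tl_tree u)))"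
    by (intro decidable_bex ptime_intros)
  then show ?case
    using decidable_bex[of "\<lambda>f t. \<exists>v \<in> elements (tl_tree f). ex_valuation xs Q ((\<rho> t)(x := v)) (j t)" j] Cons.prems(2)
    by simp
qed

lemma decidable_list_ball:
  "(\<And>a. a \<in> set xs \<Longrightarrow> decidable (P a)) \<Longrightarrow> decidable (\<lambda>t. \<forall>a \<in> set xs. P a t)"
  by (induction xs) (auto intro: decidable_const decidable_conj)

lemma ptime_enc_list: "(\<And>x. ptime (\<lambda>t. \<rho> t x)) \<Longrightarrow> ptime (\<lambda>t. enc_list (\<rho> t) xs)"
  by (induction xs) (auto intro: ptime_intros)

definition dc_vars :: "('r, 'd) dc \<Rightarrow> nat list" where
  "dc_vars \<delta> = concat (map snd (atoms \<delta>))"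

definition violated :: "('r \<Rightarrow> tree) \<Rightarrow> ('d \<Rightarrow> tree) \<Rightarrow> ('r, 'd) dc \<Rightarrow> tree \<Rightarrow> bool" where
  "violated eR eD \<delta> = ex_valuation (dc_vars \<delta>)
     (\<lambda>\<rho> j. (\<forall>a \<in> set (atoms \<delta>). Node (eR (fst a)) (enc_list \<rho> (snd a)) \<in> elements j) \<and>
       holds_tree eD \<rho> (cond \<delta>)) (\<lambda>_. Leaf)"

lemma decidable_violated: "ptime j \<Longrightarrow> decidable (\<lambda>t. violated eR eD \<delta> (j t))"
  unfolding violated_def
  by (rule decidable_ex_valuation)
    (intro decidable_conj decidable_list_ball decidable_mem decidable_holds_tree ptime_enc_list
      ptime_intros; assumption)+

lemma enc_fact_subst_atom:
  assumes "\<forall>x \<in> set (snd a). \<rho>' x = enc_val eD (\<rho> x)"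
  shows "Node (eR (fst a)) (enc_list \<rho>' (snd a)) = enc_fact eR eD (subst_atom \<rho> a)"
proof -
  have "enc_list \<rho>' ys = enc_list (enc_val eD) (map \<rho> ys)" if "\<forall>x \<in> set ys. \<rho>' x = enc_val eD (\<rho> x)" for ys
    using that by (induction ys) auto
  then show ?thesis using assms by (simp add: enc_fact_def subst_atom_def)
qed

text \<open>Every variable occurs in an atom, so all values of a violating substitution occur in
  facts of \<open>J\<close> and the search through the active domain misses none. Conversely, every
  value found there is an encoding and can be decoded.\<close>

lemma violated_iff:
  fixes J :: "('r, 'd) fact set"
  assumes inj: "inj_on eR (dom S)" "inj eD" and dc: "wf_dc S \<delta>"
    and J: "\<forall>f \<in> J. fst f \<in> dom S" and j: "elements j = enc_fact eR eD ` J"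
  shows "violated eR eD \<delta> j \<longleftrightarrow> \<not> satisfies J \<delta>"
proof -
  have vars: "set (dc_vars \<delta>) = (\<Union>a \<in> set (atoms \<delta>). set (snd a))"
    by (simp add: dc_vars_def)
  have cond: "form_vars (cond \<delta>) \<subseteq> set (dc_vars \<delta>)"
    using dc unfolding vars wf_dc_def by (auto simp: case_prod_beta)
  have dom: "fst a \<in> dom S" if "a \<in> set (atoms \<delta>)" for a
    using dc that unfolding wf_dc_def by (auto simp: case_prod_beta)
  have mem: "enc_fact eR eD (subst_atom \<rho> a) \<in> elements j \<longleftrightarrow> subst_atom \<rho> a \<in> J"
    if "a \<in> set (atoms \<delta>)" for \<rho> a
  proof -
    \<comment> \<open>The instantiated atom may lie outside \<open>J\<close>, so injectivity is
      established on \<open>J\<close> together with it.\<close>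
    have "inj_on (enc_fact eR eD) (insert (subst_atom \<rho> a) J)"
      by (rule enc_fact_inj_on[OF inj]) (use J dom[OF that] in \<open>auto simp: subst_atom_def\<close>)
    then show ?thesis unfolding j by (auto simp: inj_on_def)
  qed
  have body: "((\<forall>a \<in> set (atoms \<delta>). Node (eR (fst a)) (enc_list \<rho>' (snd a)) \<in> elements j) \<and>
       holds_tree eD \<rho>' (cond \<delta>)) \<longleftrightarrow>
     (\<forall>a \<in> set (atoms \<delta>). subst_atom \<rho> a \<in> J) \<and> holds \<rho> (cond \<delta>)"
    if eq: "\<forall>x \<in> set (dc_vars \<delta>). \<rho>' x = enc_val eD (\<rho> x)" for \<rho>' \<rho>
  proof -
    have "Node (eR (fst a)) (enc_list \<rho>' (snd a)) = enc_fact eR eD (subst_atom \<rho> a)"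
      if "a \<in> set (atoms \<delta>)" for a
      using eq that by (intro enc_fact_subst_atom) (auto simp: vars)
    moreover have "holds_tree eD \<rho>' (cond \<delta>) \<longleftrightarrow> holds \<rho> (cond \<delta>)"
      using eq cond by (intro holds_tree_enc_val[OF inj(2)]) auto
    ultimately show ?thesis using mem by simp
  qed
  show ?thesis
  proof
    assume "violated eR eD \<delta> j"
    then obtain \<rho>' where \<rho>': "\<forall>x \<in> set (dc_vars \<delta>). \<exists>f \<in> elements j. \<rho>' x \<in> elements (tl_tree f)"
      "\<forall>a \<in> set (atoms \<delta>). Node (eR (fst a)) (enc_list \<rho>' (snd a)) \<in> elements j"
      "holds_tree eD \<rho>' (cond \<delta>)"
      unfolding violated_def ex_valuation_iff by blast
    have "\<exists>v. \<rho>' x = enc_val eD v" if "x \<in> set (dc_vars \<delta>)" for x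
      using \<rho>'(1) that unfolding j by (auto simp: enc_fact_def)
    then obtain \<rho> where "\<forall>x \<in> set (dc_vars \<delta>). \<rho>' x = enc_val eD (\<rho> x)" by metis
    from body[OF this] \<rho>'(2,3) show "\<not> satisfies J \<delta>" unfolding satisfies_def by blast
  next
    assume "\<not> satisfies J \<delta>"
    then obtain \<rho> where \<rho>: "\<forall>a \<in> set (atoms \<delta>). subst_atom \<rho> a \<in> J" "holds \<rho> (cond \<delta>)"
      unfolding satisfies_def by blast
    define \<rho>' where "\<rho>' x = (if x \<in> set (dc_vars \<delta>) then enc_val eD (\<rho> x) else Leaf)" for x
    have "\<exists>f \<in> elements j. \<rho>' x \<in> elements (tl_tree f)" if x: "x \<in> set (dc_vars \<delta>)" for x
    proof -
      obtain a where a: "a \<in> set (atoms \<delta>)" "x \<in> set (snd a)" using x unfolding vars by blast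
      then have "enc_val eD (\<rho> x) \<in> elements (tl_tree (enc_fact eR eD (subst_atom \<rho> a)))"
        by (auto simp: enc_fact_def subst_atom_def)
      then show ?thesis using \<rho>(1) a(1) x unfolding j \<rho>'_def by auto
    qed
    moreover have "\<forall>x \<in> set (dc_vars \<delta>). \<rho>' x = enc_val eD (\<rho> x)" by (simp add: \<rho>'_def)
    from body[OF this] have "(\<forall>a \<in> set (atoms \<delta>). Node (eR (fst a)) (enc_list \<rho>' (snd a)) \<in> elements j) \<and>
       holds_tree eD \<rho>' (cond \<delta>)" using \<rho> by blast
    moreover have "\<forall>x. x \<notin> set (dc_vars \<delta>) \<longrightarrow> \<rho>' x = Leaf" by (simp add: \<rho>'_def)
    ultimately show "violated eR eD \<delta> j" unfolding violated_def ex_valuation_iff by blast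
  qed
qed

definition consistent_tree where
  "consistent_tree eR eD \<Delta> j \<longleftrightarrow> (\<forall>\<delta> \<in> set \<Delta>. \<not> violated eR eD \<delta> j)"

lemma decidable_consistent_tree:
  "ptime j \<Longrightarrow> decidable (\<lambda>t. consistent_tree eR eD \<Delta> (j t))"
  unfolding consistent_tree_def by (intro decidable_list_ball decidable_not decidable_violated)

lemma consistent_tree_iff:
  assumes "inj_on eR (dom S)" "inj eD" "\<forall>\<delta> \<in> set \<Delta>. wf_dc S \<delta>"
    and "\<forall>f \<in> J. fst f \<in> dom S" "elements j = enc_fact eR eD ` J"
  shows "consistent_tree eR eD \<Delta> j \<longleftrightarrow> consistent (set \<Delta>) J"
  using violated_iff[OF assms(1,2) _ assms(4,5)] assms(3)
  by (auto simp: consistent_tree_def consistent_def)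

section \<open>The program\<close>

text \<open>Execution of \<open>choice_loop\<close> at the level of trees: the head of the state
  lists the admissible choices, and the body receives the chosen element paired with the
  state.\<close>

inductive loop_run :: "(tree \<Rightarrow> tree) \<Rightarrow> tree \<Rightarrow> tree list \<Rightarrow> tree \<Rightarrow> bool" for g where
  loop_exit: "hd_tree u = Leaf \<Longrightarrow> loop_run g u [] u"
| loop_choice: "a \<in> elements (hd_tree u) \<Longrightarrow> loop_run g (g (Node a u)) as v \<Longrightarrow> loop_run g u (a # as) v"

definition choice_loop :: "com \<Rightarrow> com" where
  "choice_loop c =
     While (Hd (V 0)) (Seq (Choose 1 (Hd (V 0))) (Seq (Assign 0 (NodeE (V 1) (V 0))) c))"

text \<open>The bound \<open>b\<close> on the inputs of the body gives all rounds the same time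
  bound. Besides the body, a round takes 7 steps: two for \<open>While\<close>, three for
  sequencing, one for \<open>Choose\<close> and one for \<open>Assign\<close>.\<close>

lemma safe_choice_loop:
  assumes c: "computes c k (poly p) g"
    and Inv: "\<And>u a. Inv u \<Longrightarrow> a \<in> elements (hd_tree u) \<Longrightarrow>
      Inv (g (Node a u)) \<and> N (g (Node a u)) < (N u :: nat) \<and> size (Node a u) \<le> b"
    and "Inv (s 0)" "N (s 0) \<le> m"
  shows "safe (2 + m * (poly p b + 7)) (choice_loop c, s) (\<lambda>as s'. loop_run g (s 0) as (s' 0))"
  using assms(3,4)
proof (induction m arbitrary: s)
  case 0
  then have "hd_tree (s 0) = Leaf" using Inv[of "s 0"] by (cases "hd_tree (s 0)") auto
  then have "safe (Suc (Suc 0)) (choice_loop c, s) (\<lambda>as s'. loop_run g (s 0) as (s' 0))"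
    unfolding choice_loop_def by (intro safe_while) (auto intro: loop_exit)
  then show ?case by (simp add: numeral_2_eq_2)
next
  case (Suc m)
  let ?T = "2 + m * (poly p b + 7)"
  have "safe (Suc (Suc (Suc (Suc (Suc 0 + Suc (Suc 0 + poly p b)) + ?T)))) (choice_loop c, s)
    (\<lambda>as s'. loop_run g (s 0) as (s' 0))"
    unfolding choice_loop_def
  proof (rule safe_while, rule safe_seq, rule safe_seq, rule safe_choose)
    assume "exp_val s (Hd (V 0)) \<noteq> Leaf"
    then show "exp_val s (Hd (V 0)) \<noteq> Leaf" .
    fix a assume "a \<in> elements (exp_val s (Hd (V 0)))"
    then have a: "a \<in> elements (hd_tree (s 0))" by simp
    note I = Inv[OF Suc.prems(1) a]
    show "safe (Suc (Suc 0 + poly p b)) (Seq (Assign 0 (NodeE (V 1) (V 0))) c, s(1 := a))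
      (\<lambda>bs s'. safe ?T (While (Hd (V 0)) (Seq (Choose 1 (Hd (V 0))) (Seq (Assign 0 (NodeE (V 1) (V 0))) c)), s')
         (\<lambda>cs s''. loop_run g (s 0) (([a] @ bs) @ cs) (s'' 0)))"
    proof (rule safe_seq, rule safe_assign, rule computes_safe[OF c])
      show "poly p (size (((s(1 := a)) (0 := exp_val (s(1 := a)) (NodeE (V 1) (V 0)))) 0)) \<le> poly p b"
        using I by (intro poly_nat_mono) simp
      fix s' :: store assume "s' 0 = g (((s(1 := a)) (0 := exp_val (s(1 := a)) (NodeE (V 1) (V 0)))) 0)"
      then have s': "s' 0 = g (Node a (s 0))" by simp
      have "safe ?T (choice_loop c, s') (\<lambda>as s''. loop_run g (s' 0) as (s'' 0))"
        using I Suc.prems(2) by (intro Suc.IH) (auto simp: s')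
      then show "safe ?T (While (Hd (V 0)) (Seq (Choose 1 (Hd (V 0))) (Seq (Assign 0 (NodeE (V 1) (V 0))) c)), s')
         (\<lambda>cs s''. loop_run g (s 0) (([a] @ [] @ []) @ cs) (s'' 0))"
        unfolding choice_loop_def[symmetric]
        by (rule safe_mono) (use a s' in \<open>auto intro: loop_choice\<close>)
    qed
  next
    assume "exp_val s (Hd (V 0)) = Leaf"
    then show "loop_run g (s 0) [] (s 0)" by (auto intro: loop_exit)
  qed
  then show ?case by (rule safe_mono) auto
qed

text \<open>\<open>safe\<close> constrains all runs but does not provide one with prescribed
  choices. Such runs, required by the converse half of \<open>implements_on\<close>, are composed
  with this lemma.\<close>

lemma run_Seq:
  assumes "run com_step (c, s) as n (Skip, s')" "run com_step (d, s') bs m k"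
  shows "\<exists>n. run com_step (Seq c d, s) (as @ bs) n k"
proof -
  have "run com_step (Seq c d, s) as n (Seq Skip d, s')"
    using assms(1)
  proof (induction n arbitrary: c s as)
    case 0
    then show ?case by (cases rule: run_cases_label) (auto intro: run_refl)
  next
    case (Suc n)
    from Suc.prems show ?case
    proof (cases rule: run_cases_label)
      case (2 l k ys m)
      obtain c' t where k: "k = (c', t)" by (cases k)
      have "com_step (Seq c d, s) l (Seq c' d, t)" using 2(1) unfolding k by (rule com_step.intros)
      moreover have "run com_step (Seq c' d, t) ys n (Seq Skip d, s')"
        using Suc.IH[of c' t ys] 2 k by simp
      ultimately show ?thesis using run_step[of com_step] 2(3) by metis
    qed simp
  qed
  moreover have "com_step (Seq Skip d, s') None (d, s')" by (rule com_step.intros)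
  then have "run com_step (Seq Skip d, s') bs (Suc m) k" using assms(2) by (rule run_silent)
  ultimately show ?thesis using run_append by metis
qed

lemma computes_run:
  assumes "computes c k T f"
  shows "\<exists>n s'. run com_step (c, s) [] n (Skip, s') \<and> s' 0 = f (s 0)"
  using safe_terminates[OF computesD[OF assms, of s]] by auto

lemma run_Assign: "run com_step (Assign x e, s) [] 1 (Skip, s(x := exp_val s e))"
  using run_silent[of com_step, OF com_step.intros(1) run_refl] by simp

lemma run_choice_loop:
  assumes c: "computes c k T g" and "loop_run g (s 0) as v"
  shows "\<exists>n s'. run com_step (choice_loop c, s) as n (Skip, s') \<and> s' 0 = v"
  using assms(2)
proof (induction "s 0" as v arbitrary: s rule: loop_run.induct)
  case loop_exit
  then have 1: "com_step (If (Hd (V 0)) (Seq (Seq (Choose 1 (Hd (V 0))) (Seq (Assign 0 (NodeE (V 1) (V 0))) c)) (choice_loop c)) Skip, s) None (Skip, s)"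
    by (intro com_step.intros) simp
  have 2: "com_step (choice_loop c, s) None (If (Hd (V 0)) (Seq (Seq (Choose 1 (Hd (V 0))) (Seq (Assign 0 (NodeE (V 1) (V 0))) c)) (choice_loop c)) Skip, s)"
    unfolding choice_loop_def by (rule com_step.intros)
  show ?case using run_silent[of com_step, OF 2 run_silent[of com_step, OF 1 run_refl]] by blast
next
  case (loop_choice a as v)
  let ?body = "Seq (Choose 1 (Hd (V 0))) (Seq (Assign 0 (NodeE (V 1) (V 0))) c)"
  have 1: "com_step (choice_loop c, s) None (If (Hd (V 0)) (Seq ?body (choice_loop c)) Skip, s)"
    unfolding choice_loop_def by (rule com_step.intros)
  have 2: "com_step (If (Hd (V 0)) (Seq ?body (choice_loop c)) Skip, s) None (Seq ?body (choice_loop c), s)"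
    using loop_choice(1) by (intro com_step.intros) auto
  have "com_step (Choose 1 (Hd (V 0)), s) (Some a) (Skip, s(1 := a))"
    using loop_choice(1) by (intro com_step.intros) auto
  then have 3: "run com_step (Choose 1 (Hd (V 0)), s) [a] 1 (Skip, s(1 := a))"
    using run_choice[of com_step, OF _ run_refl] by simp
  let ?s = "(s(1 := a))(0 := exp_val (s(1 := a)) (NodeE (V 1) (V 0)))"
  obtain n s' where 4: "run com_step (c, ?s) [] n (Skip, s')" and s': "s' 0 = g (Node a (s 0))"
    using computes_run[OF c, of ?s] by auto
  obtain m where 5: "run com_step (?body, s) [a] m (Skip, s')"
    using run_Seq[OF run_Assign 4] run_Seq[OF 3] by fastforce
  obtain n' t where 6: "run com_step (choice_loop c, s') as n' (Skip, t)" "t 0 = v"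
    using loop_choice(3)[of s'] s' by auto
  obtain m' where "run com_step (Seq ?body (choice_loop c), s) (a # as) m' (Skip, t)"
    using run_Seq[OF 5 6(1)] by auto
  then show ?case using run_silent[of com_step, OF 1 run_silent[of com_step, OF 2]] 6(2) by blast
qed

definition add_tree where
  "add_tree eR eD \<Delta> x j = (if consistent_tree eR eD \<Delta> (Node x j) then Node x j else j)"

definition remove_tree :: "tree \<Rightarrow> tree \<Rightarrow> tree" where
  "remove_tree x k = tree_filter (\<lambda>a. \<not> a = x) k"

definition winnow_tree :: "tree \<Rightarrow> tree \<Rightarrow> tree" where
  "winnow_tree p k = tree_filter (\<lambda>x. \<not> (\<exists>y \<in> elements k. Node y x \<in> elements p)) k"

text \<open>An improvement \<open>(X, Y)\<close> of \<open>J\<close> may be assumed to have the form \<open>Y = {y}\<close> and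
  \<open>X = {x \<in> J. y \<succ> x}\<close>, so that only the choices of \<open>y\<close> have to be searched.\<close>

definition pareto_tree where
  "pareto_tree eR eD \<Delta> d j \<longleftrightarrow> \<not> (\<exists>y \<in> elements (hd_tree d). \<not> y \<in> elements j \<and>
     (\<exists>x \<in> elements j. Node y x \<in> elements (tl_tree d)) \<and>
     consistent_tree eR eD \<Delta> (Node y (tree_filter (\<lambda>x. \<not> Node y x \<in> elements (tl_tree d)) j)))"

lemma decidable_pareto_tree:
  assumes "ptime f" "ptime g"
  shows "decidable (\<lambda>t. pareto_tree eR eD \<Delta> (f t) (g t))"
proof -
  have "decidable (\<lambda>t. pareto_tree eR eD \<Delta> (hd_tree t) (tl_tree t))"
    unfolding pareto_tree_def
    by (intro ptime_intros decidable_bex decidable_mem decidable_consistent_tree ptime_filter)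
  then show ?thesis using assms by (rule decidable_comp2)
qed

lemma ptime_winnow_tree:
  assumes "ptime f" "ptime g"
  shows "ptime (\<lambda>t. winnow_tree (f t) (g t))"
proof -
  have "ptime (\<lambda>t. winnow_tree (hd_tree t) (tl_tree t))"
    unfolding winnow_tree_def by (intro ptime_intros decidable_bex decidable_mem ptime_filter)
  then show ?thesis using assms by (rule ptime_comp2)
qed

lemma ptime_remove_tree:
  assumes "ptime f" "ptime g"
  shows "ptime (\<lambda>t. remove_tree (f t) (g t))"
proof -
  have "ptime (\<lambda>t. remove_tree (hd_tree t) (tl_tree t))"
    unfolding remove_tree_def by (intro ptime_intros decidable_eq ptime_filter)
  then show ?thesis using assms by (rule ptime_comp2)
qed

lemma ptime_add_tree: "ptime f \<Longrightarrow> ptime g \<Longrightarrow> ptime (\<lambda>t. add_tree eR eD \<Delta> (f t) (g t))"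
  unfolding add_tree_def by (intro ptime_intros decidable_consistent_tree)

text \<open>With \<open>d\<close> denoting the input, \<open>Node k (Node j d)\<close> encodes the state \<open>Basic K J\<close>, and
  \<open>Node w (Node k (Node j d))\<close> with \<open>w\<close> encoding \<open>\<omega>\<^sub>\<succ>(K)\<close> encodes the state \<open>Winnow K J\<close>.
  The state \<open>Return J\<close> is represented in the latter way with \<open>w = Leaf\<close>.\<close>

definition basic_tree where
  "basic_tree eR eD \<Delta> u = Node (remove_tree (hd_tree u) (hd_tree (tl_tree u)))
     (Node (add_tree eR eD \<Delta> (hd_tree u) (hd_tree (tl_tree (tl_tree u)))) (tl_tree (tl_tree (tl_tree u))))"

text \<open>After a successful test the list of choices is empty, so the second loop ends at once
  and one sequential program serves both outcomes.\<close>

definition test_tree where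
  "test_tree eR eD \<Delta> u = (if pareto_tree eR eD \<Delta> (tl_tree (tl_tree u)) (hd_tree (tl_tree u))
     then Node Leaf u
     else Node (winnow_tree (tl_tree (tl_tree (tl_tree u))) (hd_tree (tl_tree (tl_tree u))))
       (Node (hd_tree (tl_tree (tl_tree u))) (Node Leaf (tl_tree (tl_tree u)))))"

text \<open>The candidates are recomputed from the remaining facts, because removing the chosen fact
  can free facts that it dominated.\<close>

definition winnow_step_tree where
  "winnow_step_tree eR eD \<Delta> u = Node
     (winnow_tree (tl_tree (tl_tree (tl_tree (tl_tree (tl_tree u)))))
       (remove_tree (hd_tree u) (hd_tree (tl_tree (tl_tree u)))))
     (basic_tree eR eD \<Delta> (Node (hd_tree u) (tl_tree (tl_tree u))))"

lemma ptime_basic_tree: "ptime f \<Longrightarrow> ptime (\<lambda>t. basic_tree eR eD \<Delta> (f t))"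
  unfolding basic_tree_def by (intro ptime_intros ptime_remove_tree ptime_add_tree)

lemma ptime_test_tree: "ptime (test_tree eR eD \<Delta>)"
  unfolding test_tree_def by (intro ptime_intros ptime_winnow_tree decidable_pareto_tree)

lemma ptime_winnow_step_tree: "ptime (winnow_step_tree eR eD \<Delta>)"
  unfolding winnow_step_tree_def
  by (intro ptime_intros ptime_winnow_tree ptime_remove_tree ptime_basic_tree)

lemma set_encodings_elements: "t \<in> set_encodings e A \<Longrightarrow> elements t = e ` A"
  by (auto simp: set_encodings_def)

text \<open>The reversal done by \<open>tree_filter\<close> is harmless, since every repetition-free
  enumeration encodes the set.\<close>

lemma tree_filter_set_encodings:
  assumes "t \<in> set_encodings e A" "\<And>x. x \<in> A \<Longrightarrow> P (e x) \<longleftrightarrow> Q x"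
  shows "tree_filter P t \<in> set_encodings e {x \<in> A. Q x}"
proof -
  obtain xs where xs: "t = enc_list e xs" "distinct xs" "set xs = A"
    using assms(1) by (auto simp: set_encodings_def)
  have "filter P (map e xs) = map e (filter Q xs)"
    using assms(2) xs(3) by (auto simp: filter_map o_def intro!: arg_cong[where f = "map e"] filter_cong)
  then have "tree_filter P t = enc_list e (rev (filter Q xs))"
    by (simp add: tree_filter_def xs(1) rev_map[symmetric] enc_list_map[of e])
  then show ?thesis using xs unfolding set_encodings_def by force
qed

text \<open>The size is a sum over the set and hence independent of the enumeration. Thus trees
  encoding subsets of \<open>I\<close> are bounded by the input.\<close>

lemma size_set_encodings_mono:
  assumes "s \<in> set_encodings e A" "t \<in> set_encodings e B" "A \<subseteq> B"
  shows "size s \<le> size t"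
proof -
  have size: "size t = (\<Sum>x\<in>A. Suc (size (e x))) \<and> finite A" if "t \<in> set_encodings e A" for t A
    using that by (auto simp: set_encodings_def size_enc_list sum_list_distinct_conv_sum_set)
  show ?thesis using size[OF assms(1)] size[OF assms(2)] assms(3) by (simp add: sum_mono2)
qed

lemma length_set_encodings: "t \<in> set_encodings e A \<Longrightarrow> length (list_of t) = card A"
  by (auto simp: set_encodings_def distinct_card)

section \<open>Correctness of the tree operations on encoded inputs\<close>

locale encoded_input =
  fixes S :: "'r schema" and eR :: "'r \<Rightarrow> tree" and eD :: "'d \<Rightarrow> tree"
    and \<Delta> :: "('r, 'd) dc list" and I :: "('r, 'd) fact set" and P :: "('r, 'd) prio" and d :: tree
  assumes inj: "inj_on eR (dom S)" "inj eD"
    and wf_dc: "\<forall>\<delta> \<in> set \<Delta>. wf_dc S \<delta>"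
    and db: "db_instance S I"
    and prio: "priority (set \<Delta>) I P"
    and input: "d \<in> input_encodings eR eD I P"
begin

abbreviation "enc \<equiv> enc_fact eR eD"
abbreviation "encs \<equiv> set_encodings enc"
abbreviation "F \<equiv> set \<Delta>"

lemma finite_I: "finite I" and dom_I: "f \<in> I \<Longrightarrow> fst f \<in> dom S"
  using db by (auto simp: db_instance_def wf_fact_def)

lemma enc_inj: "inj_on enc I"
  by (rule enc_fact_inj_on[OF inj]) (simp add: dom_I)

lemma enc_eq_iff: "x \<in> I \<Longrightarrow> y \<in> I \<Longrightarrow> enc x = enc y \<longleftrightarrow> x = y"
  using enc_inj by (auto dest: inj_onD)

lemma hd_d: "hd_tree d \<in> encs I"
  using input by (auto simp: input_encodings_def)

lemma prio_iff:
  assumes "x \<in> I" "y \<in> I"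
  shows "Node (enc x) (enc y) \<in> elements (tl_tree d) \<longleftrightarrow> (x, y) \<in> P"
proof -
  have "elements (tl_tree d) = (\<lambda>(x, y). Node (enc x) (enc y)) ` P"
  proof -
    obtain a b where "d = Node a b" "b \<in> set_encodings (\<lambda>(x, y). Node (enc x) (enc y)) P"
      using input by (auto simp: input_encodings_def)
    then show ?thesis using set_encodings_elements by fastforce
  qed
  moreover have "P \<subseteq> I \<times> I" using prio by (simp add: priority_def)
  ultimately show ?thesis using assms by (auto simp: enc_eq_iff)
qed

lemma consistent_tree_enc:
  assumes "J \<subseteq> I" "elements j = enc ` J"
  shows "consistent_tree eR eD \<Delta> j \<longleftrightarrow> consistent F J"
  by (rule consistent_tree_iff[OF inj wf_dc _ assms(2)]) (use assms(1) dom_I in blast)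

text \<open>That \<open>x\<close> lies outside \<open>J\<close> keeps the extended list free of
  repetitions.\<close>

lemma add_tree_enc:
  assumes "j \<in> encs J" "J \<subseteq> I" "x \<in> I - J"
  shows "add_tree eR eD \<Delta> (enc x) j \<in> encs (add_fact F J x)"
proof -
  have "consistent_tree eR eD \<Delta> (Node (enc x) j) \<longleftrightarrow> consistent F (insert x J)"
    by (rule consistent_tree_enc) (use assms in \<open>auto simp: set_encodings_elements\<close>)
  moreover have "Node (enc x) j \<in> encs (insert x J)"
  proof -
    obtain xs where "j = enc_list enc xs" "distinct xs" "set xs = J"
      using assms(1) by (auto simp: set_encodings_def)
    then show ?thesis using assms(3) unfolding set_encodings_def
      by (auto intro!: exI[of _ "x # xs"])
  qed
  ultimately show ?thesis using assms(1) by (simp add: add_tree_def add_fact_def)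
qed

lemma remove_tree_enc:
  assumes "k \<in> encs K" "K \<subseteq> I" "x \<in> I"
  shows "remove_tree (enc x) k \<in> encs (K - {x})"
proof -
  have "tree_filter (\<lambda>a. \<not> a = enc x) k \<in> encs {y \<in> K. y \<noteq> x}"
    by (rule tree_filter_set_encodings[OF assms(1)]) (use assms enc_eq_iff in blast)
  moreover have "{y \<in> K. y \<noteq> x} = K - {x}" by auto
  ultimately show ?thesis by (simp add: remove_tree_def)
qed

lemma winnow_tree_enc:
  assumes "k \<in> encs K" "K \<subseteq> I"
  shows "winnow_tree (tl_tree d) k \<in> encs (winnow P K)"
  unfolding winnow_tree_def winnow_def set_encodings_elements[OF assms(1)]
  by (rule tree_filter_set_encodings[OF assms(1)]) (use assms(2) prio_iff in blast)

lemma pareto_tree_enc: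
  assumes "j \<in> encs J" "J \<subseteq> I"
  shows "pareto_tree eR eD \<Delta> d j \<longleftrightarrow> pareto_optimal F I P J"
proof -
  have el: "elements j = enc ` J" "elements (hd_tree d) = enc ` I"
    using assms(1) hd_d by (auto simp: set_encodings_elements)
  have dom: "(\<exists>x \<in> enc ` J. Node (enc y) x \<in> elements (tl_tree d)) \<longleftrightarrow> (\<exists>x \<in> J. (y, x) \<in> P)"
    and mem: "enc y \<in> enc ` J \<longleftrightarrow> y \<in> J"
    and cons: "consistent_tree eR eD \<Delta> (Node (enc y) (tree_filter (\<lambda>x. \<not> Node (enc y) x \<in> elements (tl_tree d)) j))
      \<longleftrightarrow> consistent F (insert y {x \<in> J. (y, x) \<notin> P})" if "y \<in> I" for y
  proof -
    show "(\<exists>x \<in> enc ` J. Node (enc y) x \<in> elements (tl_tree d)) \<longleftrightarrow> (\<exists>x \<in> J. (y, x) \<in> P)"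
      using prio_iff[OF that] assms(2) by blast
    show "enc y \<in> enc ` J \<longleftrightarrow> y \<in> J"
      using enc_eq_iff[OF that] assms(2) by blast
    have "tree_filter (\<lambda>x. \<not> Node (enc y) x \<in> elements (tl_tree d)) j \<in> encs {x \<in> J. (y, x) \<notin> P}"
      by (rule tree_filter_set_encodings[OF assms(1)]) (use prio_iff[OF that] assms(2) in blast)
    note set_encodings_elements[OF this]
    then show "consistent_tree eR eD \<Delta> (Node (enc y) (tree_filter (\<lambda>x. \<not> Node (enc y) x \<in> elements (tl_tree d)) j))
      \<longleftrightarrow> consistent F (insert y {x \<in> J. (y, x) \<notin> P})"
      by (intro consistent_tree_enc) (use that assms(2) in \<open>auto simp del: elements_tree_filter\<close>)
  qed
  have "pareto_tree eR eD \<Delta> d j \<longleftrightarrow> \<not> (\<exists>y \<in> I - J. (\<exists>x \<in> J. (y, x) \<in> P) \<and>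
      consistent F (insert y {x \<in> J. (y, x) \<notin> P}))"
    unfolding pareto_tree_def el using dom mem cons by auto
  also have "\<dots> \<longleftrightarrow> pareto_optimal F I P J"
  proof -
    have "\<exists>X Y. X \<subseteq> J \<and> X \<noteq> {} \<and> Y \<subseteq> I - J \<and> Y \<noteq> {} \<and>
          consistent F ((J - X) \<union> Y) \<and> (\<forall>x \<in> X. \<forall>y \<in> Y. (y, x) \<in> P)"
      if y: "y \<in> I - J" "\<exists>x \<in> J. (y, x) \<in> P" "consistent F (insert y {x \<in> J. (y, x) \<notin> P})" for y
    proof (intro exI conjI)
      have "(J - {x \<in> J. (y, x) \<in> P}) \<union> {y} = insert y {x \<in> J. (y, x) \<notin> P}" by auto
      then show "consistent F ((J - {x \<in> J. (y, x) \<in> P}) \<union> {y})" using y(3) by simp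
    qed (use y in auto)
    moreover have "\<exists>y \<in> I - J. (\<exists>x \<in> J. (y, x) \<in> P) \<and> consistent F (insert y {x \<in> J. (y, x) \<notin> P})"
      if XY: "X \<subseteq> J" "X \<noteq> {}" "Y \<subseteq> I - J" "Y \<noteq> {}" "consistent F ((J - X) \<union> Y)"
        "\<forall>x \<in> X. \<forall>y \<in> Y. (y, x) \<in> P" for X Y
    proof -
      obtain y where y: "y \<in> Y" using XY(4) by blast
      \<comment> \<open>A fact of \<open>J\<close> that \<open>y\<close> does not dominate cannot
        belong to \<open>X\<close>, so this set is contained in
        \<open>(J - X) \<union> Y\<close>.\<close>
      have "consistent F (insert y {x \<in> J. (y, x) \<notin> P})"
        by (rule consistent_subset[OF XY(5)]) (use y XY in blast)
      then show ?thesis using y XY by blast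
    qed
    ultimately show ?thesis unfolding pareto_optimal_def using assms(2) by meson
  qed
  finally show ?thesis .
qed

text \<open>Disjointness of \<open>K\<close> and \<open>J\<close> ensures that a chosen fact is new
  to the list \<open>j\<close>.\<close>

definition basic_rel where
  "basic_rel K J u \<longleftrightarrow> (\<exists>k j. u = Node k (Node j d) \<and> k \<in> encs K \<and> j \<in> encs J \<and>
     K \<subseteq> I \<and> J \<subseteq> I \<and> K \<inter> J = {})"

definition winnow_rel where
  "winnow_rel K J u \<longleftrightarrow> basic_rel K J (tl_tree u) \<and>
     u = Node (winnow_tree (tl_tree d) (hd_tree (tl_tree u))) (tl_tree u)"

lemma basic_rel_step:
  assumes "basic_rel K J u" "x \<in> K"
  shows "basic_rel (K - {x}) (add_fact F J x) (basic_tree eR eD \<Delta> (Node (enc x) u))"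
proof -
  obtain k j where u: "u = Node k (Node j d)" "k \<in> encs K" "j \<in> encs J" "K \<subseteq> I" "J \<subseteq> I" "K \<inter> J = {}"
    using assms(1) by (auto simp: basic_rel_def)
  moreover have "add_fact F J x \<subseteq> I" "(K - {x}) \<inter> add_fact F J x = {}"
    using u assms(2) by (auto simp: add_fact_def)
  moreover have "remove_tree (enc x) k \<in> encs (K - {x})"
    using u assms(2) by (intro remove_tree_enc) auto
  moreover have "add_tree eR eD \<Delta> (enc x) j \<in> encs (add_fact F J x)"
    using u assms(2) by (intro add_tree_enc) auto
  ultimately show ?thesis by (auto simp: basic_rel_def basic_tree_def)
qed

lemma basic_rel_choices: "basic_rel K J u \<Longrightarrow> elements (hd_tree u) = enc ` K"
  by (auto simp: basic_rel_def set_encodings_elements)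

lemma winnow_rel_step:
  assumes "winnow_rel K J u" "x \<in> K"
  shows "winnow_rel (K - {x}) (add_fact F J x) (winnow_step_tree eR eD \<Delta> (Node (enc x) u))"
proof -
  obtain k j where u: "tl_tree u = Node k (Node j d)"
    using assms(1) by (auto simp: winnow_rel_def basic_rel_def)
  have "basic_rel (K - {x}) (add_fact F J x) (basic_tree eR eD \<Delta> (Node (enc x) (tl_tree u)))"
    using assms by (intro basic_rel_step) (auto simp: winnow_rel_def)
  then show ?thesis using u by (simp add: winnow_rel_def winnow_step_tree_def basic_tree_def)
qed

lemma winnow_rel_choices: "winnow_rel K J u \<Longrightarrow> elements (hd_tree u) = enc ` winnow P K"
proof -
  assume u: "winnow_rel K J u"
  then have "winnow_tree (tl_tree d) (hd_tree (tl_tree u)) \<in> encs (winnow P K)"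
    by (intro winnow_tree_enc) (auto simp: winnow_rel_def basic_rel_def)
  with u show ?thesis unfolding winnow_rel_def by (metis hd_tree.simps(2) set_encodings_elements)
qed

lemma elements_eq_empty_iff: "elements t = {} \<longleftrightarrow> t = Leaf"
  by (cases t) auto

lemma test_tree_rel:
  assumes "basic_rel {} J u"
  shows "if pareto_optimal F I P J then hd_tree (test_tree eR eD \<Delta> u) = Leaf \<and>
      hd_tree (tl_tree (tl_tree (test_tree eR eD \<Delta> u))) \<in> encs J
    else winnow_rel I {} (test_tree eR eD \<Delta> u)"
proof -
  obtain k j where u: "u = Node k (Node j d)" "j \<in> encs J" "J \<subseteq> I"
    using assms by (auto simp: basic_rel_def)
  have "Leaf \<in> encs {}" by (force simp: set_encodings_def)
  then show ?thesis using u hd_d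
    by (auto simp: test_tree_def pareto_tree_enc winnow_rel_def basic_rel_def)
qed

section \<open>Simulation between the tree loops and the runs of the algorithm\<close>

lemma loop_run_basic:
  assumes "loop_run (basic_tree eR eD \<Delta>) u as v" "basic_rel K J u"
  shows "\<exists>xs n J'. run (alg_step F I P) (Basic K J) xs n (Test J') \<and> as = map enc xs \<and> basic_rel {} J' v"
  using assms
proof (induction arbitrary: K J rule: loop_run.induct)
  case (loop_exit u)
  then have "K = {}" using basic_rel_choices[of K J u] by auto
  moreover have "run (alg_step F I P) (Basic {} J) [] 1 (Test J)"
    using basic_done[of F I P J] by (auto intro: run.intros)
  ultimately show ?case using loop_exit by (intro exI[of _ "[]"]) auto
next
  case (loop_choice a u as v)
  then obtain x where x: "x \<in> K" "a = enc x" using basic_rel_choices[of K J u] by auto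
  obtain xs n J' where "run (alg_step F I P) (Basic (K - {x}) (add_fact F J x)) xs n (Test J')"
    "as = map enc xs" "basic_rel {} J' v"
    using loop_choice.IH[of "K - {x}" "add_fact F J x"] basic_rel_step[OF loop_choice.prems x(1)] x(2) by auto
  moreover from this(1) have "run (alg_step F I P) (Basic K J) (x # xs) (Suc n) (Test J')"
    by (rule run_choice[of "alg_step F I P", OF basic_pick[OF x(1)]])
  ultimately show ?case using x(2)
    by (intro exI[of _ "x # xs"] exI[of _ "Suc n"] exI[of _ J']) simp
qed

lemma loop_run_winnow:
  assumes "loop_run (winnow_step_tree eR eD \<Delta>) u as v" "winnow_rel K J u"
  shows "\<exists>xs n J'. run (alg_step F I P) (Winnow K J) xs n (Return J') \<and> as = map enc xs \<and>
    hd_tree (tl_tree (tl_tree v)) \<in> encs J'"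
  using assms
proof (induction arbitrary: K J rule: loop_run.induct)
  case (loop_exit u)
  then have "winnow P K = {}" using winnow_rel_choices[of K J u] by auto
  then have "run (alg_step F I P) (Winnow K J) [] 1 (Return J)"
    using winnow_done[of P K F I J] by (auto intro: run.intros)
  then show ?case using loop_exit
    by (intro exI[of _ "[]"] exI[of _ 1] exI[of _ J]) (auto simp: winnow_rel_def basic_rel_def)
next
  case (loop_choice a u as v)
  then obtain x where x: "x \<in> winnow P K" "a = enc x" using winnow_rel_choices[of K J u] by auto
  then have "x \<in> K" by (simp add: winnow_def)
  obtain xs n J' where "run (alg_step F I P) (Winnow (K - {x}) (add_fact F J x)) xs n (Return J')"
    "as = map enc xs" "hd_tree (tl_tree (tl_tree v)) \<in> encs J'"
    using loop_choice.IH[of "K - {x}" "add_fact F J x"] winnow_rel_step[OF loop_choice.prems \<open>x \<in> K\<close>] x(2)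
    by auto
  moreover from this(1) have "run (alg_step F I P) (Winnow K J) (x # xs) (Suc n) (Return J')"
    by (rule run_choice[of "alg_step F I P", OF winnow_pick[OF x(1)]])
  ultimately show ?case using x(2)
    by (intro exI[of _ "x # xs"] exI[of _ "Suc n"] exI[of _ J']) simp
qed

lemma run_Return:
  assumes "run (alg_step F I P) (Return J) xs n s"
  shows "xs = [] \<and> s = Return J"
  using assms by (cases rule: run_cases_label) (auto elim: Return_stepE)

lemma run_winnow_loop:
  assumes "run (alg_step F I P) (Winnow K J) xs n (Return J')" "winnow_rel K J u"
  shows "\<exists>v. loop_run (winnow_step_tree eR eD \<Delta>) u (map enc xs) v \<and>
    hd_tree (tl_tree (tl_tree v)) \<in> encs J'"
  using assms
proof (induction n arbitrary: K J xs u)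
  case 0
  then show ?case by (cases rule: run_cases_label) auto
next
  case (Suc n)
  from Suc.prems(1) show ?case
  proof (cases rule: run_cases_label)
    case (2 l s' ys m)
    from 2(1) consider x where "s' = Winnow (K - {x}) (add_fact F J x)" "l = Some x" "x \<in> winnow P K"
      | "s' = Return J" "l = None" "winnow P K = {}"
      by (auto elim: Winnow_stepE)
    then show ?thesis
    proof cases
      case (1 x)
      then have "x \<in> K" by (simp add: winnow_def)
      obtain v where "loop_run (winnow_step_tree eR eD \<Delta>) (winnow_step_tree eR eD \<Delta> (Node (enc x) u)) (map enc ys) v"
        "hd_tree (tl_tree (tl_tree v)) \<in> encs J'"
        using Suc.IH[OF _ winnow_rel_step[OF Suc.prems(2) \<open>x \<in> K\<close>], of ys] 1 2 by auto
      moreover have "enc x \<in> elements (hd_tree u)" using winnow_rel_choices[OF Suc.prems(2)] 1 by auto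
      ultimately show ?thesis using 1 2 by (auto intro: loop_run.loop_choice)
    next
      case alg: 2
      have "run (alg_step F I P) (Return J) ys m (Return J')" using 2(2) alg by simp
      from run_Return[OF this] have "ys = []" "J' = J" by simp_all
      moreover have "hd_tree u = Leaf"
        using winnow_rel_choices[OF Suc.prems(2)] alg elements_eq_empty_iff by auto
      moreover have "hd_tree (tl_tree (tl_tree u)) \<in> encs J"
        using Suc.prems(2) by (auto simp: winnow_rel_def basic_rel_def)
      ultimately show ?thesis using 2 alg by (auto intro: loop_run.loop_exit)
    qed
  qed simp
qed

text \<open>The choices are split at the test, which makes none itself: \<open>as\<close> belongs to
  the basic phase and \<open>bs\<close> to the winnow phase, so that \<open>bs\<close> is empty if
  the test succeeds.\<close>

lemma run_basic_loop:
  assumes "run (alg_step F I P) (Basic K J) xs n (Return J')" "basic_rel K J u"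
  shows "\<exists>as bs v w. map enc xs = as @ bs \<and> loop_run (basic_tree eR eD \<Delta>) u as v \<and>
    loop_run (winnow_step_tree eR eD \<Delta>) (test_tree eR eD \<Delta> v) bs w \<and>
    hd_tree (tl_tree (tl_tree w)) \<in> encs J'"
  using assms
proof (induction n arbitrary: K J xs u)
  case 0
  then show ?case by (cases rule: run_cases_label) auto
next
  case (Suc n)
  from Suc.prems(1) show ?case
  proof (cases rule: run_cases_label)
    case (2 l s' ys m)
    from 2(1) consider x where "s' = Basic (K - {x}) (add_fact F J x)" "l = Some x" "x \<in> K"
      | "s' = Test J" "l = None" "K = {}"
      by (auto elim: Basic_stepE)
    then show ?thesis
    proof cases
      case (1 x)
      obtain as bs v w where "map enc ys = as @ bs"
        "loop_run (basic_tree eR eD \<Delta>) (basic_tree eR eD \<Delta> (Node (enc x) u)) as v"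
        "loop_run (winnow_step_tree eR eD \<Delta>) (test_tree eR eD \<Delta> v) bs w"
        "hd_tree (tl_tree (tl_tree w)) \<in> encs J'"
        using Suc.IH[OF _ basic_rel_step[OF Suc.prems(2) 1(3)], of ys] 1 2 by auto
      moreover have "enc x \<in> elements (hd_tree u)" using basic_rel_choices[OF Suc.prems(2)] 1 by auto
      ultimately show ?thesis using 1 2
        by (intro exI[of _ "enc x # as"] exI[of _ bs] exI[of _ v] exI[of _ w])
          (auto intro: loop_run.loop_choice)
    next
      case alg: 2
      have u: "basic_rel {} J u" using Suc.prems(2) alg by simp
      have "hd_tree u = Leaf" using basic_rel_choices[OF u] elements_eq_empty_iff by auto
      then have v: "loop_run (basic_tree eR eD \<Delta>) u [] u" by (rule loop_run.loop_exit)
      have "run (alg_step F I P) (Test J) ys m (Return J')" using 2 alg by simp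
      then have "\<exists>w. loop_run (winnow_step_tree eR eD \<Delta>) (test_tree eR eD \<Delta> u) (map enc ys) w \<and>
        hd_tree (tl_tree (tl_tree w)) \<in> encs J'"
      proof (cases rule: run_cases_label)
        case test: (2 l' s'' zs m')
        from test(1) consider "s'' = Return J" "l' = None" "pareto_optimal F I P J"
          | "s'' = Winnow I {}" "l' = None" "\<not> pareto_optimal F I P J"
          by (auto elim: Test_stepE)
        then show ?thesis
        proof cases
          case 1
          have "run (alg_step F I P) (Return J) zs m' (Return J')" using 1 test(2) by simp
          from run_Return[OF this] have "zs = []" "J' = J" by simp_all
          then show ?thesis using test_tree_rel[OF u] 1 test(3) by (auto intro: loop_run.loop_exit)
        next
          case t: 2
          then show ?thesis using run_winnow_loop[of I "{}" zs m' J'] test_tree_rel[OF u] test(2,3) by auto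
        qed
      qed simp
      with v show ?thesis using 2 alg by fastforce
    qed
  qed simp
qed

end

section \<open>The assembled program and its time bound\<close>

lemma size_elements: "a \<in> elements t \<Longrightarrow> size a \<le> size t"
  by (induction t rule: elements.induct) auto

lemma size_winnow_tree: "size (winnow_tree p k) \<le> size k"
  unfolding winnow_tree_def by (rule size_tree_filter)

definition init_tree :: "tree \<Rightarrow> tree" where
  "init_tree t = Node (hd_tree t) (Node Leaf t)"

lemma ptime_init_tree: "ptime init_tree"
  unfolding init_tree_def by (intro ptime_intros)

definition repair_program :: "com \<Rightarrow> com \<Rightarrow> com \<Rightarrow> com \<Rightarrow> com" where
  "repair_program c0 c1 c2 c3 =
     Seq c0 (Seq (choice_loop c1) (Seq c2 (Seq (choice_loop c3) (Assign 0 (Hd (Tl (Tl (V 0))))))))"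

context encoded_input
begin

lemma size_hd_d: "size (hd_tree d) \<le> size d"
  by (rule size_hd_tree)

lemma basic_rel_init: "basic_rel I {} (init_tree d)"
proof -
  have "Leaf \<in> encs {}" by (force simp: set_encodings_def)
  then show ?thesis using hd_d by (auto simp: basic_rel_def init_tree_def)
qed

lemma size_encs: "k \<in> encs K \<Longrightarrow> K \<subseteq> I \<Longrightarrow> size k \<le> size d"
  using size_set_encodings_mono[OF _ hd_d] size_hd_d by (meson order_trans)

lemma basic_rel_size:
  assumes "basic_rel K J u"
  shows "size u \<le> 3 * size d + 2"
proof -
  obtain k j where u: "u = Node k (Node j d)" "k \<in> encs K" "j \<in> encs J" "K \<subseteq> I" "J \<subseteq> I"
    using assms unfolding basic_rel_def by blast
  then show ?thesis using size_encs[OF u(2,4)] size_encs[OF u(3,5)] by simp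
qed

lemma winnow_rel_size:
  assumes u: "winnow_rel K J u"
  shows "size u \<le> 4 * size d + 3"
proof -
  obtain k j where k: "tl_tree u = Node k (Node j d)" "k \<in> encs K" "K \<subseteq> I"
    using u by (auto simp: winnow_rel_def basic_rel_def)
  have "u = Node (winnow_tree (tl_tree d) k) (tl_tree u)"
    using u k(1) unfolding winnow_rel_def by simp
  from arg_cong[OF this, of size]
  have "size u = size (winnow_tree (tl_tree d) k) + size (tl_tree u) + 1" by simp
  moreover have "size (tl_tree u) \<le> 3 * size d + 2"
    using basic_rel_size u unfolding winnow_rel_def by blast
  moreover have "size (winnow_tree (tl_tree d) k) \<le> size d"
    using size_winnow_tree size_encs[OF k(2,3)] by (rule order_trans)
  ultimately show ?thesis by linarith
qed

lemma basic_rel_length: "basic_rel K J u \<Longrightarrow> length (list_of (hd_tree u)) = card K \<and> finite K"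
  using finite_I by (auto simp: basic_rel_def length_set_encodings intro: finite_subset)

lemma card_I: "card I \<le> size d"
  using length_set_encodings[OF hd_d] length_list_of[of "hd_tree d"] size_hd_d by simp

text \<open>A round works on a choice of size at most \<open>size d\<close> paired with a state of
  size at most \<open>3 * size d + 2\<close>. The weaker bound \<open>5 * size d + 4\<close> is that
  of the winnow loop, whose states carry one more list.\<close>

lemma safe_basic_loop:
  assumes c: "computes c k (poly p) (basic_tree eR eD \<Delta>)" and u: "basic_rel I {} (s 0)"
  shows "safe (2 + size d * (poly p (5 * size d + 4) + 7)) (choice_loop c, s)
    (\<lambda>as s'. \<exists>xs n J'. run (alg_step F I P) (Basic I {}) xs n (Test J') \<and> as = map enc xs \<and>
       basic_rel {} J' (s' 0))"
proof -
  have "safe (2 + size d * (poly p (5 * size d + 4) + 7)) (choice_loop c, s)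
    (\<lambda>as s'. loop_run (basic_tree eR eD \<Delta>) (s 0) as (s' 0))"
  proof (rule safe_choice_loop[OF c, where Inv = "\<lambda>u. \<exists>K J. basic_rel K J u"
      and N = "\<lambda>u. length (list_of (hd_tree u))"])
    fix u a assume ex: "\<exists>K J. basic_rel K J u" and a: "a \<in> elements (hd_tree u)"
    then obtain K J x where K: "basic_rel K J u" "x \<in> K" "a = enc x"
      using basic_rel_choices by blast
    note st = basic_rel_step[OF K(1,2)]
    have "card (K - {x}) < card K"
      using basic_rel_length[OF K(1)] K(2) by (intro card_Diff1_less) auto
    moreover have "size a \<le> size (hd_tree u)" by (rule size_elements[OF a])
    moreover have "size (hd_tree u) \<le> size d" using K(1) size_encs by (auto simp: basic_rel_def)
    ultimately show "(\<exists>K J. basic_rel K J (basic_tree eR eD \<Delta> (Node a u))) \<and>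
      length (list_of (hd_tree (basic_tree eR eD \<Delta> (Node a u)))) < length (list_of (hd_tree u)) \<and>
      size (Node a u) \<le> 5 * size d + 4"
      using st basic_rel_length[OF st] basic_rel_length[OF K(1)] basic_rel_size[OF K(1)] K(3) by auto
  next
    show "length (list_of (hd_tree (s 0))) \<le> size d"
      using basic_rel_length[OF u] card_I by simp
  qed (use u in blast)
  then show ?thesis by (rule safe_mono) (use loop_run_basic[OF _ u] in auto)
qed

lemma safe_winnow_loop:
  assumes c: "computes c k (poly p) (winnow_step_tree eR eD \<Delta>)"
    and u: "basic_rel {} J u" "s 0 = test_tree eR eD \<Delta> u"
  shows "safe (2 + size d * (poly p (5 * size d + 4) + 7)) (choice_loop c, s)
    (\<lambda>as s'. \<exists>xs n J'. run (alg_step F I P) (Test J) xs n (Return J') \<and> as = map enc xs \<and>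
       hd_tree (tl_tree (tl_tree (s' 0))) \<in> encs J')"
proof -
  \<comment> \<open>The second disjunct covers the state after a successful test, of which only the
    empty list of choices matters for the loop.\<close>
  let ?Inv = "\<lambda>u. (\<exists>K J. winnow_rel K J u) \<or> hd_tree u = Leaf"
  have test: "if pareto_optimal F I P J then hd_tree (s 0) = Leaf \<and>
      hd_tree (tl_tree (tl_tree (s 0))) \<in> encs J else winnow_rel I {} (s 0)"
    using test_tree_rel[OF u(1)] u(2) by simp
  have "safe (2 + size d * (poly p (5 * size d + 4) + 7)) (choice_loop c, s)
    (\<lambda>as s'. loop_run (winnow_step_tree eR eD \<Delta>) (s 0) as (s' 0))"
  \<comment> \<open>The measure counts \<open>K\<close> and not the candidates, since
    \<open>winnow P K\<close> may grow when a fact is removed.\<close>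
  proof (rule safe_choice_loop[OF c, where Inv = ?Inv and N = "\<lambda>u. if hd_tree u = Leaf then 0 else length (list_of (hd_tree (tl_tree u)))"])
    fix u a assume ex: "?Inv u" and a: "a \<in> elements (hd_tree u)"
    then have ne: "hd_tree u \<noteq> Leaf" by auto
    then obtain K J x where K: "winnow_rel K J u" "x \<in> winnow P K" "a = enc x"
      using ex a winnow_rel_choices by blast
    then have xK: "x \<in> K" by (simp add: winnow_def)
    note st = winnow_rel_step[OF K(1) xK]
    have len: "length (list_of (hd_tree (tl_tree u))) = card K" "finite K"
      using basic_rel_length K(1) by (auto simp: winnow_rel_def)
    have len': "length (list_of (hd_tree (tl_tree (winnow_step_tree eR eD \<Delta> (Node a u))))) = card (K - {x})"
      using basic_rel_length[of "K - {x}"] st K(3) by (auto simp: winnow_rel_def)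
    have less: "card (K - {x}) < card K"
      using len(2) xK by (rule card_Diff1_less)
    have "size a \<le> size (hd_tree u)" by (rule size_elements[OF a])
    moreover have "size (hd_tree u) \<le> size d"
    proof -
      have "hd_tree u = winnow_tree (tl_tree d) (hd_tree (tl_tree u))"
        using K(1) unfolding winnow_rel_def by (metis hd_tree.simps(2))
      moreover have "size (hd_tree (tl_tree u)) \<le> size d"
        using K(1) size_encs by (auto simp: winnow_rel_def basic_rel_def)
      ultimately show ?thesis using size_winnow_tree by (metis order_trans)
    qed
    ultimately have sz: "size (Node a u) \<le> 5 * size d + 4"
      using winnow_rel_size[OF K(1)] by simp
    show "?Inv (winnow_step_tree eR eD \<Delta> (Node a u)) \<and>
      (if hd_tree (winnow_step_tree eR eD \<Delta> (Node a u)) = Leaf then 0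
       else length (list_of (hd_tree (tl_tree (winnow_step_tree eR eD \<Delta> (Node a u)))))) <
      (if hd_tree u = Leaf then 0 else length (list_of (hd_tree (tl_tree u)))) \<and>
      size (Node a u) \<le> 5 * size d + 4"
      using st sz ne less len len' K(3) by auto
  next
    show "?Inv (s 0)" using test by (auto split: if_splits)
    have "length (list_of (hd_tree (tl_tree (s 0)))) = card I" if "winnow_rel I {} (s 0)"
      using basic_rel_length that by (auto simp: winnow_rel_def)
    then show "(if hd_tree (s 0) = Leaf then 0 else length (list_of (hd_tree (tl_tree (s 0))))) \<le> size d"
      using test card_I by (auto split: if_splits)
  qed
  then show ?thesis
  proof (rule safe_mono)
    fix as and s' :: store assume l: "loop_run (winnow_step_tree eR eD \<Delta>) (s 0) as (s' 0)"
    show "\<exists>xs n J'. run (alg_step F I P) (Test J) xs n (Return J') \<and> as = map enc xs \<and>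
       hd_tree (tl_tree (tl_tree (s' 0))) \<in> encs J'"
    proof (cases "pareto_optimal F I P J")
      case True
      then have "run (alg_step F I P) (Test J) [] 1 (Return J)"
        using test_success[of F I P J] by (auto intro: run.intros)
      moreover have "as = [] \<and> s' 0 = s 0"
        using l test True by (auto elim: loop_run.cases)
      ultimately show ?thesis using test True
        by (intro exI[of _ "[]"] exI[of _ 1] exI[of _ J]) auto
    next
      case False
      then obtain xs n J' where *: "run (alg_step F I P) (Winnow I {}) xs n (Return J')"
        "as = map enc xs" "hd_tree (tl_tree (tl_tree (s' 0))) \<in> encs J'"
        using loop_run_winnow[OF l, of I "{}"] test by auto
      from run_silent[of "alg_step F I P", OF test_failure[OF False] *(1)] *(2,3)
      show ?thesis by blast
    qed
  qed simp
qed

lemma safe_repair_program: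
  assumes c0: "computes c0 k0 (poly p0) init_tree"
    and c1: "computes c1 k1 (poly p1) (basic_tree eR eD \<Delta>)"
    and c2: "computes c2 k2 (poly p2) (test_tree eR eD \<Delta>)"
    and c3: "computes c3 k3 (poly p3) (winnow_step_tree eR eD \<Delta>)"
    and s: "s 0 = d"
  shows "safe (Suc (poly p0 (size d) + Suc ((2 + size d * (poly p1 (5 * size d + 4) + 7)) +
      Suc (poly p2 (3 * size d + 2) + Suc ((2 + size d * (poly p3 (5 * size d + 4) + 7)) + Suc 0)))))
    (repair_program c0 c1 c2 c3, s)
    (\<lambda>as s'. \<exists>xs n J. run (alg_step F I P) (Basic I {}) xs n (Return J) \<and> as = map enc xs \<and> s' 0 \<in> encs J)"
  unfolding repair_program_def
proof (rule safe_seq, rule computes_safe[OF c0])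
  fix s1 :: store assume s1: "s1 0 = init_tree (s 0)"
  show "safe (Suc ((2 + size d * (poly p1 (5 * size d + 4) + 7)) +
      Suc (poly p2 (3 * size d + 2) + Suc ((2 + size d * (poly p3 (5 * size d + 4) + 7)) + Suc 0))))
    (Seq (choice_loop c1) (Seq c2 (Seq (choice_loop c3) (Assign 0 (Hd (Tl (Tl (V 0))))))), s1)
    (\<lambda>bs s'. \<exists>xs n J. run (alg_step F I P) (Basic I {}) xs n (Return J) \<and> [] @ bs = map enc xs \<and> s' 0 \<in> encs J)"
  proof (rule safe_seq, rule safe_mono[OF safe_basic_loop[OF c1] order_refl])
    show "basic_rel I {} (s1 0)" using s s1 basic_rel_init by simp
    fix as and s2 :: store assume "\<exists>xs n J'. run (alg_step F I P) (Basic I {}) xs n (Test J') \<and> as = map enc xs \<and>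
       basic_rel {} J' (s2 0)"
    then obtain xs n J where 1: "run (alg_step F I P) (Basic I {}) xs n (Test J)" "as = map enc xs"
      and J: "basic_rel {} J (s2 0)" by blast
    show "safe (Suc (poly p2 (3 * size d + 2) + Suc ((2 + size d * (poly p3 (5 * size d + 4) + 7)) + Suc 0)))
      (Seq c2 (Seq (choice_loop c3) (Assign 0 (Hd (Tl (Tl (V 0)))))), s2)
      (\<lambda>bs s'. \<exists>xs n J. run (alg_step F I P) (Basic I {}) xs n (Return J) \<and> [] @ (as @ bs) = map enc xs \<and> s' 0 \<in> encs J)"
    proof (rule safe_seq, rule computes_safe[OF c2])
      show "poly p2 (size (s2 0)) \<le> poly p2 (3 * size d + 2)"
        by (intro poly_nat_mono basic_rel_size[OF J])
      fix s3 :: store assume s3: "s3 0 = test_tree eR eD \<Delta> (s2 0)"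
      show "safe (Suc ((2 + size d * (poly p3 (5 * size d + 4) + 7)) + Suc 0))
        (Seq (choice_loop c3) (Assign 0 (Hd (Tl (Tl (V 0))))), s3)
        (\<lambda>bs s'. \<exists>xs n J. run (alg_step F I P) (Basic I {}) xs n (Return J) \<and> [] @ (as @ [] @ bs) = map enc xs \<and> s' 0 \<in> encs J)"
      proof (rule safe_seq, rule safe_mono[OF safe_winnow_loop[where s = s3, OF c3 J s3] order_refl])
        fix bs and s4 :: store assume "\<exists>xs n J'. run (alg_step F I P) (Test J) xs n (Return J') \<and> bs = map enc xs \<and>
          hd_tree (tl_tree (tl_tree (s4 0))) \<in> encs J'"
        then obtain ys m J' where 2: "run (alg_step F I P) (Test J) ys m (Return J')" "bs = map enc ys"
          "hd_tree (tl_tree (tl_tree (s4 0))) \<in> encs J'" by blast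
        have "\<exists>zs n J. run (alg_step F I P) (Basic I {}) zs n (Return J) \<and>
          [] @ as @ [] @ bs @ [] = map enc zs \<and> (s4(0 := exp_val s4 (Hd (Tl (Tl (V 0)))))) 0 \<in> encs J"
          using run_append[OF 1(1) 2(1)] 1(2) 2(2,3)
          by (intro exI[of _ "xs @ ys"] exI[of _ "n + m"] exI[of _ J']) simp
        then show "safe (Suc 0) (Assign 0 (Hd (Tl (Tl (V 0)))), s4)
          (\<lambda>cs s'. \<exists>xs n J. run (alg_step F I P) (Basic I {}) xs n (Return J) \<and>
             [] @ (as @ [] @ (bs @ cs)) = map enc xs \<and> s' 0 \<in> encs J)"
          by (rule safe_assign)
      qed
    qed
  qed
qed (simp add: s)

lemma run_repair_program:
  assumes c0: "computes c0 k0 T0 init_tree"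
    and c1: "computes c1 k1 T1 (basic_tree eR eD \<Delta>)"
    and c2: "computes c2 k2 T2 (test_tree eR eD \<Delta>)"
    and c3: "computes c3 k3 T3 (winnow_step_tree eR eD \<Delta>)"
    and s: "s 0 = d"
    and run: "run (alg_step F I P) (Basic I {}) xs m (Return J)"
  shows "\<exists>n s'. run com_step (repair_program c0 c1 c2 c3, s) (map enc xs) n (Skip, s') \<and> s' 0 \<in> encs J"
proof -
  obtain n0 s1 where r0: "run com_step (c0, s) [] n0 (Skip, s1)" and s1: "s1 0 = init_tree d"
    using computes_run[OF c0, of s] s by auto
  obtain as bs v w where xs: "map enc xs = as @ bs"
    and v: "loop_run (basic_tree eR eD \<Delta>) (s1 0) as v"
    and w: "loop_run (winnow_step_tree eR eD \<Delta>) (test_tree eR eD \<Delta> v) bs w"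
    and J: "hd_tree (tl_tree (tl_tree w)) \<in> encs J"
    using run_basic_loop[OF run, of "s1 0"] basic_rel_init s1 by auto
  obtain n1 s2 where r1: "run com_step (choice_loop c1, s1) as n1 (Skip, s2)" and s2: "s2 0 = v"
    using run_choice_loop[OF c1, of s1 as v] v by blast
  obtain n2 s3 where r2: "run com_step (c2, s2) [] n2 (Skip, s3)" and s3: "s3 0 = test_tree eR eD \<Delta> v"
    using computes_run[OF c2, of s2] s2 by auto
  obtain n3 s4 where r3: "run com_step (choice_loop c3, s3) bs n3 (Skip, s4)" and s4: "s4 0 = w"
    using run_choice_loop[OF c3, of s3 bs w] w s3 by auto
  let ?s = "s4(0 := exp_val s4 (Hd (Tl (Tl (V 0)))))"
  obtain m3 where r3: "run com_step (Seq (choice_loop c3) (Assign 0 (Hd (Tl (Tl (V 0))))), s3) bs m3 (Skip, ?s)"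
    using run_Seq[OF r3 run_Assign[of 0 "Hd (Tl (Tl (V 0)))"]] unfolding append_Nil2 by blast
  obtain m2 where r2: "run com_step (Seq c2 (Seq (choice_loop c3) (Assign 0 (Hd (Tl (Tl (V 0)))))), s2) bs m2 (Skip, ?s)"
    using run_Seq[OF r2 r3] by auto
  obtain m1 where r1: "run com_step (Seq (choice_loop c1) (Seq c2 (Seq (choice_loop c3) (Assign 0 (Hd (Tl (Tl (V 0))))))), s1) (as @ bs) m1 (Skip, ?s)"
    using run_Seq[OF r1 r2] by auto
  obtain m0 where "run com_step (repair_program c0 c1 c2 c3, s) (as @ bs) m0 (Skip, ?s)"
    using run_Seq[OF r0 r1] unfolding repair_program_def by auto
  moreover have "?s 0 \<in> encs J" using J s4 by simp
  ultimately show ?thesis unfolding xs by blast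
qed

end

text \<open>The four deterministic parts depend only on the constraints and the two encodings, so
  one program with one polynomial serves all instances and priorities.\<close>

lemma repair_program_exists:
  fixes eR :: "'r \<Rightarrow> tree" and eD :: "'d \<Rightarrow> tree" and F :: "('r, 'd) dc set"
  assumes inj: "inj_on eR (dom S)" "inj eD" and F: "finite F" "\<forall>\<delta> \<in> F. wf_dc S \<delta>"
  shows "\<exists>c. poly_time_on
      (\<Union>{input_encodings eR eD I P | I P. db_instance S I \<and> priority F I P}) c \<and>
    (\<forall>I P. db_instance S I \<and> priority F I P \<longrightarrow> implements_on eR eD F I P c)"
proof -
  obtain \<Delta> where \<Delta>: "set \<Delta> = F" using F(1) finite_list by blast
  have input: "encoded_input S eR eD \<Delta> I P d"
    if "db_instance S I" "priority F I P" "d \<in> input_encodings eR eD I P" for I P d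
    using that inj F(2) \<Delta> by unfold_locales auto
  obtain c0 k0 p0 where c0: "computes c0 k0 (poly p0) init_tree"
    using ptime_init_tree unfolding ptime_def by blast
  have "ptime (basic_tree eR eD \<Delta>)" using ptime_basic_tree[OF ptime_id] .
  then obtain c1 k1 p1 where c1: "computes c1 k1 (poly p1) (basic_tree eR eD \<Delta>)"
    unfolding ptime_def by blast
  obtain c2 k2 p2 where c2: "computes c2 k2 (poly p2) (test_tree eR eD \<Delta>)"
    using ptime_test_tree unfolding ptime_def by blast
  obtain c3 k3 p3 where c3: "computes c3 k3 (poly p3) (winnow_step_tree eR eD \<Delta>)"
    using ptime_winnow_step_tree unfolding ptime_def by blast
  let ?c = "repair_program c0 c1 c2 c3"
  \<comment> \<open>\<open>14\<close> is twice the overhead of 7 steps per round,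
    \<open>[:2, 3:]\<close> and \<open>[:4, 5:]\<close> bound the inputs of the test and of the loop
    bodies, and \<open>9\<close> collects the steps spent once.\<close>
  define p where "p = p0 + pcompose p2 [:2, 3:] + [:0, 14:] + [:0, 1:] * pcompose p1 [:4, 5:] +
     [:0, 1:] * pcompose p3 [:4, 5:] + [:9:]"
  have p: "Suc (poly p0 n + Suc ((2 + n * (poly p1 (5 * n + 4) + 7)) +
      Suc (poly p2 (3 * n + 2) + Suc ((2 + n * (poly p3 (5 * n + 4) + 7)) + Suc 0)))) = poly p n" for n
    by (simp add: p_def poly_pcompose algebra_simps)
  have safe: "safe (poly p (size d)) (start ?c d) (\<lambda>as s'. \<exists>xs n J.
      run (alg_step F I P) (Basic I {}) xs n (Return J) \<and> as = map (enc_fact eR eD) xs \<and>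
      s' 0 \<in> set_encodings (enc_fact eR eD) J)"
    if "db_instance S I" "priority F I P" "d \<in> input_encodings eR eD I P" for I P d
    using encoded_input.safe_repair_program[OF input[OF that] c0 c1 c2 c3, of "(\<lambda>_. Leaf)(0 := d)"]
    unfolding p \<Delta> start_def by simp
  have "poly_time_on (\<Union>{input_encodings eR eD I P | I P. db_instance S I \<and> priority F I P}) ?c"
    unfolding poly_time_on_def using safe_run[OF _ safe] by blast
  moreover have "implements_on eR eD F I P ?c" if IP: "db_instance S I" "priority F I P" for I P
    unfolding implements_on_def
  proof (intro ballI conjI allI impI)
    fix d as n s assume d: "d \<in> input_encodings eR eD I P"
      and run: "run com_step (start ?c d) as n (Skip, s)"
    show "\<exists>xs m J. run (alg_step F I P) (Basic I {}) xs m (Return J) \<and>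
      as = map (enc_fact eR eD) xs \<and> s 0 \<in> set_encodings (enc_fact eR eD) J"
      using safe_run[OF run safe[OF IP d]] by blast
  next
    fix d xs m J assume d: "d \<in> input_encodings eR eD I P"
      and run: "run (alg_step F I P) (Basic I {}) xs m (Return J)"
    show "\<exists>n s. run com_step (start ?c d) (map (enc_fact eR eD) xs) n (Skip, s) \<and>
      s 0 \<in> set_encodings (enc_fact eR eD) J"
      unfolding start_def
      by (rule encoded_input.run_repair_program[OF input[OF IP d] c0 c1 c2 c3])
        (use run \<Delta> in simp_all)
  qed
  ultimately show ?thesis by blast
qed

theorem proposition8:
  fixes S :: "'r schema" and F :: "('r, 'd) dc set"
  assumes "infinite (UNIV :: 'd set)"
    and "wf_schema S"
    and "finite F" and "\<forall>\<delta> \<in> F. wf_dc S \<delta>"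
  shows
    "(\<forall>I P. db_instance S I \<and> priority F I P \<longrightarrow>
        terminating (alg_step F I P) (Basic I {}) \<and>
        (\<forall>xs n J. run (alg_step F I P) (Basic I {}) xs n (Test J) \<longrightarrow> repair F I J) \<and>
        (\<forall>J. (\<exists>xs n. run (alg_step F I P) (Winnow I {}) xs n (Return J)) \<longleftrightarrow>
             completion_optimal F I P J) \<and>
        (\<forall>xs n s. run (alg_step F I P) (Basic I {}) xs n s \<and> halted (alg_step F I P) s \<longrightarrow>
           (\<exists>J. s = Return J \<and> repair F I J \<and> pareto_optimal F I P J)) \<and>
        (\<forall>J. repair F I J \<and> pareto_optimal F I P J \<longrightarrow>
           (\<exists>xs n. run (alg_step F I P) (Basic I {}) xs n (Return J)))) \<and>
     (\<forall>(eR :: 'r \<Rightarrow> tree) (eD :: 'd \<Rightarrow> tree). inj_on eR (dom S) \<and> inj eD \<longrightarrow>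
        (\<exists>c. poly_time_on
               (\<Union>{input_encodings eR eD I P | I P. db_instance S I \<and> priority F I P}) c \<and>
             (\<forall>I P. db_instance S I \<and> priority F I P \<longrightarrow> implements_on eR eD F I P c)))"
proof -
  have F: "\<forall>\<delta> \<in> F. atoms \<delta> \<noteq> []" using assms(4) by (simp add: wf_dc_def)
  have fin: "finite I" if "db_instance S I" for I using that by (simp add: db_instance_def)
  have "\<exists>c. poly_time_on
      (\<Union>{input_encodings eR eD I P | I P. db_instance S I \<and> priority F I P}) c \<and>
      (\<forall>I P. db_instance S I \<and> priority F I P \<longrightarrow> implements_on eR eD F I P c)"
    if "inj_on eR (dom S) \<and> inj eD" for eR :: "'r \<Rightarrow> tree" and eD :: "'d \<Rightarrow> tree"
    using that assms(3,4) by (intro repair_program_exists) auto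
  moreover have "terminating (alg_step F I P) (Basic I {}) \<and>
        (\<forall>xs n J. run (alg_step F I P) (Basic I {}) xs n (Test J) \<longrightarrow> repair F I J) \<and>
        (\<forall>J. (\<exists>xs n. run (alg_step F I P) (Winnow I {}) xs n (Return J)) \<longleftrightarrow>
             completion_optimal F I P J) \<and>
        (\<forall>xs n s. run (alg_step F I P) (Basic I {}) xs n s \<and> halted (alg_step F I P) s \<longrightarrow>
           (\<exists>J. s = Return J \<and> repair F I J \<and> pareto_optimal F I P J)) \<and>
        (\<forall>J. repair F I J \<and> pareto_optimal F I P J \<longrightarrow>
           (\<exists>xs n. run (alg_step F I P) (Basic I {}) xs n (Return J)))"
    if I: "db_instance S I \<and> priority F I P" for I P
  proof (intro conjI allI impI iffI)
    have fin: "finite I" and P: "priority F I P" using I by (auto simp: db_instance_def)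
    show "terminating (alg_step F I P) (Basic I {})" using fin by (rule terminating_alg)
    show "repair F I J" if "run (alg_step F I P) (Basic I {}) xs n (Test J)" for xs n J
      using F that by (rule basic_run_repair)
    show "completion_optimal F I P J" if "\<exists>xs n. run (alg_step F I P) (Winnow I {}) xs n (Return J)" for J
      using winnow_run_completion_optimal[OF F fin P] that by blast
    show "\<exists>xs n. run (alg_step F I P) (Winnow I {}) xs n (Return J)" if "completion_optimal F I P J" for J
      using fin that by (rule completion_optimal_winnow_run)
    show "\<exists>J. s = Return J \<and> repair F I J \<and> pareto_optimal F I P J"
      if "run (alg_step F I P) (Basic I {}) xs n s \<and> halted (alg_step F I P) s" for xs n s
      using alg_sound[OF F fin P] that by blast
    show "\<exists>xs n. run (alg_step F I P) (Basic I {}) xs n (Return J)"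
      if "repair F I J \<and> pareto_optimal F I P J" for J
      using alg_complete[OF fin] that by blast
  qed
  ultimately show ?thesis by blast
qed

end
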